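(* Let $G$ be a connected $K_4$-minor-free graph. Then the following statements are equivalent: (1) $G$ is $1$-perfectly orientable. (2) $G$ is $\{K_{2,3},F_1,F_2\}$-induced-minor-free. (3) Every block of $G$ is a $2$-tree, except possibly one, which is either $K_1$ or a hollowed $2$-tree. (4) $G$ can be constructed from either $K_1$ or a cycle by a sequence of operations $(A_1)$ and $(A_2)$, where $(A_1)$ is: add a new vertex adjacent to exactly one existing vertex; and $(A_2)$ is: add a new vertex adjacent to exactly two existing vertices which are adjacent to each other.
   Context: All graphs are finite and simple. An orientation of a graph $G$ is $1$-perfect if for every vertex $v$ the out-neighborhood of $v$ is a clique in $G$; $G$ is $1$-perfectly orientable if it has a $1$-perfect orientation. $H$ is an induced minor of $G$ if $H$ can be obtained from $G$ by vertex deletions and edge contractions; $G$ is $\mathcal F$-induced-minor-free if no member of $\mathcal F$ is (isomorphic to) an induced minor of $G$. $F_1$ is the graph consisting of two $4$-cycles sharing exactly one edge (vertices $a,b,c,d,e,f$ with edges $ab,bc,cd,da,ce,ef,fd$, i.e. $C_6$ plus a chord joining two antipodal vertices). $F_2$ is the graph consisting of two $4$-cycles sharing exactly one vertex (7 vertices). A block is a maximal biconnected subgraph, where a graph is biconnected if it is connected and has no cut vertex. $2$-trees: $K_2$ is a $2$-tree, and adding to a $2$-tree a new vertex adjacent to exactly two adjacent vertices yields a $2$-tree; there are no others. Hollowed $2$-trees: every cycle of length at least $4$ is a hollowed $2$-tree, and adding to a hollowed $2$-tree a new vertex adjacent to exactly two adjacent vertices yields a hollowed $2$-tree; there are no others.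 *)

theory Defs
  imports Main
begin

type_synonym 'a graph = "'a set \<times> 'a set set"

definition verts :: "'a graph \<Rightarrow> 'a set" where "verts G = fst G"
definition edges :: "'a graph \<Rightarrow> 'a set set" where "edges G = snd G"

definition graph :: "'a graph \<Rightarrow> bool" where
  "graph G \<longleftrightarrow> finite (verts G) \<and>
     (\<forall>e\<in>edges G. \<exists>u v. u \<noteq> v \<and> u \<in> verts G \<and> v \<in> verts G \<and> e = {u, v})"

definition adj :: "'a graph \<Rightarrow> 'a \<Rightarrow> 'a \<Rightarrow> bool" where
  "adj G u v \<longleftrightarrow> {u, v} \<in> edges G"

definition reach :: "'a graph \<Rightarrow> 'a \<Rightarrow> 'a \<Rightarrow> bool" where
  "reach G u v \<longleftrightarrow> u \<in> verts G \<and> (u, v) \<in> {(x, y). adj G x y}\<^sup>*"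

definition connected :: "'a graph \<Rightarrow> bool" where
  "connected G \<longleftrightarrow> verts G \<noteq> {} \<and> (\<forall>u\<in>verts G. \<forall>v\<in>verts G. reach G u v)"

definition delete_vertex :: "'a graph \<Rightarrow> 'a \<Rightarrow> 'a graph" where
  "delete_vertex G v = (verts G - {v}, {e \<in> edges G. v \<notin> e})"

definition delete_edge :: "'a graph \<Rightarrow> 'a set \<Rightarrow> 'a graph" where
  "delete_edge G e = (verts G, edges G - {e})"

definition contract :: "'a graph \<Rightarrow> 'a \<Rightarrow> 'a \<Rightarrow> 'a graph" where
  "contract G u v = (verts G - {v},
     {e \<in> edges G. v \<notin> e} \<union> {{u, w} | w. {v, w} \<in> edges G \<and> w \<noteq> u})"

inductive induced_minor_of :: "'a graph \<Rightarrow> 'a graph \<Rightarrow> bool" where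
  im_refl: "induced_minor_of G G"
| im_del: "induced_minor_of H G \<Longrightarrow> v \<in> verts H \<Longrightarrow> induced_minor_of (delete_vertex H v) G"
| im_contr: "induced_minor_of H G \<Longrightarrow> {u, v} \<in> edges H \<Longrightarrow> u \<noteq> v \<Longrightarrow>
     induced_minor_of (contract H u v) G"

inductive minor_of :: "'a graph \<Rightarrow> 'a graph \<Rightarrow> bool" where
  m_refl: "minor_of G G"
| m_del: "minor_of H G \<Longrightarrow> v \<in> verts H \<Longrightarrow> minor_of (delete_vertex H v) G"
| m_dele: "minor_of H G \<Longrightarrow> e \<in> edges H \<Longrightarrow> minor_of (delete_edge H e) G"
| m_contr: "minor_of H G \<Longrightarrow> {u, v} \<in> edges H \<Longrightarrow> u \<noteq> v \<Longrightarrow>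
     minor_of (contract H u v) G"

definition isomorphic :: "'a graph \<Rightarrow> 'b graph \<Rightarrow> bool" where
  "isomorphic G H \<longleftrightarrow> (\<exists>f. bij_betw f (verts G) (verts H) \<and>
     (\<forall>u\<in>verts G. \<forall>v\<in>verts G. {u, v} \<in> edges G \<longleftrightarrow> {f u, f v} \<in> edges H))"

definition has_induced_minor :: "'a graph \<Rightarrow> 'b graph \<Rightarrow> bool" where
  "has_induced_minor G H \<longleftrightarrow> (\<exists>H'. induced_minor_of H' G \<and> isomorphic H H')"

definition has_minor :: "'a graph \<Rightarrow> 'b graph \<Rightarrow> bool" where
  "has_minor G H \<longleftrightarrow> (\<exists>H'. minor_of H' G \<and> isomorphic H H')"

definition K4 :: "nat graph" where
  "K4 = ({0, 1, 2, 3}, {{i, j} | i j. i \<in> {0, 1, 2, 3} \<and> j \<in> {0, 1, 2, 3} \<and> i \<noteq> j})"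

definition K23 :: "nat graph" where
  "K23 = ({0, 1, 2, 3, 4}, {{i, j} | i j. i \<in> {0, 1} \<and> j \<in> {2, 3, 4}})"

definition F1 :: "nat graph" where
  "F1 = ({0, 1, 2, 3, 4, 5}, {{0, 1}, {1, 2}, {2, 3}, {3, 0}, {2, 4}, {4, 5}, {5, 3}})"

definition F2 :: "nat graph" where
  "F2 = ({0, 1, 2, 3, 4, 5, 6}, {{0, 1}, {1, 2}, {2, 3}, {3, 0}, {0, 4}, {4, 5}, {5, 6}, {6, 0}})"

definition orientation :: "'a graph \<Rightarrow> ('a \<times> 'a) set \<Rightarrow> bool" where
  "orientation G D \<longleftrightarrow> (\<forall>(u, v)\<in>D. {u, v} \<in> edges G) \<and>
     (\<forall>u v. {u, v} \<in> edges G \<longrightarrow> ((u, v) \<in> D \<longleftrightarrow> (v, u) \<notin> D))"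

definition clique :: "'a graph \<Rightarrow> 'a set \<Rightarrow> bool" where
  "clique G S \<longleftrightarrow> S \<subseteq> verts G \<and> (\<forall>u\<in>S. \<forall>v\<in>S. u \<noteq> v \<longrightarrow> {u, v} \<in> edges G)"

definition one_perfect_orientation :: "'a graph \<Rightarrow> ('a \<times> 'a) set \<Rightarrow> bool" where
  "one_perfect_orientation G D \<longleftrightarrow> orientation G D \<and>
     (\<forall>v\<in>verts G. clique G {w. (v, w) \<in> D})"

definition one_perfectly_orientable :: "'a graph \<Rightarrow> bool" where
  "one_perfectly_orientable G \<longleftrightarrow> (\<exists>D. one_perfect_orientation G D)"

definition subgraph :: "'a graph \<Rightarrow> 'a graph \<Rightarrow> bool" where
  "subgraph H G \<longleftrightarrow> verts H \<subseteq> verts G \<and> edges H \<subseteq> edges G \<and> (\<forall>e\<in>edges H. e \<subseteq> verts H)"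

text \<open>A cut vertex is one whose removal increases the number of components, i.e.
  separates two vertices lying in a common component.\<close>
definition cut_vertex :: "'a graph \<Rightarrow> 'a \<Rightarrow> bool" where
  "cut_vertex G v \<longleftrightarrow> v \<in> verts G \<and> (\<exists>x\<in>verts G - {v}. \<exists>y\<in>verts G - {v}.
     reach G x y \<and> \<not> reach (delete_vertex G v) x y)"

definition biconnected :: "'a graph \<Rightarrow> bool" where
  "biconnected G \<longleftrightarrow> connected G \<and> (\<forall>v. \<not> cut_vertex G v)"

definition block :: "'a graph \<Rightarrow> 'a graph \<Rightarrow> bool" where
  "block G B \<longleftrightarrow> subgraph B G \<and> biconnected B \<and>
     (\<forall>B'. subgraph B' G \<and> biconnected B' \<and> subgraph B B' \<longrightarrow> B' = B)"

definition is_cycle :: "'a graph \<Rightarrow> bool" where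
  "is_cycle G \<longleftrightarrow> (\<exists>vs. distinct vs \<and> length vs \<ge> 3 \<and> verts G = set vs \<and>
     edges G = {{vs ! i, vs ! ((i + 1) mod length vs)} | i. i < length vs})"

definition is_K1 :: "'a graph \<Rightarrow> bool" where
  "is_K1 G \<longleftrightarrow> (\<exists>x. G = ({x}, {}))"

inductive two_tree :: "'a graph \<Rightarrow> bool" where
  tt_base: "u \<noteq> v \<Longrightarrow> two_tree ({u, v}, {{u, v}})"
| tt_step: "two_tree (V, E) \<Longrightarrow> {x, y} \<in> E \<Longrightarrow> w \<notin> V \<Longrightarrow>
     two_tree (insert w V, E \<union> {{w, x}, {w, y}})"

inductive hollowed_two_tree :: "'a graph \<Rightarrow> bool" where
  htt_base: "is_cycle G \<Longrightarrow> card (verts G) \<ge> 4 \<Longrightarrow> hollowed_two_tree G"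
| htt_step: "hollowed_two_tree (V, E) \<Longrightarrow> {x, y} \<in> E \<Longrightarrow> w \<notin> V \<Longrightarrow>
     hollowed_two_tree (insert w V, E \<union> {{w, x}, {w, y}})"

inductive A12_constructible :: "'a graph \<Rightarrow> bool" where
  c_K1: "A12_constructible ({x}, {})"
| c_cycle: "is_cycle G \<Longrightarrow> A12_constructible G"
| c_A1: "A12_constructible (V, E) \<Longrightarrow> x \<in> V \<Longrightarrow> w \<notin> V \<Longrightarrow>
     A12_constructible (insert w V, insert {w, x} E)"
| c_A2: "A12_constructible (V, E) \<Longrightarrow> {x, y} \<in> E \<Longrightarrow> w \<notin> V \<Longrightarrow>
     A12_constructible (insert w V, E \<union> {{w, x}, {w, y}})"

end

theory Submission
  imports Defs
begin

text \<open>The four statements are linked by (4) \<Longrightarrow> (1) \<Longrightarrow> (2) \<Longrightarrow> (4) and (4) \<Longrightarrow> (3) \<Longrightarrow> (4).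

  1-perfect orientability survives induced minors, and a triangle-free graph with more edges than
  vertices is not 1-perfectly orientable; this gives (1) \<Longrightarrow> (2).

  For the two implications into (4), remove simplicial vertices one at a time. If none is left
  and the graph has more than one vertex, Dirac's theorem provides a hole (an induced cycle of length
  at least 4) \<open>C\<close>. If the graph is not just \<open>C\<close>, take a component \<open>K\<close> of the rest. Its
  attachments on \<open>C\<close> form a clique of size 1 or 2: three attachments give a \<open>K\<^sub>4\<close> minor, and two
  nonadjacent ones give an induced \<open>K\<^sub>2\<^sub>,\<^sub>3\<close> minor as well as a second hole. Applying Dirac's theorem
  to \<open>K\<close> together with its attachments, which has no simplicial vertex in \<open>K\<close>, yields a second
  hole there. Under (2) the two holes form an induced minor \<open>F\<^sub>1\<close> or \<open>F\<^sub>2\<close>; under (3) all holes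
  lie in the only block that is not a 2-tree, and a hollowed 2-tree has only one hole.\<close>

section \<open>Connected vertex sets, induced paths and holes\<close>

text \<open>The edge set \<open>E\<close> stays fixed and only vertex sets vary, so passing to an
  induced subgraph means replacing a set. Minors are exhibited by branch sets and translated into
  deletions and contractions once. As \<open>K4\<close> is complete, it is used only as an excluded
  induced minor. The obstacle is that a simplicial vertex of \<open>K\<close> together with its
  attachments may be an attachment, which has further neighbours on the hole. Hence Dirac's theorem
  is proved in a form that avoids a prescribed clique. A vertex found in \<open>K\<close> itself has
  no neighbours elsewhere, so it is simplicial in the whole graph, and exclusion of
  \<open>K4\<close> limits its degree to two. Statements (2) and (3) enter the induction only
  through two hereditary conditions: attachments on a hole are pairwise adjacent, and
  \<open>K\<close> with its attachments contains no hole. One induction therefore serves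
  both.\<close>

text \<open>Cuts are used instead of walks, so that unions, contractions and deletions are handled
  by following one cut; \<open>conn_iff_reach\<close> gives the link to \<open>reach\<close>. The
  empty set counts as connected, which makes deletion of the only vertex harmless in
  \<open>biconnected_iff\<close>.\<close>

definition conn :: "'a set set \<Rightarrow> 'a set \<Rightarrow> bool" where
  "conn E X \<longleftrightarrow> (\<forall>P\<subseteq>X. P \<noteq> {} \<and> P \<noteq> X \<longrightarrow> (\<exists>a\<in>P. \<exists>b\<in>X - P. {a, b} \<in> E))"

definition linked :: "'a set set \<Rightarrow> 'a set \<Rightarrow> 'a set \<Rightarrow> bool" where
  "linked E X Y \<longleftrightarrow> (\<exists>x\<in>X. \<exists>y\<in>Y. {x, y} \<in> E)"

lemma connI:
  assumes "\<And>P. P \<subseteq> X \<Longrightarrow> P \<noteq> {} \<Longrightarrow> P \<noteq> X \<Longrightarrow> \<exists>a\<in>P. \<exists>b\<in>X - P. {a, b} \<in> E"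
  shows "conn E X"
  using assms unfolding conn_def by blast

lemma connD:
  assumes "conn E X" "P \<subseteq> X" "P \<noteq> {}" "P \<noteq> X"
  obtains a b where "a \<in> P" "b \<in> X" "b \<notin> P" "{a, b} \<in> E"
  using assms unfolding conn_def by blast

lemma linked_sym: "linked E X Y \<longleftrightarrow> linked E Y X"
  unfolding linked_def by (metis insert_commute)

lemma linked_Un_left [simp]: "linked E (X \<union> X') Y \<longleftrightarrow> linked E X Y \<or> linked E X' Y"
  unfolding linked_def by blast

lemma linked_Un_right [simp]: "linked E X (Y \<union> Y') \<longleftrightarrow> linked E X Y \<or> linked E X Y'"
  unfolding linked_def by blast

lemma conn_empty [simp]: "conn E {}"
  unfolding conn_def by blast

lemma conn_singleton [simp]: "conn E {x}"
  unfolding conn_def by blast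

text \<open>A cut that splits \<open>X\<close> or \<open>Y\<close> is crossed inside that set. A cut
  that splits neither has \<open>X\<close> on one side and \<open>Y\<close> on the other, so they
  are disjoint and hence linked.\<close>

lemma conn_Un:
  assumes X: "conn E X" and Y: "conn E Y" and XY: "X \<inter> Y \<noteq> {} \<or> linked E X Y"
  shows "conn E (X \<union> Y)"
proof (rule connI)
  fix P assume P: "P \<subseteq> X \<union> Y" "P \<noteq> {}" "P \<noteq> X \<union> Y"
  show "\<exists>a\<in>P. \<exists>b\<in>X \<union> Y - P. {a, b} \<in> E"
  proof (cases "(P \<inter> X = {} \<or> X \<subseteq> P) \<and> (P \<inter> Y = {} \<or> Y \<subseteq> P)")
    case True
    then consider "X \<subseteq> P" "P \<inter> Y = {}" | "Y \<subseteq> P" "P \<inter> X = {}" using P by blast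
    then show ?thesis
    proof cases
      case 1
      with XY P have "linked E X Y" by blast
      with 1 show ?thesis unfolding linked_def by blast
    next
      case 2
      with XY P have "linked E Y X" using linked_sym by blast
      with 2 show ?thesis unfolding linked_def by blast
    qed
  next
    case False
    then consider "P \<inter> X \<noteq> {}" "\<not> X \<subseteq> P" | "P \<inter> Y \<noteq> {}" "\<not> Y \<subseteq> P" by blast
    then show ?thesis
    proof cases
      case 1
      then obtain a b where "a \<in> P \<inter> X" "b \<in> X" "b \<notin> P \<inter> X" "{a, b} \<in> E"
        using connD[OF X, of "P \<inter> X"] by blast
      then show ?thesis by blast
    next
      case 2
      then obtain a b where "a \<in> P \<inter> Y" "b \<in> Y" "b \<notin> P \<inter> Y" "{a, b} \<in> E"
        using connD[OF Y, of "P \<inter> Y"] by blast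
      then show ?thesis by blast
    qed
  qed
qed

lemma conn_insert:
  assumes "conn E X" "x \<in> X" "{w, x} \<in> E"
  shows "conn E (insert w X)"
  using conn_Un[of E "{w}" X] assms by (auto simp: linked_def)

lemma conn_mono: "conn E X \<Longrightarrow> E \<subseteq> F \<Longrightarrow> conn F X"
  unfolding conn_def by blast

lemma conn_iff_linked:
  "conn E X \<longleftrightarrow> (\<forall>P\<subseteq>X. P \<noteq> {} \<and> P \<noteq> X \<longrightarrow> linked E P (X - P))"
  unfolding conn_def linked_def by blast

lemma conn_linked_sub:
  assumes "conn E X" "A \<subseteq> X" "A \<noteq> {}" "X - A \<noteq> {}"
  shows "linked E A (X - A)"
  using assms unfolding conn_def linked_def by (metis Diff_eq_empty_iff order_refl)

text \<open>A path through \<open>w\<close> can be shortcut, because its neighbours are adjacent. In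
  terms of cuts: if \<open>P\<close> contains a neighbour \<open>x\<close> of \<open>w\<close>, then
  \<open>w\<close> is put on the side of \<open>P\<close>, and an edge leaving from \<open>w\<close>
  to \<open>b\<close> is replaced by the edge from \<open>x\<close> to \<open>b\<close>.\<close>

lemma conn_remove_simplicial:
  assumes X: "conn E X"
    and cl: "\<And>x y. x \<in> X \<Longrightarrow> y \<in> X \<Longrightarrow> x \<noteq> y \<Longrightarrow> x \<noteq> w \<Longrightarrow> y \<noteq> w \<Longrightarrow> {w, x} \<in> E \<Longrightarrow> {w, y} \<in> E \<Longrightarrow> {x, y} \<in> E"
  shows "conn E (X - {w})"
proof (rule connI)
  fix P assume P: "P \<subseteq> X - {w}" "P \<noteq> {}" "P \<noteq> X - {w}"
  show "\<exists>a\<in>P. \<exists>b\<in>X - {w} - P. {a, b} \<in> E"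
  proof (cases "\<exists>x\<in>P. {w, x} \<in> E")
    case True
    then obtain x where x: "x \<in> P" "{w, x} \<in> E" by blast
    show ?thesis
    proof (cases "w \<in> X")
      case True
      have "insert w P \<subseteq> X" "insert w P \<noteq> {}" "insert w P \<noteq> X" using P True by auto
      then obtain a b where ab: "a \<in> insert w P" "b \<in> X" "b \<notin> insert w P" "{a, b} \<in> E"
        using connD[OF X] by metis
      show ?thesis
      proof (cases "a = w")
        case True
        then have "{x, b} \<in> E" using cl[of x b] ab x P by blast
        then show ?thesis using ab x by blast
      next
        case False then show ?thesis using ab by blast
      qed
    next
      case False
      then have "P \<subseteq> X" "P \<noteq> X" using P by auto
      then obtain a b where "a \<in> P" "b \<in> X" "b \<notin> P" "{a, b} \<in> E"
        using connD[OF X] P by metis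
      then show ?thesis using False by blast
    qed
  next
    case False
    have "P \<subseteq> X" "P \<noteq> X" using P by auto
    then obtain a b where "a \<in> P" "b \<in> X" "b \<notin> P" "{a, b} \<in> E"
      using connD[OF X] P by metis
    then show ?thesis using False by (metis Diff_iff insert_commute singletonD)
  qed
qed

lemma component_exists:
  assumes "finite U" "x \<in> U"
  obtains Z where "x \<in> Z" "Z \<subseteq> U" "conn E Z" "\<forall>a\<in>Z. \<forall>b\<in>U. {a, b} \<in> E \<longrightarrow> b \<in> Z"
proof -
  let ?F = "{Z. x \<in> Z \<and> Z \<subseteq> U \<and> conn E Z}"
  have "finite ?F" using assms by auto
  moreover have "{x} \<in> ?F" using assms by auto
  then have "?F \<noteq> {}" by blast
  ultimately have "\<exists>Z\<in>?F. \<forall>Y\<in>?F. Z \<subseteq> Y \<longrightarrow> Z = Y" by (rule finite_has_maximal)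
  then obtain Z where Z: "Z \<in> ?F" "\<forall>Y\<in>?F. Z \<subseteq> Y \<longrightarrow> Z = Y" by blast
  have "b \<in> Z" if "a \<in> Z" "b \<in> U" "{a, b} \<in> E" for a b
  proof -
    have "insert b Z \<in> ?F" using that Z(1) conn_insert[of E Z a b] by (auto simp: insert_commute)
    from Z(2)[rule_format, OF this] show ?thesis by blast
  qed
  then have "\<forall>a\<in>Z. \<forall>b\<in>U. {a, b} \<in> E \<longrightarrow> b \<in> Z" by blast
  moreover have "x \<in> Z" "Z \<subseteq> U" "conn E Z" using Z(1) by auto
  ultimately show ?thesis by (intro that)
qed

text \<open>\<open>Y\<close> is the component of \<open>y\<close> in \<open>Z - {x}\<close>. The
  rest is connected because every other component of \<open>Z - {x}\<close> is joined to
  \<open>x\<close>.\<close>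

lemma conn_split:
  assumes "finite Z" "conn E Z" "x \<in> Z" "y \<in> Z" "x \<noteq> y"
  obtains X Y where "Z = X \<union> Y" "X \<inter> Y = {}" "conn E X" "conn E Y" "x \<in> X" "y \<in> Y"
proof -
  have "finite (Z - {x})" "y \<in> Z - {x}" using assms by auto
  then obtain Y where Y: "y \<in> Y" "Y \<subseteq> Z - {x}" "conn E Y"
      "\<forall>a\<in>Y. \<forall>b\<in>Z - {x}. {a, b} \<in> E \<longrightarrow> b \<in> Y"
    using component_exists[of "Z - {x}" y E] by metis
  have "conn E (Z - Y)"
  proof (rule connI, rule ccontr)
    fix P assume P: "P \<subseteq> Z - Y" "P \<noteq> {}" "P \<noteq> Z - Y" and no: "\<not> (\<exists>a\<in>P. \<exists>b\<in>Z - Y - P. {a, b} \<in> E)"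
    \<comment> \<open>\<open>R\<close> is the side of the cut that misses \<open>x\<close>. An edge
      leaving it inside \<open>Z\<close> can only end in \<open>Y\<close>, and since
      \<open>Y\<close> is closed in \<open>Z - {x}\<close>, its other end would lie in
      \<open>Y\<close> as well.\<close>
    define R where "R = (if x \<in> P then Z - Y - P else P)"
    have R: "R \<subseteq> Z - Y" "R \<noteq> {}" "R \<noteq> Z" "x \<notin> R" using P Y(1,2) assms unfolding R_def by auto
    have noR: "{a, b} \<notin> E" if "a \<in> R" "b \<in> Z - Y - R" for a b
      using that no P unfolding R_def by (auto split: if_splits simp: insert_commute)
    have "R \<subseteq> Z" using R by blast
    then obtain a b where ab: "a \<in> R" "b \<in> Z" "b \<notin> R" "{a, b} \<in> E" using connD[OF assms(2)] R by metis
    then have "b \<in> Y" using noR by blast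
    moreover have "{b, a} \<in> E" "a \<in> Z - {x}" using ab R by (auto simp: insert_commute)
    ultimately have "a \<in> Y" using Y(4) by blast
    then show False using ab R by blast
  qed
  then show ?thesis using that[of "Z - Y" Y] Y assms by blast
qed

section \<open>Induced paths and induced cycles as lists\<close>

fun ipath :: "'a set set \<Rightarrow> 'a list \<Rightarrow> bool" where
  "ipath E [] \<longleftrightarrow> True"
| "ipath E (x # xs) \<longleftrightarrow> x \<notin> set xs \<and> (\<forall>y\<in>set xs. {x, y} \<in> E \<longleftrightarrow> y = hd xs) \<and> ipath E xs"

lemma ipath_append:
  "ipath E (xs @ ys) \<longleftrightarrow> ipath E xs \<and> ipath E ys \<and> set xs \<inter> set ys = {} \<and>
     (\<forall>x\<in>set xs. \<forall>y\<in>set ys. {x, y} \<in> E \<longleftrightarrow> x = last xs \<and> y = hd ys)"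
proof (induction xs)
  case (Cons x xs)
  show ?case
  proof (cases "xs = []")
    case False
    then have "last xs \<in> set xs" "hd xs \<in> set xs" by auto
    then have "hd xs \<notin> set ys" if "set xs \<inter> set ys = {}" using that by blast
    with False Cons \<open>last xs \<in> set xs\<close> \<open>hd xs \<in> set xs\<close> show ?thesis by auto
  qed (auto)
qed simp

lemma ipath_distinct: "ipath E xs \<Longrightarrow> distinct xs"
  by (induction xs) auto

lemma ipath_rev: "ipath E (rev xs) \<longleftrightarrow> ipath E xs"
proof (induction xs)
  case (Cons x xs)
  then show ?case
    by (cases "xs = []") (auto simp: ipath_append last_rev insert_commute)
qed simp

lemma conn_ipath: "ipath E xs \<Longrightarrow> conn E (set xs)"
proof (induction xs)
  case (Cons x xs)
  then show ?case
    using conn_insert[of E "set xs" "hd xs" x] by (cases "xs = []") auto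
qed simp

text \<open>Instead of choosing a shortest path, \<open>P\<close> collects the ends of all induced
  paths from \<open>s\<close> within \<open>Z\<close>. No edge leaves \<open>P\<close>, since a path
  ending next to \<open>b\<close> can be trimmed and prolonged to \<open>b\<close>.\<close>

lemma conn_imp_ipath:
  assumes Z: "conn E Z" "s \<in> Z" "t \<in> Z"
  obtains xs where "ipath E xs" "xs \<noteq> []" "hd xs = s" "last xs = t" "set xs \<subseteq> Z"
proof -
  define Q where "Q xs \<longleftrightarrow> ipath E xs \<and> xs \<noteq> [] \<and> hd xs = s \<and> set xs \<subseteq> Z" for xs
  define P where "P = {last xs | xs. Q xs}"
  have sub: "set xs \<subseteq> P" if "Q xs" for xs
  proof
    fix x assume "x \<in> set xs"
    then obtain us vs where xs: "xs = (us @ [x]) @ vs" by (metis append.assoc append_Cons append_Nil split_list)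
    have "ipath E (us @ [x])" using that unfolding Q_def xs ipath_append[of E "us @ [x]"] by blast
    then have "Q (us @ [x])" using that unfolding Q_def xs by (cases us) auto
    then show "x \<in> P" unfolding P_def by force
  qed
  have "P \<subseteq> Z" unfolding P_def Q_def by fastforce
  moreover have "Q [s]" using Z unfolding Q_def by auto
  then have "s \<in> P" using sub by fastforce
  moreover have "P = Z"
  proof (rule ccontr)
    assume "P \<noteq> Z"
    then obtain a b where ab: "a \<in> P" "b \<in> Z" "b \<notin> P" "{a, b} \<in> E"
      using connD[OF Z(1), of P] \<open>P \<subseteq> Z\<close> \<open>s \<in> P\<close> by blast
    then obtain xs where xs: "Q xs" "a = last xs" unfolding P_def by blast
    then have "\<exists>x\<in>set xs. {x, b} \<in> E" using ab unfolding Q_def by auto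
    \<comment> \<open>Cutting at the first vertex adjacent to \<open>b\<close> keeps the path
      induced when \<open>b\<close> is appended.\<close>
    then obtain us v vs where spl: "xs = us @ v # vs" "{v, b} \<in> E" "\<forall>u\<in>set us. {u, b} \<notin> E"
      using split_list_first_prop[of xs "\<lambda>x. {x, b} \<in> E"] by blast
    have "b \<notin> set xs" using sub xs(1) ab by blast
    have "xs = (us @ [v]) @ vs" using spl by simp
    then have "ipath E (us @ [v])" using xs(1) ipath_append unfolding Q_def by metis
    then have "ipath E (us @ [v, b])" using spl \<open>b \<notin> set xs\<close> unfolding ipath_append
      by auto
    then have "Q (us @ [v, b])" using xs(1) ab spl unfolding Q_def by (cases us) auto
    then have "b \<in> P" unfolding P_def by force
    then show False using ab by blast
  qed
  ultimately have "t \<in> P" using Z by blast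
  then show ?thesis using that unfolding P_def Q_def by blast
qed

lemma ipath_through:
  assumes X: "conn E X" "linked E {s} X" "linked E X {t}" "s \<notin> X" "t \<notin> X" "s \<noteq> t" "{s, t} \<notin> E"
  obtains xs where "ipath E (s # xs @ [t])" "xs \<noteq> []" "set xs \<subseteq> X"
proof -
  have "conn E (insert t X)" using X(1,3) conn_insert[of E X _ t] unfolding linked_def by (metis insert_commute singletonD)
  then have "conn E (insert s (insert t X))" using X(2) conn_insert[of E "insert t X" _ s] unfolding linked_def by blast
  then obtain zs where zs: "ipath E zs" "zs \<noteq> []" "hd zs = s" "last zs = t" "set zs \<subseteq> insert s (insert t X)"
    using conn_imp_ipath[of E "insert s (insert t X)" s t] by blast
  then obtain ys where "zs = s # ys" by (cases zs) auto
  moreover have "ys \<noteq> []" using zs X(6) calculation by auto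
  then obtain xs where "ys = xs @ [t]" using zs calculation by (metis append_butlast_last_id last_ConsR)
  ultimately have zse: "zs = s # xs @ [t]" by simp
  moreover have "distinct zs" using zs ipath_distinct by blast
  ultimately have "set xs \<subseteq> X" using zs by auto
  moreover have "xs \<noteq> []" using zs(1) X(7) unfolding zse by auto
  ultimately show ?thesis using that zs(1) unfolding zse by blast
qed

text \<open>An induced cycle of length at least 4, cut open at the root \<open>r\<close>. The choice
  of the root is immaterial by \<open>hole_rotate\<close>, the direction by
  \<open>hole_rev\<close>.\<close>

fun hole :: "'a set set \<Rightarrow> 'a list \<Rightarrow> bool" where
  "hole E [] \<longleftrightarrow> False"
| "hole E (r # zs) \<longleftrightarrow> 3 \<le> length zs \<and> r \<notin> set zs \<and>
     (\<forall>z\<in>set zs. {r, z} \<in> E \<longleftrightarrow> z = hd zs \<or> z = last zs) \<and> ipath E zs"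

lemma hole_rotate1: "hole E (r # zs) \<Longrightarrow> hole E (zs @ [r])"
proof -
  assume h: "hole E (r # zs)"
  then obtain a bs where zs: "zs = a # bs" by (cases zs) auto
  with h have "bs \<noteq> []" by auto
  then have "hd bs \<in> set bs" "last bs \<in> set bs" by auto
  show ?thesis using h \<open>bs \<noteq> []\<close> \<open>hd bs \<in> set bs\<close> \<open>last bs \<in> set bs\<close> unfolding zs
    by (auto simp: ipath_append insert_commute)
qed

lemma hole_rotate: "hole E (us @ vs) \<Longrightarrow> hole E (vs @ us)"
proof (induction us arbitrary: vs)
  case (Cons u us)
  then have "hole E (us @ vs @ [u])" using hole_rotate1[of E u "us @ vs"] by simp
  then show ?case using Cons.IH[of "vs @ [u]"] by simp
qed simp

lemma hole_rotate_to:
  assumes "hole E cs" "c \<in> set cs"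
  obtains zs where "hole E (c # zs)" "set cs = insert c (set zs)"
proof -
  obtain us vs where cs: "cs = us @ c # vs" using assms(2) by (metis split_list)
  then have "hole E (c # vs @ us)" using hole_rotate[of E us "c # vs"] assms by simp
  then show ?thesis using that[of "vs @ us"] cs by (simp del: hole.simps add: Un_commute)
qed

lemma hole_rev: "hole E (r # zs) \<Longrightarrow> hole E (r # rev zs)"
  by (cases "zs = []") (auto simp: ipath_rev hd_rev last_rev)

lemma hole_rotate_to2:
  assumes "hole E cs" "c \<in> set cs" "d \<in> set cs" "{c, d} \<in> E" "c \<noteq> d"
  obtains zs where "hole E (c # d # zs)" "set cs = insert c (insert d (set zs))"
proof -
  obtain zs where zs: "hole E (c # zs)" "set cs = insert c (set zs)"
    using hole_rotate_to assms by metis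
  then have "zs \<noteq> []" and d: "d = hd zs \<or> d = last zs" using assms by auto
  show ?thesis
  proof (cases "d = hd zs")
    case True
    then show ?thesis using that[of "tl zs"] zs \<open>zs \<noteq> []\<close> by (cases zs) auto
  next
    case False
    then have "d = hd (rev zs)" using d by (simp add: hd_rev)
    then have "rev zs = d # tl (rev zs)" using \<open>zs \<noteq> []\<close> by (metis list.collapse rev_is_Nil_conv)
    moreover have "set zs = set (rev zs)" by simp
    ultimately show ?thesis using that[of "tl (rev zs)"] zs hole_rev[OF zs(1)] by (metis list.simps(15))
  qed
qed

lemma hole_cases:
  assumes "hole E (c # zs)"
  obtains a b ws where "zs = a # b # ws" "ws \<noteq> []"
  using assms by (cases zs; cases "tl zs"; cases "tl (tl zs)") auto

lemma hole_nbrs: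
  assumes "hole E cs" "v \<in> set cs"
  obtains a b where "a \<in> set cs" "b \<in> set cs" "a \<noteq> b" "{v, a} \<in> E" "{v, b} \<in> E" "{a, b} \<notin> E"
    "\<forall>z\<in>set cs. z \<noteq> v \<longrightarrow> {v, z} \<in> E \<longrightarrow> z = a \<or> z = b"
proof -
  obtain zs where zs: "hole E (v # zs)" "set cs = insert v (set zs)"
    using hole_rotate_to assms by metis
  then obtain a b ws where ab: "zs = a # b # ws" "ws \<noteq> []" using hole_cases by metis
  have l: "last ws \<in> set ws" using ab by simp
  have "a \<noteq> last ws" "{v, a} \<in> E" "{v, last ws} \<in> E" "last ws \<noteq> b \<Longrightarrow> {a, last ws} \<notin> E" "b \<noteq> last ws"
    using zs ab l by auto
  moreover have "z = a \<or> z = last ws" if "z \<in> set cs" "z \<noteq> v" "{v, z} \<in> E" for z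
    using that zs ab by auto
  ultimately show ?thesis using that[of a "last ws"] zs ab l by auto
qed

lemma hole_distinct: "hole E cs \<Longrightarrow> distinct cs"
  by (cases cs) (auto simp: ipath_distinct)

lemma conn_hole:
  assumes "hole E cs"
  shows "conn E (set cs)"
proof -
  obtain r zs where cs: "cs = r # zs" using assms by (cases cs) auto
  have "hd zs \<in> set zs" using assms cs by (cases zs) auto
  then show ?thesis using conn_insert[of E "set zs" "hd zs" r] conn_ipath[of E zs] assms cs by auto
qed

lemma conn_hole_remove:
  assumes "hole E cs"
  shows "conn E (set cs - {v})"
proof (cases "v \<in> set cs")
  case True
  then obtain zs where "hole E (v # zs)" "set cs = insert v (set zs)"
    using hole_rotate_to assms by metis
  then show ?thesis using conn_ipath[of E zs] by simp
qed (use conn_hole assms in auto)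

text \<open>The two neighbours of \<open>c\<close> on a hole are nonadjacent, so no third vertex
  fits beside \<open>c\<close> and \<open>d\<close>.\<close>

lemma hole_clique:
  assumes "hole E cs" "A \<subseteq> set cs" "\<And>x y. x \<in> A \<Longrightarrow> y \<in> A \<Longrightarrow> x \<noteq> y \<Longrightarrow> {x, y} \<in> E" "c \<in> A" "d \<in> A" "c \<noteq> d"
  shows "A = {c, d}"
proof -
  have cd: "{c, d} \<in> E" using assms by blast
  have "c \<in> set cs" using assms by blast
  then obtain a b where ab: "a \<in> set cs" "b \<in> set cs" "a \<noteq> b" "{c, a} \<in> E" "{c, b} \<in> E" "{a, b} \<notin> E"
    "\<forall>z\<in>set cs. z \<noteq> c \<longrightarrow> {c, z} \<in> E \<longrightarrow> z = a \<or> z = b"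
    by (rule hole_nbrs[OF assms(1)])
  have "x = c \<or> x = d" if "x \<in> A" for x
  proof (rule ccontr)
    assume "\<not> ?thesis"
    then have "{c, x} \<in> E" "{x, d} \<in> E" "x \<in> set cs" "d \<in> set cs" "x \<noteq> c" "x \<noteq> d" using assms that by auto
    then have "x = a \<or> x = b" "d = a \<or> d = b" using ab(7) cd assms by auto
    then show False using ab(6) \<open>{x, d} \<in> E\<close> \<open>x \<noteq> d\<close> by (auto simp: insert_commute)
  qed
  then show ?thesis using assms by blast
qed

text \<open>The second path is run backwards to close the cycle at \<open>s\<close>; nonempty
  interiors give length at least 4.\<close>

lemma hole_from_two_paths:
  assumes s: "ipath E (s # xs @ [t])" "ipath E (s # ys @ [t])" "xs \<noteq> []" "ys \<noteq> []"
    and "set xs \<inter> set ys = {}" "\<not> linked E (set xs) (set ys)"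
  shows "hole E (s # xs @ t # rev ys)"
proof -
  have "ipath E (s # ys)" "ipath E (ys @ [t])" "ipath E (xs @ [t])"
    using s ipath_append[of E "s # ys" "[t]"] by auto
  moreover have "hd ys \<in> set ys" "last ys \<in> set ys" "hd xs \<in> set xs" "last xs \<in> set xs" using s by auto
  moreover have "length xs \<ge> 1" "length ys \<ge> 1" using s by (auto simp: Suc_le_eq)
  ultimately have "ipath E ((xs @ [t]) @ rev ys)"
    using assms unfolding ipath_append[of E "xs @ [t]" "rev ys"]
    by (auto simp: ipath_append ipath_rev hd_rev linked_def insert_commute)
  moreover have t: "t \<notin> set xs" "t \<notin> set ys"
    using ipath_distinct[OF s(1)] ipath_distinct[OF s(2)] by auto
  have "hd xs \<notin> set ys" "hd ys \<notin> set xs" "t \<noteq> hd xs" "t \<noteq> hd ys"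
    using assms(5) t \<open>hd ys \<in> set ys\<close> \<open>hd xs \<in> set xs\<close> by blast+
  moreover have "s \<notin> set xs" "s \<notin> set ys" "s \<noteq> t" "{s, t} \<notin> E"
      "\<forall>z\<in>set xs. {s, z} \<in> E \<longleftrightarrow> z = hd xs" "\<forall>z\<in>set ys. {s, z} \<in> E \<longleftrightarrow> z = hd ys"
    using s \<open>t \<noteq> hd xs\<close> by auto
  moreover have "3 \<le> length (xs @ t # rev ys)" using \<open>length xs \<ge> 1\<close> \<open>length ys \<ge> 1\<close> by simp
  moreover have "hd (xs @ t # rev ys) = hd xs" "last (xs @ t # rev ys) = hd ys"
    using s by (auto simp: last_rev)
  ultimately show ?thesis unfolding hole.simps
    by (auto simp del: hd_append last_append)
qed

section \<open>Simplicial vertices\<close>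

text \<open>An induced path from \<open>s\<close> to \<open>t\<close> through \<open>X\<close> and
  the path through \<open>r\<close> close up to a hole, since \<open>r\<close> sees nothing of
  \<open>X\<close>.\<close>

lemma hole_via_vertex:
  assumes X: "conn E X" "linked E {s} X" "linked E {t} X" and r: "\<not> linked E {r} X"
    and ne: "r \<notin> X" "s \<notin> X" "t \<notin> X" "s \<noteq> t" "s \<noteq> r" "t \<noteq> r"
    and st: "{s, t} \<notin> E" "{s, r} \<in> E" "{t, r} \<in> E"
  shows "\<exists>cs. hole E cs \<and> set cs \<subseteq> insert r (insert s (insert t X))"
proof -
  have "linked E X {t}" using X(3) linked_sym by blast
  then obtain xs where xs: "ipath E (s # xs @ [t])" "xs \<noteq> []" "set xs \<subseteq> X"
    using ipath_through[OF X(1,2)] ne st by metis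
  have "ipath E (s # [r] @ [t])" using ne st by (auto simp: insert_commute)
  moreover have "\<not> linked E (set xs) (set [r])"
    using r xs(3) unfolding linked_def by (auto simp: insert_commute)
  moreover have "set xs \<inter> set [r] = {}" using xs(3) ne by auto
  ultimately have "hole E (s # xs @ t # rev [r])"
    using hole_from_two_paths[OF xs(1), of "[r]"] xs(2) by blast
  moreover have "set (s # xs @ t # rev [r]) \<subseteq> insert r (insert s (insert t X))" using xs(3) by auto
  ultimately show ?thesis by blast
qed

text \<open>Dirac's theorem: if \<open>X \<ni> a\<close> is a largest connected set that does not dominate \<open>V\<close>, then its
  neighbourhood is a clique completely joined to the undominated part \<open>R\<close>, so that a simplicial
  vertex of \<open>R\<close> is simplicial in \<open>V\<close>.\<close>

lemma simplicial_vertex_exists: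
  assumes "finite V" "\<not> (\<exists>cs. hole E cs \<and> set cs \<subseteq> V)"
    and "A \<subset> V" "\<forall>x\<in>A. \<forall>y\<in>A. x \<noteq> y \<longrightarrow> {x, y} \<in> E"
  shows "\<exists>r\<in>V - A. \<forall>x\<in>V - {r}. \<forall>y\<in>V - {r}. x \<noteq> y \<longrightarrow> {r, x} \<in> E \<longrightarrow> {r, y} \<in> E \<longrightarrow> {x, y} \<in> E"
  using assms
proof (induction V arbitrary: A rule: finite_psubset_induct)
  case (psubset V)
  note clA = psubset.prems(3)
  have IH: "\<exists>r\<in>R. \<forall>x\<in>R - {r}. \<forall>y\<in>R - {r}. x \<noteq> y \<longrightarrow> {r, x} \<in> E \<longrightarrow> {r, y} \<in> E \<longrightarrow> {x, y} \<in> E"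
    if "R \<subset> V" "R \<noteq> {}" for R
  proof -
    have "\<not> (\<exists>cs. hole E cs \<and> set cs \<subseteq> R)" using psubset.prems(1) that(1) by blast
    moreover have "{} \<subset> R" using that(2) by blast
    ultimately show ?thesis using psubset.IH[OF that(1), of "{}"] by simp
  qed
  show ?case
  \<comment> \<open>That \<open>A\<close> lies in the closed neighbourhood of \<open>a\<close> will
    keep the simplicial vertex out of \<open>A\<close>: it is found outside a connected set
    \<open>X\<close> containing \<open>a\<close> and has no neighbour in \<open>X\<close>.\<close>
  proof (cases "\<exists>a\<in>V. A \<subseteq> insert a {x. {a, x} \<in> E} \<and> (\<exists>b\<in>V. b \<noteq> a \<and> {a, b} \<notin> E)")
    case True
    then obtain a b where ab: "a \<in> V" "A \<subseteq> insert a {x. {a, x} \<in> E}" "b \<in> V" "b \<noteq> a" "{a, b} \<notin> E"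
      by blast
    define rest where "rest X = {r \<in> V. r \<notin> X \<and> \<not> linked E {r} X}" for X
    let ?F = "{X. a \<in> X \<and> X \<subseteq> V \<and> conn E X \<and> rest X \<noteq> {}}"
    have "{b, a} \<notin> E" using ab(5) by (simp add: insert_commute)
    then have "b \<in> rest {a}" using ab unfolding rest_def linked_def by blast
    then have "{a} \<in> ?F" using ab by auto
    then have "?F \<noteq> {}" by blast
    have "finite ?F" using psubset.hyps by auto
    then have "\<exists>X\<in>?F. \<forall>Y\<in>?F. X \<subseteq> Y \<longrightarrow> X = Y" using \<open>?F \<noteq> {}\<close> by (rule finite_has_maximal)
    then obtain X where X: "X \<in> ?F" "\<forall>Y\<in>?F. X \<subseteq> Y \<longrightarrow> X = Y" by blast
    define R where "R = rest X"
    \<comment> \<open>By maximality of \<open>X\<close>, adding \<open>s\<close> leaves no vertex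
      undominated. So \<open>r\<close>, which has no neighbour in \<open>X\<close>, must see
      \<open>s\<close>.\<close>
    have join: "{s, r} \<in> E" if s: "s \<in> V" "s \<notin> X" "linked E {s} X" and r: "r \<in> R" for s r
    proof -
      have "conn E (insert s X)" using s(3) X(1) conn_insert[of E X _ s] unfolding linked_def by blast
      then have "rest (insert s X) = {}" using X s by blast
      then have "r \<notin> rest (insert s X)" by blast
      then have "r = s \<or> linked E {r} (insert s X)" using r unfolding R_def rest_def by blast
      moreover have "r \<noteq> s" using r s unfolding R_def rest_def by blast
      ultimately have "linked E {r} (insert s X)" "\<not> linked E {r} X" using r unfolding R_def rest_def by auto
      then show ?thesis unfolding linked_def by (metis insert_commute insertE singletonD)
    qed
    have clN: "{s, t} \<in> E" if s: "s \<in> V" "s \<notin> X" "linked E {s} X" and t: "t \<in> V" "t \<notin> X" "linked E {t} X"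
        and ne: "s \<noteq> t" for s t
    proof (rule ccontr)
      assume "{s, t} \<notin> E"
      obtain r where r: "r \<in> R" using X(1) unfolding R_def by blast
      then have r': "r \<in> V" "r \<notin> X" "\<not> linked E {r} X" unfolding R_def rest_def by auto
      have "s \<noteq> r" "t \<noteq> r" using r' s t by auto
      have "conn E X" using X(1) by blast
      have "\<exists>cs. hole E cs \<and> set cs \<subseteq> insert r (insert s (insert t X))"
        by (rule hole_via_vertex) (fact \<open>conn E X\<close> s t r' ne \<open>s \<noteq> r\<close> \<open>t \<noteq> r\<close> \<open>{s, t} \<notin> E\<close> join[OF s r] join[OF t r])+
      then show False using psubset.prems(1) r' s t X(1) by blast
    qed
    have Rne: "R \<subset> V" "R \<noteq> {}" using X(1) unfolding R_def rest_def by auto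
    then obtain r where r: "r \<in> R"
      "\<forall>x\<in>R - {r}. \<forall>y\<in>R - {r}. x \<noteq> y \<longrightarrow> {r, x} \<in> E \<longrightarrow> {r, y} \<in> E \<longrightarrow> {x, y} \<in> E"
      using IH[OF Rne] by blast
    have nX: "z \<notin> X" if "{r, z} \<in> E" for z
      using that r(1) unfolding R_def rest_def linked_def by blast
    have "r \<notin> A"
    proof
      assume "r \<in> A"
      then have "r = a \<or> {r, a} \<in> E" using ab(2) by (auto simp: insert_commute)
      then show False using X(1) r(1) nX unfolding R_def rest_def by blast
    qed
    moreover have "{x, y} \<in> E"
      if xy: "x \<in> V - {r}" "y \<in> V - {r}" "x \<noteq> y" "{r, x} \<in> E" "{r, y} \<in> E" for x y
    proof -
      \<comment> \<open>Neighbours of \<open>r\<close> lie in \<open>R\<close> or next to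
        \<open>X\<close>. The choice of \<open>r\<close>, the join and the clique \<open>clN\<close>
        cover all combinations.\<close>
      have "x \<notin> X" "y \<notin> X" using nX xy by auto
      then have sub: "x \<in> R \<or> linked E {x} X" "y \<in> R \<or> linked E {y} X"
        using xy unfolding R_def rest_def by auto
      show ?thesis
      proof (cases "linked E {x} X")
        case True
        then show ?thesis using join[of x y] clN[of x y] sub xy \<open>x \<notin> X\<close> \<open>y \<notin> X\<close> by blast
      next
        case False
        then have "x \<in> R" using sub by blast
        then show ?thesis using join[of y x] sub xy r(2) \<open>y \<notin> X\<close> by (auto simp: insert_commute)
      qed
    qed
    ultimately show ?thesis using r(1) unfolding R_def rest_def by blast
  next
    case False
    \<comment> \<open>Now each vertex of the clique \<open>A\<close> is adjacent to all other
      vertices of \<open>V\<close>, so a simplicial vertex of \<open>V - A\<close> stays simplicial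
      in \<open>V\<close>. If \<open>A\<close> is empty, \<open>V\<close> itself is a
      clique.\<close>
    then have univ: "{a, b} \<in> E" if "a \<in> V" "A \<subseteq> insert a {x. {a, x} \<in> E}" "b \<in> V" "b \<noteq> a" for a b
      using that by blast
    show ?thesis
    proof (cases "A = {}")
      case True
      then obtain r where "r \<in> V" using psubset.prems(2) by blast
      then show ?thesis using univ True by blast
    next
      case False
      have VA: "V - A \<subset> V" "V - A \<noteq> {}" using psubset.prems(2) False by auto
      then obtain r where r: "r \<in> V - A"
        "\<forall>x\<in>V - A - {r}. \<forall>y\<in>V - A - {r}. x \<noteq> y \<longrightarrow> {r, x} \<in> E \<longrightarrow> {r, y} \<in> E \<longrightarrow> {x, y} \<in> E"
        using IH[OF VA] by blast
      have uA: "{x, y} \<in> E" if xy: "x \<in> A" "y \<in> V" "x \<noteq> y" for x y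
      proof (rule univ)
        show "A \<subseteq> insert x {z. {x, z} \<in> E}" using clA xy(1) by auto
      qed (use xy psubset.prems(2) in auto)
      have "{x, y} \<in> E"
        if xy: "x \<in> V - {r}" "y \<in> V - {r}" "x \<noteq> y" "{r, x} \<in> E" "{r, y} \<in> E" for x y
      proof (cases "x \<in> A \<or> y \<in> A")
        case True
        then show ?thesis using uA[of x y] uA[of y x] xy by (auto simp: insert_commute)
      next
        case False
        then show ?thesis using r(2) xy by blast
      qed
      then show ?thesis using r(1) by blast
    qed
  qed
qed

section \<open>Branch sets of induced minors\<close>

text \<open>The usual branch sets, with "linked exactly if adjacent" for induced minors. Separating
  \<open>E\<close> from \<open>U\<close> lets a model found in part of a graph be reused through
  \<open>im_model_mono\<close>.\<close>

definition im_model :: "'a set set \<Rightarrow> 'a set \<Rightarrow> 'b graph \<Rightarrow> ('b \<Rightarrow> 'a set) \<Rightarrow> bool" where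
  "im_model E U H \<phi> \<longleftrightarrow> (\<forall>i\<in>verts H. \<phi> i \<noteq> {} \<and> \<phi> i \<subseteq> U \<and> conn E (\<phi> i)) \<and>
     (\<forall>i\<in>verts H. \<forall>j\<in>verts H. i \<noteq> j \<longrightarrow> \<phi> i \<inter> \<phi> j = {} \<and> ({i, j} \<in> edges H \<longleftrightarrow> linked E (\<phi> i) (\<phi> j)))"

lemma verts_edges_simps [simp]: "verts (V, E) = V" "edges (V, E) = E"
  unfolding verts_def edges_def by auto

lemma graph_no_loop: "graph G \<Longrightarrow> {x} \<notin> edges G"
  unfolding graph_def by (metis doubleton_eq_iff insert_absorb2)

lemma graph_adj_verts: "graph G \<Longrightarrow> {x, y} \<in> edges G \<Longrightarrow> x \<in> verts G \<and> y \<in> verts G \<and> x \<noteq> y"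
  unfolding graph_def by (metis doubleton_eq_iff insert_absorb2)

lemma graph_edge_sub: "graph G \<Longrightarrow> e \<in> edges G \<Longrightarrow> e \<subseteq> verts G"
  unfolding graph_def by fastforce

lemma graph_delete_vertex: "graph G \<Longrightarrow> graph (delete_vertex G v)"
  unfolding graph_def delete_vertex_def by fastforce

lemma edges_contract:
  assumes "graph G" "{u, v} \<in> edges G" "x \<noteq> v" "y \<noteq> v"
  shows "{x, y} \<in> edges (contract G u v) \<longleftrightarrow>
     {x, y} \<in> edges G \<or> (x = u \<and> y \<noteq> u \<and> {v, y} \<in> edges G) \<or> (y = u \<and> x \<noteq> u \<and> {v, x} \<in> edges G)"
  using assms unfolding contract_def by (auto simp: doubleton_eq_iff)

lemma edges_contract_no_v:
  assumes "graph G" "{u, v} \<in> edges G" "e \<in> edges (contract G u v)"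
  shows "v \<notin> e"
  using assms graph_no_loop[OF assms(1)] unfolding contract_def by auto

lemma graph_contract:
  assumes "graph G" "{u, v} \<in> edges G"
  shows "graph (contract G u v)"
  unfolding graph_def
proof (intro conjI ballI)
  show "finite (verts (contract G u v))" using assms unfolding graph_def contract_def by auto
next
  fix e assume e: "e \<in> edges (contract G u v)"
  then consider "e \<in> edges G" "v \<notin> e" | w where "e = {u, w}" "{v, w} \<in> edges G" "w \<noteq> u"
    unfolding contract_def by auto
  then show "\<exists>x y. x \<noteq> y \<and> x \<in> verts (contract G u v) \<and> y \<in> verts (contract G u v) \<and> e = {x, y}"
  proof cases
    case 1
    then obtain x y where "x \<noteq> y" "x \<in> verts G" "y \<in> verts G" "e = {x, y}" using assms unfolding graph_def by blast
    then show ?thesis using 1 unfolding contract_def by auto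
  next
    case 2
    have "w \<in> verts G" "w \<noteq> v" "u \<in> verts G" "u \<noteq> v"
      using graph_adj_verts[OF assms(1) 2(2)] graph_adj_verts[OF assms] by auto
    then show ?thesis using 2 unfolding contract_def by auto
  qed
qed

lemma induced_minor_of_trans:
  assumes "induced_minor_of H K" "induced_minor_of K G"
  shows "induced_minor_of H G"
  using assms
proof (induction rule: induced_minor_of.induct)
  case (im_refl G) then show ?case .
next
  case (im_del H K v)
  show ?case by (rule induced_minor_of.im_del[OF im_del.IH[OF im_del.prems] im_del.hyps(2)])
next
  case (im_contr H K u v)
  show ?case by (rule induced_minor_of.im_contr[OF im_contr.IH[OF im_contr.prems] im_contr.hyps(2,3)])
qed

lemma induced_minor_imp_minor: "induced_minor_of H G \<Longrightarrow> minor_of H G"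
  by (induction rule: induced_minor_of.induct) (auto intro: minor_of.intros)

text \<open>Neither set may separate \<open>u\<close> from \<open>v\<close>, since \<open>u\<close>
  inherits the edges of \<open>v\<close>. Disjointness keeps the ends of an edge distinct when
  \<open>v\<close> is renamed to \<open>u\<close>.\<close>

lemma linked_contract:
  assumes G: "graph G" "{u, v} \<in> edges G" and XY: "X \<inter> Y = {}" and uv: "u \<in> X \<longleftrightarrow> v \<in> X" "u \<in> Y \<longleftrightarrow> v \<in> Y"
  shows "linked (edges (contract G u v)) (X - {v}) (Y - {v}) \<longleftrightarrow> linked (edges G) X Y"
proof
  assume "linked (edges (contract G u v)) (X - {v}) (Y - {v})"
  then obtain x y where "x \<in> X" "y \<in> Y" "x \<noteq> v" "y \<noteq> v" "{x, y} \<in> edges (contract G u v)"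
    unfolding linked_def by blast
  then show "linked (edges G) X Y" using uv unfolding edges_contract[OF G \<open>x \<noteq> v\<close> \<open>y \<noteq> v\<close>] linked_def
    by (metis insert_commute)
next
  assume "linked (edges G) X Y"
  then obtain x y where xy: "x \<in> X" "y \<in> Y" "{x, y} \<in> edges G" unfolding linked_def by blast
  have "u \<noteq> v" using graph_adj_verts[OF G] by blast
  define x' where "x' = (if x = v then u else x)"
  define y' where "y' = (if y = v then u else y)"
  have "x' \<in> X - {v}" "y' \<in> Y - {v}" using xy uv \<open>u \<noteq> v\<close> unfolding x'_def y'_def by auto
  moreover have "x' \<noteq> y'" using calculation XY by blast
  then have "{x', y'} \<in> edges (contract G u v)"
    using xy calculation edges_contract[OF G, of x' y'] unfolding x'_def y'_def
    by (auto simp: insert_commute split: if_splits)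
  ultimately show "linked (edges (contract G u v)) (X - {v}) (Y - {v})"
    unfolding linked_def by blast
qed

text \<open>A cut after the contraction lifts to a cut of \<open>X\<close> with \<open>v\<close> on
  the side of \<open>u\<close>, and an edge across that cut survives by
  \<open>linked_contract\<close>.\<close>

lemma conn_contract:
  assumes G: "graph G" "{u, v} \<in> edges G" and X: "conn (edges G) X" and uv: "u \<in> X \<longleftrightarrow> v \<in> X"
  shows "conn (edges (contract G u v)) (X - {v})"
proof (rule connI)
  fix P assume P: "P \<subseteq> X - {v}" "P \<noteq> {}" "P \<noteq> X - {v}"
  define P' where "P' = (if u \<in> P then insert v P else P)"
  have "u \<noteq> v" using graph_adj_verts[OF G] by blast
  then have "P' \<subseteq> X" "P' \<noteq> {}" "P' \<noteq> X" "X - P' \<noteq> {}" and eq: "P' - {v} = P" "X - P' - {v} = X - {v} - P"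
    using P uv unfolding P'_def by auto
  then have "linked (edges G) P' (X - P')" using conn_linked_sub[OF X] by blast
  moreover have "u \<in> P' \<longleftrightarrow> v \<in> P'" "u \<in> X - P' \<longleftrightarrow> v \<in> X - P'"
    using P uv \<open>u \<noteq> v\<close> unfolding P'_def by auto
  ultimately have "linked (edges (contract G u v)) (P' - {v}) (X - P' - {v})"
    using linked_contract[OF G, of P' "X - P'"] by blast
  then show "\<exists>a\<in>P. \<exists>b\<in>X - {v} - P. {a, b} \<in> edges (contract G u v)"
    unfolding eq linked_def .
qed

lemma has_induced_minor_mono:
  assumes "has_induced_minor K H" "induced_minor_of K G"
  shows "has_induced_minor G H"
  using assms induced_minor_of_trans unfolding has_induced_minor_def by blast

text \<open>Delete the vertices outside the branch sets and contract edges inside them.\<close>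

lemma im_model_imp_induced_minor:
  fixes H :: "'b graph"
  assumes "graph G" "im_model (edges G) (verts G) H \<phi>" "\<forall>i. {i} \<notin> edges H"
  shows "has_induced_minor G H"
  using assms
proof (induction "card (verts G)" arbitrary: G \<phi> rule: less_induct)
  case less
  note G = \<open>graph G\<close> and M = \<open>im_model (edges G) (verts G) H \<phi>\<close>
  have fin: "finite (verts G)" using G unfolding graph_def by blast
  show ?case
  proof (cases "\<exists>v\<in>verts G. \<forall>i\<in>verts H. v \<notin> \<phi> i")
    case True
    then obtain v where v: "v \<in> verts G" "\<forall>i\<in>verts H. v \<notin> \<phi> i" by blast
    let ?G = "delete_vertex G v"
    have link: "linked (edges ?G) X Y \<longleftrightarrow> linked (edges G) X Y" if "v \<notin> X" "v \<notin> Y" for X Y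
      using that unfolding linked_def delete_vertex_def by auto
    have "conn (edges ?G) X \<longleftrightarrow> conn (edges G) X" if "v \<notin> X" for X
    proof -
      have "linked (edges ?G) P (X - P) \<longleftrightarrow> linked (edges G) P (X - P)" if "P \<subseteq> X" for P
        using that \<open>v \<notin> X\<close> link[of P "X - P"] by blast
      then show ?thesis unfolding conn_iff_linked by simp
    qed
    then have im: "im_model (edges ?G) (verts ?G) H \<phi>"
      using M v link unfolding im_model_def by (auto simp: delete_vertex_def)
    have "verts ?G \<subset> verts G" using v by (auto simp: delete_vertex_def)
    then have "card (verts ?G) < card (verts G)" using fin psubset_card_mono by blast
    from less.hyps[OF this graph_delete_vertex[OF G] im less.prems(3)]
    show ?thesis by (rule has_induced_minor_mono[OF _ im_del[OF im_refl v(1)]])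
  next
    case noout: False
    show ?thesis
    proof (cases "\<exists>i\<in>verts H. \<exists>x y. x \<in> \<phi> i \<and> y \<in> \<phi> i \<and> x \<noteq> y")
      case True
      then obtain i x y where i: "i \<in> verts H" "x \<in> \<phi> i" "y \<in> \<phi> i" "x \<noteq> y" by blast
      have "conn (edges G) (\<phi> i)" using M i(1) unfolding im_model_def by blast
      then obtain u v where uv: "u = x" "v \<in> \<phi> i" "v \<notin> {x}" "{u, v} \<in> edges G"
      proof (rule connD)
        show "{x} \<subseteq> \<phi> i" "{x} \<noteq> {}" "{x} \<noteq> \<phi> i" using i by auto
      qed blast
      let ?G = "contract G u v"
      have same: "u \<in> \<phi> j \<longleftrightarrow> v \<in> \<phi> j" if "j \<in> verts H" for j
        using M that i uv unfolding im_model_def by (metis disjoint_iff)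
      have im: "im_model (edges ?G) (verts ?G) H (\<lambda>j. \<phi> j - {v})"
        unfolding im_model_def
      proof (intro conjI ballI impI)
        fix j assume j: "j \<in> verts H"
        have "\<phi> j \<noteq> {}" "\<phi> j \<subseteq> verts G" "conn (edges G) (\<phi> j)" using M j unfolding im_model_def by auto
        then show "\<phi> j - {v} \<subseteq> verts ?G" "conn (edges ?G) (\<phi> j - {v})"
          using conn_contract[OF G uv(4) _ same[OF j]] by (auto simp: contract_def)
        show "\<phi> j - {v} \<noteq> {}" using \<open>\<phi> j \<noteq> {}\<close> same[OF j] uv by auto
      next
        fix j k assume jk: "j \<in> verts H" "k \<in> verts H" "j \<noteq> k"
        then have d: "\<phi> j \<inter> \<phi> k = {}" and e: "{j, k} \<in> edges H \<longleftrightarrow> linked (edges G) (\<phi> j) (\<phi> k)"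
          using M unfolding im_model_def by auto
        then show "(\<phi> j - {v}) \<inter> (\<phi> k - {v}) = {}" by blast
        show "{j, k} \<in> edges H \<longleftrightarrow> linked (edges ?G) (\<phi> j - {v}) (\<phi> k - {v})"
          using linked_contract[OF G uv(4) d] same jk e by blast
      qed
      have "v \<in> verts G" using M i uv unfolding im_model_def by blast
      then have "verts ?G \<subset> verts G" by (auto simp: contract_def)
      then have "card (verts ?G) < card (verts G)" using fin psubset_card_mono by blast
      note ih = less.hyps[OF this graph_contract[OF G uv(4)] im less.prems(3)]
      have "u \<noteq> v" using uv by blast
      show ?thesis by (rule has_induced_minor_mono[OF ih im_contr[OF im_refl uv(4) \<open>u \<noteq> v\<close>]])
    next
      case False
      \<comment> \<open>All branch sets are singletons and cover the vertices, so \<open>G\<close>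
        itself is a copy of \<open>H\<close>.\<close>
      define f where "f i = (SOME x. x \<in> \<phi> i)" for i
      have f: "\<phi> i = {f i}" if "i \<in> verts H" for i
      proof -
        have "\<phi> i \<noteq> {}" using M that unfolding im_model_def by blast
        then have "f i \<in> \<phi> i" unfolding f_def by (simp add: some_in_eq)
        then show ?thesis using False that by blast
      qed
      have "i = j" if "i \<in> verts H" "j \<in> verts H" "f i = f j" for i j
        using M f[OF that(1)] f[OF that(2)] that unfolding im_model_def by (metis Int_absorb insert_not_empty)
      then have "inj_on f (verts H)" unfolding inj_on_def by blast
      moreover have "f ` verts H = verts G"
      proof
        show "f ` verts H \<subseteq> verts G" using M f unfolding im_model_def by fastforce
        show "verts G \<subseteq> f ` verts H"
        proof
          fix x assume "x \<in> verts G"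
          then obtain i where "i \<in> verts H" "x \<in> \<phi> i" using noout by blast
          then show "x \<in> f ` verts H" using f by auto
        qed
      qed
      ultimately have "bij_betw f (verts H) (verts G)" unfolding bij_betw_def by blast
      moreover have "{i, j} \<in> edges H \<longleftrightarrow> {f i, f j} \<in> edges G" if "i \<in> verts H" "j \<in> verts H" for i j
      proof (cases "i = j")
        case True
        then show ?thesis using less.prems(3) graph_no_loop[OF G] by auto
      next
        case False
        then have "{i, j} \<in> edges H \<longleftrightarrow> linked (edges G) (\<phi> i) (\<phi> j)"
          using M that unfolding im_model_def by blast
        then show ?thesis using f that unfolding linked_def by auto
      qed
      ultimately have "isomorphic H G" unfolding isomorphic_def by blast
      then show ?thesis using im_refl unfolding has_induced_minor_def by blast
    qed
  qed
qed

section \<open>Branch sets from holes\<close>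

text \<open>The conditions on a pair are symmetric, so for the concrete forbidden graphs only pairs
  with \<open>i < j\<close> have to be computed.\<close>

lemma im_modelI:
  fixes H :: "nat graph"
  assumes "\<forall>i\<in>verts H. \<phi> i \<noteq> {} \<and> \<phi> i \<subseteq> U \<and> conn E (\<phi> i)"
    and *: "\<forall>i\<in>verts H. \<forall>j\<in>verts H. i < j \<longrightarrow> \<phi> i \<inter> \<phi> j = {} \<and> ({i, j} \<in> edges H \<longleftrightarrow> linked E (\<phi> i) (\<phi> j))"
  shows "im_model E U H \<phi>"
proof -
  have "\<phi> i \<inter> \<phi> j = {} \<and> ({i, j} \<in> edges H \<longleftrightarrow> linked E (\<phi> i) (\<phi> j))"
    if "i \<in> verts H" "j \<in> verts H" "i \<noteq> j" for i j
  proof (cases "i < j")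
    case False
    then have "\<phi> j \<inter> \<phi> i = {} \<and> ({j, i} \<in> edges H \<longleftrightarrow> linked E (\<phi> j) (\<phi> i))" using * that by auto
    then show ?thesis using linked_sym[of E "\<phi> i"] by (simp add: insert_commute Int_commute)
  qed (use * that in blast)
  then show ?thesis using assms(1) unfolding im_model_def by blast
qed

lemma edges_K4: "verts K4 = {0, 1, 2, 3}" "edges K4 = {{0, 1}, {0, 2}, {0, 3}, {1, 2}, {1, 3}, {2, 3}}"
proof -
  have eq: "{{i, j} | i j. i \<in> A \<and> j \<in> A \<and> i \<noteq> j} = (\<Union>i\<in>A. \<Union>j\<in>A - {i}. {{i, j}})" for A :: "nat set"
    by auto
  show "verts K4 = {0, 1, 2, 3}" unfolding K4_def by simp
  show "edges K4 = {{0, 1}, {0, 2}, {0, 3}, {1, 2}, {1, 3}, {2, 3}}"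
    unfolding K4_def verts_edges_simps eq by (simp add: insert_Diff_if insert_commute)
qed

lemma edges_K23: "verts K23 = {0, 1, 2, 3, 4}"
    "edges K23 = {{0, 2}, {0, 3}, {0, 4}, {1, 2}, {1, 3}, {1, 4}}"
  unfolding K23_def by auto

lemma edges_F1: "verts F1 = {0, 1, 2, 3, 4, 5}"
    "edges F1 = {{0, 1}, {1, 2}, {2, 3}, {3, 0}, {2, 4}, {4, 5}, {5, 3}}"
  unfolding F1_def by auto

lemma edges_F2: "verts F2 = {0, 1, 2, 3, 4, 5, 6}"
    "edges F2 = {{0, 1}, {1, 2}, {2, 3}, {3, 0}, {0, 4}, {4, 5}, {5, 6}, {6, 0}}"
  unfolding F2_def by auto

text \<open>The vertices of the small graphs are numbered from 0 without gaps, so \<open>nth\<close>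
  on a list of branch sets serves as branch map.\<close>

lemma K4_model:
  assumes "A \<noteq> {}" "A \<subseteq> U" "conn E A" "B \<noteq> {}" "B \<subseteq> U" "conn E B"
    "C \<noteq> {}" "C \<subseteq> U" "conn E C" "D \<noteq> {}" "D \<subseteq> U" "conn E D"
    "A \<inter> B = {}" "A \<inter> C = {}" "A \<inter> D = {}" "B \<inter> C = {}" "B \<inter> D = {}" "C \<inter> D = {}"
    "linked E A B" "linked E A C" "linked E A D" "linked E B C" "linked E B D" "linked E C D"
  shows "\<exists>\<phi>. im_model E U K4 \<phi>"
  by (rule exI[of _ "nth [A, B, C, D]"], rule im_modelI) (simp_all add: edges_K4 doubleton_eq_iff assms)

lemma K23_model:
  assumes "A \<noteq> {}" "A \<subseteq> U" "conn E A" "B \<noteq> {}" "B \<subseteq> U" "conn E B"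
    "X \<noteq> {}" "X \<subseteq> U" "conn E X" "Y \<noteq> {}" "Y \<subseteq> U" "conn E Y" "Z \<noteq> {}" "Z \<subseteq> U" "conn E Z"
    "A \<inter> B = {}" "A \<inter> X = {}" "A \<inter> Y = {}" "A \<inter> Z = {}" "B \<inter> X = {}" "B \<inter> Y = {}" "B \<inter> Z = {}"
    "X \<inter> Y = {}" "X \<inter> Z = {}" "Y \<inter> Z = {}"
    "linked E A X" "linked E A Y" "linked E A Z" "linked E B X" "linked E B Y" "linked E B Z"
    "\<not> linked E A B" "\<not> linked E X Y" "\<not> linked E X Z" "\<not> linked E Y Z"
  shows "\<exists>\<phi>. im_model E U K23 \<phi>"
  by (rule exI[of _ "nth [A, B, X, Y, Z]"], rule im_modelI) (simp_all add: edges_K23 doubleton_eq_iff assms)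

text \<open>The hole is read as a 4-cycle: \<open>c\<close>, \<open>a\<close> and \<open>b\<close>
  stay single and the arc \<open>ws\<close> becomes one branch set. This is how long holes shrink to
  the 4-cycles of \<open>F1\<close> and \<open>F2\<close>.\<close>

lemma hole_arcs:
  assumes "hole E (c # a # b # ws)"
  shows "ws \<noteq> []" "conn E (set ws)" "{c, a} \<in> E" "{a, b} \<in> E" "linked E {b} (set ws)" "linked E {c} (set ws)"
    "\<not> linked E {a} (set ws)" "{c, b} \<notin> E" "a \<noteq> b" "c \<noteq> a" "c \<noteq> b" "a \<notin> set ws" "b \<notin> set ws" "c \<notin> set ws"
proof -
  show "ws \<noteq> []" using assms by auto
  then have "hd ws \<in> set ws" "last ws \<in> set ws" by auto
  then show "conn E (set ws)" "{c, a} \<in> E" "{a, b} \<in> E" "linked E {b} (set ws)" "linked E {c} (set ws)"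
    "\<not> linked E {a} (set ws)" "{c, b} \<notin> E" "a \<noteq> b" "c \<noteq> a" "c \<noteq> b" "a \<notin> set ws" "b \<notin> set ws" "c \<notin> set ws"
    using assms \<open>ws \<noteq> []\<close> conn_ipath[of E ws] by (auto simp: linked_def)
qed

lemma not_linked_sub: "\<not> linked E X Y \<Longrightarrow> X' \<subseteq> X \<Longrightarrow> Y' \<subseteq> Y \<Longrightarrow> \<not> linked E X' Y'"
  unfolding linked_def by blast

text \<open>\<open>Y\<close> becomes the vertex 0 shared by the 4-cycles. Additional edges from
  \<open>Y\<close> to \<open>a\<close>, \<open>ws\<close>, \<open>a'\<close> or \<open>ws'\<close>
  do no harm, since those pairs are edges of \<open>F2\<close> anyway; only \<open>b\<close> and
  \<open>b'\<close> must stay away from \<open>Y\<close>.\<close>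

lemma F2_from_holes:
  assumes c: "hole E (c # a # b # ws)" and d: "hole E (d # a' # b' # ws')"
    and Y: "conn E Y" "c \<in> Y" "d \<in> Y"
    and disj: "Y \<inter> set (a # b # ws) = {}" "Y \<inter> set (a' # b' # ws') = {}"
      "set (a # b # ws) \<inter> set (a' # b' # ws') = {}"
    and nl: "\<not> linked E (set (a # b # ws)) (set (a' # b' # ws'))" "\<not> linked E Y {b}" "\<not> linked E Y {b'}"
    and U: "Y \<subseteq> U" "set (a # b # ws) \<subseteq> U" "set (a' # b' # ws') \<subseteq> U"
  shows "\<exists>\<phi>. im_model E U F2 \<phi>"
proof -
  note c = hole_arcs[OF c] and d = hole_arcs[OF d]
  have l: "linked E Y {a}" "linked E Y (set ws)" "linked E Y {a'}" "linked E Y (set ws')"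
    using c d Y unfolding linked_def by blast+
  have l2: "linked E {a} {b}" "linked E {a'} {b'}" using c d unfolding linked_def by auto
  have n: "\<not> linked E {a} {a'}" "\<not> linked E {a} {b'}" "\<not> linked E {a} (set ws')"
    "\<not> linked E {b} {a'}" "\<not> linked E {b} {b'}" "\<not> linked E {b} (set ws')"
    "\<not> linked E (set ws) {a'}" "\<not> linked E (set ws) {b'}" "\<not> linked E (set ws) (set ws')"
    using nl(1) unfolding linked_def by auto
  show ?thesis
  proof (rule exI[of _ "nth [Y, {a}, {b}, set ws, {a'}, {b'}, set ws']"], rule im_modelI, goal_cases)
    case 1
    then show ?case using c d Y U by (auto simp: edges_F2)
  next
    case 2
    have "Y \<inter> set ws = {}" "Y \<inter> set ws' = {}" "set ws \<inter> set ws' = {}" "a \<notin> Y" "b \<notin> Y" "a' \<notin> Y" "b' \<notin> Y"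
      "a \<noteq> a'" "a \<noteq> b'" "a \<notin> set ws'" "b \<noteq> a'" "b \<noteq> b'" "b \<notin> set ws'" "a' \<notin> set ws" "b' \<notin> set ws"
      using disj by auto
    then show ?case using c d l l2 n nl(2,3) by (simp add: edges_F2 doubleton_eq_iff)
  qed
qed

text \<open>\<open>Z\<close> and \<open>Y\<close> become the ends 2 and 3 of the shared edge, in the
  cycles \<open>Z\<close>, \<open>{b}\<close>, \<open>set ws\<close>, \<open>Y\<close> and
  \<open>Z\<close>, \<open>{b'}\<close>, \<open>set ws'\<close>, \<open>Y\<close>. So
  \<open>Y\<close> must avoid \<open>b\<close> and \<open>b'\<close>, and \<open>Z\<close> must
  avoid the two arcs.\<close>

lemma F1_from_holes:
  assumes c: "hole E (c # a # b # ws)" and d: "hole E (d # a' # b' # ws')"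
    and Y: "conn E Y" "c \<in> Y" "d \<in> Y" and Z: "conn E Z" "a \<in> Z" "a' \<in> Z"
    and disj: "Y \<inter> Z = {}" "Y \<inter> set (b # ws) = {}" "Y \<inter> set (b' # ws') = {}"
      "Z \<inter> set (b # ws) = {}" "Z \<inter> set (b' # ws') = {}" "set (b # ws) \<inter> set (b' # ws') = {}"
    and nl: "\<not> linked E (set (b # ws)) (set (b' # ws'))" "\<not> linked E Y {b}" "\<not> linked E Y {b'}"
      "\<not> linked E Z (set ws)" "\<not> linked E Z (set ws')"
    and U: "Y \<subseteq> U" "Z \<subseteq> U" "set (b # ws) \<subseteq> U" "set (b' # ws') \<subseteq> U"
  shows "\<exists>\<phi>. im_model E U F1 \<phi>"
proof -
  note c = hole_arcs[OF c] and d = hole_arcs[OF d]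
  have l: "linked E Z Y" "linked E {b} Z" "linked E (set ws) Y" "linked E Z {b'}" "linked E Y (set ws')"
    "linked E (set ws) {b}" "linked E (set ws') {b'}" "linked E Y (set ws)" 
    using c d Y Z unfolding linked_def by (metis insert_commute singletonD singletonI)+
  have n: "\<not> linked E (set ws) {b'}" "\<not> linked E (set ws) (set ws')"
    "\<not> linked E {b} {b'}" "\<not> linked E {b} (set ws')" "\<not> linked E (set ws) Z" "\<not> linked E {b} Y"
    using nl linked_sym[of E] unfolding linked_def by (auto simp: insert_commute)
  show ?thesis
  proof (rule exI[of _ "nth [set ws, {b}, Z, Y, {b'}, set ws']"], rule im_modelI, goal_cases)
    case 1
    then show ?case using c d Y Z U by (auto simp: edges_F1)
  next
    case 2
    have "set ws \<inter> Y = {}" "Y \<inter> set ws' = {}" "set ws \<inter> Z = {}" "Z \<inter> set ws' = {}" "set ws \<inter> set ws' = {}"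
      "b \<notin> Y" "b' \<notin> Y" "b \<notin> Z" "b' \<notin> Z" "Z \<inter> Y = {}"
      "b \<noteq> b'" "b \<notin> set ws'" "b' \<notin> set ws"
      using disj by auto
    then show ?case using c d l n nl(2-5) by (simp add: edges_F1 doubleton_eq_iff)
  qed
qed

section \<open>Attachments of a connected set on a hole\<close>

lemma hole_two_arcs:
  assumes h: "hole E (p # xs @ q # ys)" and pq: "{p, q} \<notin> E"
  shows "xs \<noteq> []" "ys \<noteq> []" "conn E (set xs)" "conn E (set ys)" "linked E {p} (set xs)" "linked E {p} (set ys)"
    "linked E {q} (set xs)" "linked E {q} (set ys)" "\<not> linked E (set xs) (set ys)"
    "p \<noteq> q" "p \<notin> set xs" "p \<notin> set ys" "q \<notin> set xs" "q \<notin> set ys" "set xs \<inter> set ys = {}"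
    "ipath E (p # xs @ [q])"
proof -
  show ne: "xs \<noteq> []" "ys \<noteq> []" using h pq by auto
  then have hl: "hd xs \<in> set xs" "last xs \<in> set xs" "hd ys \<in> set ys" "last ys \<in> set ys" by auto
  show dj: "p \<noteq> q" "p \<notin> set xs" "p \<notin> set ys" "q \<notin> set xs" "q \<notin> set ys" "set xs \<inter> set ys = {}"
    using hole_distinct[OF h] by auto
  have "ipath E ((xs @ [q]) @ ys)" using h by simp
  then have ip: "ipath E (xs @ [q])" "ipath E (q # ys)" "ipath E xs" "ipath E ys"
    using h unfolding ipath_append by auto
  then show "conn E (set xs)" "conn E (set ys)" using conn_ipath by auto
  have "{p, hd xs} \<in> E" "{p, last ys} \<in> E" using h hl ne by auto
  then show "linked E {p} (set xs)" "linked E {p} (set ys)" using hl unfolding linked_def by auto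
  have "{last xs, q} \<in> E" "{q, hd ys} \<in> E" using ip hl ne by (auto simp: ipath_append)
  then show "linked E {q} (set xs)" "linked E {q} (set ys)"
    using hl unfolding linked_def by (auto simp: insert_commute)
  show "\<not> linked E (set xs) (set ys)"
    using \<open>ipath E ((xs @ [q]) @ ys)\<close> dj unfolding ipath_append linked_def by auto
  have "{p, z} \<in> E \<longleftrightarrow> z = hd xs" if "z \<in> set xs" for z
  proof -
    have "z \<noteq> last ys" using that hl dj by blast
    then show ?thesis using h that ne by auto
  qed
  then show "ipath E (p # xs @ [q])" using dj ip ne pq hl by auto
qed

text \<open>Otherwise \<open>{p}\<close>, \<open>set xs\<close>, \<open>{q} \<union> set ys\<close>
  and \<open>K\<close> are the branch sets of a \<open>K4\<close>.\<close>

lemma theta_middle_unlinked: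
  assumes h: "hole E (p # xs @ q # ys)" and pq: "{p, q} \<notin> E"
    and K: "conn E K" "K \<noteq> {}" "K \<inter> set (p # xs @ q # ys) = {}" "linked E {p} K" "linked E {q} K"
    and K4: "\<not> (\<exists>\<phi>. im_model E (K \<union> set (p # xs @ q # ys)) K4 \<phi>)"
  shows "\<not> linked E (set xs) K"
proof
  assume "linked E (set xs) K"
  note f = hole_two_arcs[OF h pq]
  define Q where "Q = {q} \<union> set ys"
  have "conn E Q" using f unfolding Q_def by (intro conn_Un) auto
  moreover have "linked E (set xs) {q}" using f linked_sym by metis
  then have "linked E {p} Q" "linked E (set xs) Q" "linked E Q K"
    using f K unfolding Q_def linked_Un_left linked_Un_right by blast+
  moreover have "Q \<noteq> {}" "Q \<subseteq> K \<union> set (p # xs @ q # ys)" "{p} \<inter> Q = {}" "set xs \<inter> Q = {}" "Q \<inter> K = {}"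
    using f K unfolding Q_def by auto
  moreover have "{p} \<subseteq> K \<union> set (p # xs @ q # ys)" "set xs \<subseteq> K \<union> set (p # xs @ q # ys)"
    "{p} \<inter> set xs = {}" "{p} \<inter> K = {}" "set xs \<inter> K = {}" "set xs \<noteq> {}" using f K by auto
  ultimately have "\<exists>\<phi>. im_model E (K \<union> set (p # xs @ q # ys)) K4 \<phi>"
    using f K \<open>linked E (set xs) K\<close> by (intro K4_model[of "{p}" _ E "set xs" Q K]) (simp_all add: subset_insertI2)
  then show False using K4 by blast
qed

text \<open>Since \<open>K\<close> is not linked to the open arcs, \<open>p\<close> and
  \<open>q\<close> form one side of a \<open>K23\<close>, the two arcs and \<open>K\<close> the
  other. Replacing an arc by an induced path through \<open>K\<close> gives a hole that contains a
  vertex of \<open>K\<close> and so differs from \<open>cs\<close>.\<close>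

lemma attachments_nonadjacent:
  assumes cs: "hole E cs" and K: "conn E K" "K \<noteq> {}" "K \<inter> set cs = {}"
    and K4: "\<not> (\<exists>\<phi>. im_model E (K \<union> set cs) K4 \<phi>)"
    and pq: "p \<in> set cs" "q \<in> set cs" "p \<noteq> q" "linked E {p} K" "linked E {q} K" "{p, q} \<notin> E"
  shows "\<exists>\<phi>. im_model E (K \<union> set cs) K23 \<phi>"
    and "\<exists>ds. hole E ds \<and> set ds \<subseteq> K \<union> set cs \<and> set ds \<noteq> set cs"
proof -
  obtain zs where zs: "hole E (p # zs)" "set cs = insert p (set zs)"
    using hole_rotate_to[OF cs pq(1)] by metis
  then have "q \<in> set zs" using pq by auto
  then obtain xs ys where xy: "zs = xs @ q # ys" by (meson split_list)
  have h: "hole E (p # xs @ q # ys)" using zs xy by simp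
  have h': "hole E (p # rev ys @ q # rev xs)" using hole_rev[OF h] by simp
  have cse: "set cs = set (p # xs @ q # ys)" "set cs = set (p # rev ys @ q # rev xs)" using zs xy by auto
  note f = hole_two_arcs[OF h pq(6)]
  have nx: "\<not> linked E (set xs) K"
    by (rule theta_middle_unlinked[OF h pq(6)]) (use K K4 pq cse in metis)+
  \<comment> \<open>Reversing the hole exchanges the roles of the two arcs.\<close>
  have ny: "\<not> linked E (set ys) K"
    using theta_middle_unlinked[OF h' pq(6) K(1,2) K(3)[unfolded cse(2)] pq(4,5) K4[unfolded cse(2)]] by simp
  have l: "linked E {p} K" "linked E {q} K" "\<not> linked E {p} {q}" using pq by (auto simp: linked_def)
  show "\<exists>\<phi>. im_model E (K \<union> set cs) K23 \<phi>"
    unfolding cse(1)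
    by (intro K23_model[of "{p}" _ E "{q}" "set xs" "set ys" K]) (use f K l nx ny cse in auto)
  obtain ks where ks: "ipath E (p # ks @ [q])" "ks \<noteq> []" "set ks \<subseteq> K"
    using ipath_through[of E K p q] K pq linked_sym[of E "{q}" K] cse by auto
  have "\<not> linked E K (set xs)" using nx linked_sym by metis
  then have "\<not> linked E (set ks) (set xs)" using ks(3) not_linked_sub by blast
  moreover have "set ks \<inter> set xs = {}" using ks(3) K(3) cse by auto
  ultimately have "hole E (p # ks @ q # rev xs)"
    by (rule hole_from_two_paths[OF ks(1) f(16) ks(2) f(1), rotated])
  moreover have "set (p # ks @ q # rev xs) \<subseteq> K \<union> set cs" using ks cse by auto
  moreover have "set (p # ks @ q # rev xs) \<noteq> set cs" using ks K(3) by (cases ks) auto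
  ultimately show "\<exists>ds. hole E ds \<and> set ds \<subseteq> K \<union> set cs \<and> set ds \<noteq> set cs" by blast
qed

lemma component_linked:
  assumes "finite W" "conn E W" "c \<in> W - D" "W \<inter> D \<noteq> {}"
  obtains Z d where "c \<in> Z" "Z \<subseteq> W - D" "conn E Z" "\<forall>a\<in>Z. \<forall>b\<in>W - D. {a, b} \<in> E \<longrightarrow> b \<in> Z"
    "d \<in> W \<inter> D" "linked E {d} Z"
proof -
  have "finite (W - D)" using assms(1) by blast
  then obtain Z where Z: "c \<in> Z" "Z \<subseteq> W - D" "conn E Z" "\<forall>a\<in>Z. \<forall>b\<in>W - D. {a, b} \<in> E \<longrightarrow> b \<in> Z"
    using assms(3) by (rule component_exists)
  have "Z \<subseteq> W" "Z \<noteq> {}" "Z \<noteq> W" using Z assms by auto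
  then obtain a b where ab: "a \<in> Z" "b \<in> W" "b \<notin> Z" "{a, b} \<in> E" using connD[OF assms(2)] by blast
  then have "b \<in> W \<inter> D" using Z(4) by blast
  moreover have "linked E {b} Z" using ab unfolding linked_def by (auto simp: insert_commute)
  ultimately show ?thesis using Z by (intro that)
qed

text \<open>\<open>K\<close> attaches to the hole \<open>cs\<close> in a vertex or an edge, and \<open>ds\<close> is a second hole in \<open>K\<close> and these
  attachments. If \<open>K\<close> attaches in an edge and the two ends can be joined to \<open>ds\<close> disjointly at different
  vertices, contracting the connections makes the holes share an edge, which gives \<open>F\<^sub>1\<close>;
  otherwise they can be made to share exactly one vertex, which gives \<open>F\<^sub>2\<close>.\<close>

locale two_holes =
  fixes E :: "'a set set" and cs ds :: "'a list" and K :: "'a set"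
  assumes cs: "hole E cs" and ds: "hole E ds" and finK: "finite K" and K: "conn E K"
    and Kcs: "K \<inter> set cs = {}"
    and attach: "\<And>Z p q. conn E Z \<Longrightarrow> Z \<subseteq> K \<union> set cs \<Longrightarrow> Z \<inter> set ds = {} \<Longrightarrow> p \<in> set ds \<Longrightarrow> q \<in> set ds \<Longrightarrow>
      p \<noteq> q \<Longrightarrow> linked E {p} Z \<Longrightarrow> linked E {q} Z \<Longrightarrow> {p, q} \<in> E"
begin

text \<open>\<open>Y\<close> grows from \<open>c\<close> off \<open>ds\<close> and ends at one
  vertex \<open>d\<close> of \<open>ds\<close>. Its part off \<open>ds\<close> is connected, so by
  \<open>attach\<close> any other contact on \<open>ds\<close> is a neighbour of \<open>d\<close>.
  This keeps the vertex of the hole that plays the part opposite to \<open>d\<close> away from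
  \<open>Y\<close>. If \<open>c\<close> lies on \<open>ds\<close>, then \<open>{c}\<close> is
  enough.\<close>

lemma connector:
  assumes W: "conn E W" "W \<subseteq> K \<union> set cs" "c \<in> W" "W \<inter> set ds \<noteq> {}"
  shows "\<exists>Y d. conn E Y \<and> c \<in> Y \<and> Y \<subseteq> W \<and> d \<in> set ds \<and> Y \<inter> set ds = {d} \<and>
     (\<forall>e\<in>set ds. linked E Y {e} \<longrightarrow> e = d \<or> {d, e} \<in> E)"
proof (cases "c \<in> set ds")
  case True
  then show ?thesis using W by (intro exI[of _ "{c}"] exI[of _ c]) (auto simp: linked_def)
next
  case False
  have "finite W" using W finK finite_subset by blast
  have cW: "c \<in> W - set ds" using W(3) False by blast
  obtain Z d where Z: "c \<in> Z" "Z \<subseteq> W - set ds" "conn E Z" "\<forall>a\<in>Z. \<forall>b\<in>W - set ds. {a, b} \<in> E \<longrightarrow> b \<in> Z"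
      "d \<in> W \<inter> set ds" "linked E {d} Z"
    by (rule component_linked[OF \<open>finite W\<close> W(1) cW W(4)])
  have "conn E (insert d Z)" using Z conn_insert[of E Z _ d] unfolding linked_def by blast
  moreover have "e = d \<or> {d, e} \<in> E" if "e \<in> set ds" "linked E (insert d Z) {e}" for e
  proof -
    have "{d, e} \<in> E \<or> linked E {e} Z" using that linked_sym[of E Z] unfolding linked_def by blast
    moreover have "Z \<subseteq> K \<union> set cs" "Z \<inter> set ds = {}" "d \<in> set ds" using Z(2,5) W(2) by auto
    ultimately show ?thesis using attach[OF Z(3), of d e] that(1) Z(6) by blast
  qed
  ultimately show ?thesis using Z(1,2,5) by (intro exI[of _ "insert d Z"] exI[of _ d]) auto
qed

text \<open>Contracting the connector identifies \<open>c\<close> with \<open>d\<close>, so that the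
  holes share just this vertex. The remaining parts are unlinked, because only \<open>c\<close> sees
  \<open>K\<close> and the rest of \<open>ds\<close> lies in \<open>K\<close>.\<close>

lemma one_attachment:
  assumes c: "c \<in> set cs" "linked E {c} K" and att: "\<forall>x\<in>set cs. linked E {x} K \<longrightarrow> x = c"
    and dsK: "set ds \<subseteq> insert c K"
  shows "\<exists>\<phi>. im_model E (K \<union> set cs) F2 \<phi>"
proof -
  obtain zs where zs: "hole E (c # zs)" "set cs = insert c (set zs)"
    using hole_rotate_to[OF cs c(1)] by metis
  then obtain a b ws where "zs = a # b # ws" using hole_cases by metis
  with zs have h: "hole E (c # a # b # ws)" and cse: "set cs = insert c (set (a # b # ws))" by auto
  note f = hole_arcs[OF h]
  have cR: "c \<notin> set (a # b # ws)" using f by auto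
  have RK: "\<not> linked E (set (a # b # ws)) K"
    using att cse cR unfolding linked_def by (metis insertCI singletonD singletonI)
  have "conn E (insert c K)" using c(2) K conn_insert[of E K _ c] unfolding linked_def by blast
  moreover have "insert c K \<subseteq> K \<union> set cs" "c \<in> insert c K" using c by auto
  moreover have "insert c K \<inter> set ds \<noteq> {}" using dsK ds by (cases ds) auto
  ultimately obtain Y d where Y: "conn E Y" "c \<in> Y" "Y \<subseteq> insert c K" "d \<in> set ds" "Y \<inter> set ds = {d}"
     "\<forall>e\<in>set ds. linked E Y {e} \<longrightarrow> e = d \<or> {d, e} \<in> E"
    using connector[of "insert c K" c] by blast
  obtain zs' where zs': "hole E (d # zs')" "set ds = insert d (set zs')"
    using hole_rotate_to[OF ds Y(4)] by metis
  then obtain a' b' ws' where "zs' = a' # b' # ws'" using hole_cases by metis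
  with zs' have h': "hole E (d # a' # b' # ws')" and dse: "set ds = insert d (set (a' # b' # ws'))" by auto
  note f' = hole_arcs[OF h']
  have dR: "d \<notin> set (a' # b' # ws')" using f' by auto
  show ?thesis
  proof (rule F2_from_holes[OF h h' Y(1,2)])
    show "d \<in> Y" using Y by blast
    show "Y \<inter> set (a # b # ws) = {}" using Y(3) Kcs cse cR by blast
    have "e = d" if "e \<in> Y" "e \<in> set ds" for e using Y(5) that by blast
    then show dj: "Y \<inter> set (a' # b' # ws') = {}" using dse dR by auto
    then have K': "set (a' # b' # ws') \<subseteq> K" using dsK Y(2) dse by blast
    then show "set (a # b # ws) \<inter> set (a' # b' # ws') = {}" using Kcs cse by blast
    show "\<not> linked E (set (a # b # ws)) (set (a' # b' # ws'))" using K' RK not_linked_sub by blast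
    have "\<not> linked E {b} K" using RK not_linked_sub[of E _ K "{b}" K] by simp
    then have "\<not> linked E K {b}" using linked_sym by metis
    then show "\<not> linked E Y {b}" using Y(3) f(8) unfolding linked_def by blast
    show "\<not> linked E Y {b'}" using Y(6) dse f'(8) dR by auto
    show "Y \<subseteq> K \<union> set cs" "set (a # b # ws) \<subseteq> K \<union> set cs" "set (a' # b' # ws') \<subseteq> K \<union> set cs"
      using Y(3) cse K' by auto
  qed
qed

context
  fixes c0 c1 :: 'a
  assumes c0: "c0 \<in> set cs" "linked E {c0} K" and c1: "c1 \<in> set cs" "linked E {c1} K"
    and c01: "c0 \<noteq> c1" "{c0, c1} \<in> E"
    and att: "\<forall>x\<in>set cs. linked E {x} K \<longrightarrow> x = c0 \<or> x = c1"
    and dsK: "set ds \<subseteq> insert c0 (insert c1 K)"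
begin

lemma edge_attachment_frame:
  obtains b ws where "hole E (c0 # c1 # b # ws)" "set cs = insert c0 (insert c1 (set (b # ws)))"
    "\<not> linked E K (set (b # ws))" "c0 \<notin> set (b # ws)" "c1 \<notin> set (b # ws)"
proof -
  obtain zs where zs: "hole E (c0 # c1 # zs)" "set cs = insert c0 (insert c1 (set zs))"
    using hole_rotate_to2[OF cs c0(1) c1(1) c01(2,1)] by metis
  then obtain b ws where "zs = b # ws" by (cases zs) auto
  with zs have h: "hole E (c0 # c1 # b # ws)" and cse: "set cs = insert c0 (insert c1 (set (b # ws)))" by auto
  have n: "c0 \<notin> set (b # ws)" "c1 \<notin> set (b # ws)" using hole_distinct[OF h] by auto
  have "\<not> linked E (set (b # ws)) K"
    using att cse n unfolding linked_def by (metis insertCI singletonD singletonI)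
  then have "\<not> linked E K (set (b # ws))" using linked_sym by metis
  then show ?thesis using h cse n by (intro that)
qed

text \<open>The connector starts at \<open>c1\<close>, a neighbour of \<open>c0\<close>, so it has
  the contact \<open>c0\<close> on \<open>ds\<close>, and its end \<open>d\<close> must be adjacent
  to \<open>c0\<close>. Contracting it makes the edge \<open>c0\<close>, \<open>c1\<close> of
  \<open>cs\<close> coincide with the edge \<open>c0\<close>, \<open>d\<close> of
  \<open>ds\<close>.\<close>

lemma hole_meets_edge:
  assumes "c0 \<in> set ds"
  shows "\<exists>\<phi>. im_model E (K \<union> set cs) F1 \<phi>"
proof -
  obtain b ws where h: "hole E (c0 # c1 # b # ws)" and cse: "set cs = insert c0 (insert c1 (set (b # ws)))"
    and KR: "\<not> linked E K (set (b # ws))" and nR: "c0 \<notin> set (b # ws)" "c1 \<notin> set (b # ws)"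
    by (rule edge_attachment_frame)
  note f = hole_arcs[OF h]
  have "conn E (insert c1 K)" using c1 K conn_insert[of E K _ c1] unfolding linked_def by blast
  moreover have "insert c1 K \<subseteq> K \<union> set cs" "c1 \<in> insert c1 K" using c1 by auto
  moreover obtain e where "e \<in> set ds" "e \<noteq> c0" using hole_nbrs[OF ds assms] by metis
  then have "insert c1 K \<inter> set ds \<noteq> {}" using dsK by auto
  ultimately obtain Z d where Z: "conn E Z" "c1 \<in> Z" "Z \<subseteq> insert c1 K" "d \<in> set ds" "Z \<inter> set ds = {d}"
     "\<forall>e\<in>set ds. linked E Z {e} \<longrightarrow> e = d \<or> {d, e} \<in> E"
    using connector[of "insert c1 K" c1] by blast
  have c0Z: "c0 \<notin> Z" using Z(3) c01(1) Kcs c0(1) by blast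
  then have "d \<noteq> c0" using Z(5) by blast
  have "linked E Z {c0}" using Z(2) c01(2) unfolding linked_def by (auto simp: insert_commute)
  then have "{c0, d} \<in> E" using Z(6) assms \<open>d \<noteq> c0\<close> by (auto simp: insert_commute)
  then obtain zs' where zs': "hole E (c0 # d # zs')" "set ds = insert c0 (insert d (set zs'))"
    using hole_rotate_to2[OF ds assms Z(4)] \<open>d \<noteq> c0\<close> by metis
  then obtain b' ws' where "zs' = b' # ws'" by (cases zs') auto
  with zs' have h': "hole E (c0 # d # b' # ws')"
    and dse: "set ds = insert c0 (insert d (set (b' # ws')))" by auto
  note f' = hole_arcs[OF h']
  have nR': "c0 \<notin> set (b' # ws')" "d \<notin> set (b' # ws')" using hole_distinct[OF h'] by auto
  show ?thesis
  proof (rule F1_from_holes[OF h h', of "{c0}" Z])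
    show "conn E {c0}" "c0 \<in> {c0}" "c0 \<in> {c0}" "conn E Z" "c1 \<in> Z" "d \<in> Z" "{c0} \<inter> Z = {}"
      "{c0} \<inter> set (b # ws) = {}" "{c0} \<inter> set (b' # ws') = {}" using Z c0Z nR nR' by auto
    show "Z \<inter> set (b # ws) = {}" using Z(3) Kcs cse nR by blast
    have "e = d" if "e \<in> Z" "e \<in> set ds" for e using Z(5) that by blast
    then show dj: "Z \<inter> set (b' # ws') = {}" using dse nR' by auto
    then have K': "set (b' # ws') \<subseteq> K" using dsK Z(2) dse nR' by blast
    then show "set (b # ws) \<inter> set (b' # ws') = {}" using Kcs cse by blast
    show "\<not> linked E (set (b # ws)) (set (b' # ws'))"
      using K' KR linked_sym[of E "set (b # ws)"] not_linked_sub by blast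
    show "\<not> linked E {c0} {b}" "\<not> linked E {c0} {b'}" using f f' by (auto simp: linked_def)
    show "\<not> linked E Z (set ws)" using Z(3) KR f(7) unfolding linked_def by auto
    show "\<not> linked E Z (set ws')"
    proof
      assume "linked E Z (set ws')"
      then obtain e where e: "e \<in> set ws'" "linked E Z {e}" unfolding linked_def by blast
      then have "{d, e} \<in> E" using Z(6) dse nR' by auto
      then show False using e f'(7) unfolding linked_def by blast
    qed
    show "{c0} \<subseteq> K \<union> set cs" "Z \<subseteq> K \<union> set cs" "set (b # ws) \<subseteq> K \<union> set cs" "set (b' # ws') \<subseteq> K \<union> set cs"
      using Z(3) cse K' by auto
  qed
qed

text \<open>As \<open>X \<union> Y\<close> is connected, \<open>attach\<close> makes
  \<open>d0\<close> and \<open>d1\<close> adjacent, so \<open>insert d0 X\<close> and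
  \<open>insert d1 Y\<close> can be the ends of the shared edge of \<open>F1\<close>. An unwanted
  contact of \<open>X\<close> or \<open>Y\<close> would force a chord of \<open>ds\<close>.\<close>

lemma hole_joined_twice:
  assumes Z: "conn E X" "conn E Y" "X \<inter> Y = {}" "c0 \<in> X" "c1 \<in> Y" "X \<union> Y \<subseteq> insert c0 (insert c1 K) - set ds"
      "conn E (X \<union> Y)"
    and d: "d0 \<in> set ds" "d1 \<in> set ds" "d0 \<noteq> d1" "linked E {d0} X" "linked E {d1} Y"
    and dsK': "set ds \<subseteq> K"
  shows "\<exists>\<phi>. im_model E (K \<union> set cs) F1 \<phi>"
proof -
  obtain b ws where h: "hole E (c0 # c1 # b # ws)" and cse: "set cs = insert c0 (insert c1 (set (b # ws)))"
    and KR: "\<not> linked E K (set (b # ws))" and nR: "c0 \<notin> set (b # ws)" "c1 \<notin> set (b # ws)"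
    by (rule edge_attachment_frame)
  note f = hole_arcs[OF h]
  have XY: "X \<union> Y \<subseteq> K \<union> set cs" "(X \<union> Y) \<inter> set ds = {}" using Z c0 c1 by auto
  have at: "{p, q} \<in> E" if "p \<in> set ds" "q \<in> set ds" "p \<noteq> q" "linked E {p} (X \<union> Y)" "linked E {q} (X \<union> Y)" for p q
    using attach[OF Z(7) XY that] .
  have "{d0, d1} \<in> E" using at d by simp
  then obtain zs' where zs': "hole E (d0 # d1 # zs')" "set ds = insert d0 (insert d1 (set zs'))"
    using hole_rotate_to2[OF ds d(1,2)] d(3) by metis
  then obtain b' ws' where "zs' = b' # ws'" by (cases zs') auto
  with zs' have h': "hole E (d0 # d1 # b' # ws')"
    and dse: "set ds = insert d0 (insert d1 (set (b' # ws')))" by auto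
  note f' = hole_arcs[OF h']
  have nR': "d0 \<notin> set (b' # ws')" "d1 \<notin> set (b' # ws')" using hole_distinct[OF h'] by auto
  have Xs: "X \<subseteq> insert c0 K" "Y \<subseteq> insert c1 K" using Z by auto
  have dK: "d0 \<in> K" "d1 \<in> K" "set (b' # ws') \<subseteq> K" using d dsK' dse by auto
  show ?thesis
  proof (rule F1_from_holes[OF h h', of "insert d0 X" "insert d1 Y"])
    show "conn E (insert d0 X)" "conn E (insert d1 Y)"
      using d(4,5) Z(1,2) conn_insert[of E X _ d0] conn_insert[of E Y _ d1] unfolding linked_def by blast+
    show "c0 \<in> insert d0 X" "d0 \<in> insert d0 X" "c1 \<in> insert d1 Y" "d1 \<in> insert d1 Y" using Z by auto
    show "insert d0 X \<inter> insert d1 Y = {}" using Z(3,6) d by auto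
    show "insert d0 X \<inter> set (b # ws) = {}" using Xs dK Kcs nR cse by blast
    show "insert d1 Y \<inter> set (b # ws) = {}" using Xs dK Kcs nR cse by blast
    show "insert d0 X \<inter> set (b' # ws') = {}" "insert d1 Y \<inter> set (b' # ws') = {}" using XY(2) nR' dse by auto
    show "set (b # ws) \<inter> set (b' # ws') = {}" using Kcs cse dK by blast
    show "\<not> linked E (set (b # ws)) (set (b' # ws'))"
      using dK KR linked_sym[of E "set (b # ws)"] not_linked_sub by blast
    show "\<not> linked E (insert d0 X) {b}" using Xs dK KR f(8) unfolding linked_def by auto
    show "\<not> linked E (insert d1 Y) (set ws)" using Xs dK KR f(7) unfolding linked_def by auto
    show "\<not> linked E (insert d0 X) {b'}"
    proof
      assume "linked E (insert d0 X) {b'}"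
      then have "linked E {b'} X" using f'(8) linked_sym[of E X] unfolding linked_def by blast
      then have "{d0, b'} \<in> E" using at[of d0 b'] d dse nR' by auto
      then show False using f'(8) by blast
    qed
    show "\<not> linked E (insert d1 Y) (set ws')"
    proof
      assume "linked E (insert d1 Y) (set ws')"
      then have "linked E Y (set ws')" using f'(7) unfolding linked_def by blast
      then obtain e where e: "e \<in> set ws'" "linked E {e} Y"
        unfolding linked_def by (metis insert_commute singletonI)
      then have "{d1, e} \<in> E" using at[of d1 e] d dse nR' by auto
      then show False using e f'(7) unfolding linked_def by blast
    qed
    show "insert d0 X \<subseteq> K \<union> set cs" "insert d1 Y \<subseteq> K \<union> set cs" "set (b # ws) \<subseteq> K \<union> set cs"
      "set (b' # ws') \<subseteq> K \<union> set cs" using XY dK cse by auto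
  qed
qed

text \<open>\<open>insert d X\<close> is the shared vertex of \<open>F2\<close>, while
  \<open>c1\<close> stays a separate vertex of the first cycle. The condition on \<open>Y\<close>
  keeps \<open>c1\<close> from seeing \<open>ds\<close> outside \<open>d\<close>.\<close>

lemma hole_joined_once:
  assumes Z: "conn E X" "conn E Y" "X \<inter> Y = {}" "c0 \<in> X" "c1 \<in> Y" "X \<union> Y \<subseteq> insert c0 (insert c1 K) - set ds"
    and d: "d \<in> set ds" "linked E {d} X" "\<forall>e\<in>set ds. linked E {e} Y \<longrightarrow> e = d"
    and dsK': "set ds \<subseteq> K"
  shows "\<exists>\<phi>. im_model E (K \<union> set cs) F2 \<phi>"
proof -
  obtain b ws where h: "hole E (c0 # c1 # b # ws)" and cse: "set cs = insert c0 (insert c1 (set (b # ws)))"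
    and KR: "\<not> linked E K (set (b # ws))" and nR: "c0 \<notin> set (b # ws)" "c1 \<notin> set (b # ws)"
    by (rule edge_attachment_frame)
  note f = hole_arcs[OF h]
  have X: "X \<subseteq> K \<union> set cs" "X \<inter> set ds = {}" "X \<subseteq> insert c0 K" using Z c0 c1 by auto
  obtain zs' where zs': "hole E (d # zs')" "set ds = insert d (set zs')"
    using hole_rotate_to[OF ds d(1)] by metis
  then obtain a' b' ws' where "zs' = a' # b' # ws'" using hole_cases by metis
  with zs' have h': "hole E (d # a' # b' # ws')" and dse: "set ds = insert d (set (a' # b' # ws'))" by auto
  note f' = hole_arcs[OF h']
  have nR': "d \<notin> set (a' # b' # ws')" using hole_distinct[OF h'] by auto
  have dK: "d \<in> K" "set (a' # b' # ws') \<subseteq> K" using d(1) dsK' dse by auto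
  show ?thesis
  proof (rule F2_from_holes[OF h h', of "insert d X"])
    show "conn E (insert d X)" using d(2) Z(1) conn_insert[of E X _ d] unfolding linked_def by blast
    show "c0 \<in> insert d X" "d \<in> insert d X" using Z by auto
    have "d \<notin> set cs" using dK Kcs by blast
    moreover have "c1 \<notin> X" using Z by blast
    moreover have "X \<inter> set (b # ws) = {}" using X(3) Kcs nR cse by blast
    ultimately show "insert d X \<inter> set (c1 # b # ws) = {}" using cse by auto
    show "insert d X \<inter> set (a' # b' # ws') = {}" using X(2) nR' dse by auto
    show "set (c1 # b # ws) \<inter> set (a' # b' # ws') = {}" using Kcs cse dK by auto
    have "\<not> linked E (set (b # ws)) (set (a' # b' # ws'))"
      using dK KR linked_sym[of E "set (b # ws)"] not_linked_sub by blast
    moreover have "\<not> linked E {c1} (set (a' # b' # ws'))"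
    proof
      assume "linked E {c1} (set (a' # b' # ws'))"
      then obtain e where e: "e \<in> set (a' # b' # ws')" "linked E {e} Y"
        using Z(5) unfolding linked_def by (auto simp: insert_commute)
      then show False using d(3) dse nR' by blast
    qed
    ultimately show "\<not> linked E (set (c1 # b # ws)) (set (a' # b' # ws'))" unfolding linked_def by auto
    show "\<not> linked E (insert d X) {b}" using X dK KR f(8) unfolding linked_def by auto
    show "\<not> linked E (insert d X) {b'}"
    proof
      assume "linked E (insert d X) {b'}"
      then have "linked E {b'} X" using f'(8) linked_sym[of E X] unfolding linked_def by blast
      moreover have "b' \<in> set ds" "d \<noteq> b'" using dse nR' by auto
      ultimately have "{d, b'} \<in> E" using attach[OF Z(1) X(1,2), of d b'] d(1,2) by blast
      then show False using f'(8) by blast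
    qed
    show "insert d X \<subseteq> K \<union> set cs" "set (c1 # b # ws) \<subseteq> K \<union> set cs"
      "set (a' # b' # ws') \<subseteq> K \<union> set cs" using X dK cse by auto
  qed
qed

end

text \<open>If \<open>ds\<close> misses both ends of the edge, the component off \<open>ds\<close>
  containing \<open>c0\<close> and \<open>c1\<close> is split between them. Different contacts for
  the two halves give \<open>F1\<close>. Otherwise a contact \<open>d\<close> of one half is the
  only possible contact of the other, which gives \<open>F2\<close>.\<close>

lemma edge_attachment:
  assumes c0: "c0 \<in> set cs" "linked E {c0} K" and c1: "c1 \<in> set cs" "linked E {c1} K"
    and c01: "c0 \<noteq> c1" "{c0, c1} \<in> E"
    and att: "\<forall>x\<in>set cs. linked E {x} K \<longrightarrow> x = c0 \<or> x = c1"
    and dsK: "set ds \<subseteq> insert c0 (insert c1 K)"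
  shows "(\<exists>\<phi>. im_model E (K \<union> set cs) F1 \<phi>) \<or> (\<exists>\<phi>. im_model E (K \<union> set cs) F2 \<phi>)"
proof -
  have c10: "c1 \<noteq> c0" "{c1, c0} \<in> E" using c01 by (auto simp: insert_commute)
  have att': "\<forall>x\<in>set cs. linked E {x} K \<longrightarrow> x = c1 \<or> x = c0" using att by blast
  have dsK'': "set ds \<subseteq> insert c1 (insert c0 K)" using dsK by blast
  consider "c0 \<in> set ds" | "c1 \<in> set ds" | "c0 \<notin> set ds" "c1 \<notin> set ds" by blast
  then show ?thesis
  proof cases
    case 1
    then show ?thesis using hole_meets_edge[OF c0 c1 c01 att dsK] by blast
  next
    case 2
    then show ?thesis using hole_meets_edge[OF c1 c0 c10 att' dsK''] by blast
  next
    case 3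
    then have dsK': "set ds \<subseteq> K" using dsK by blast
    let ?W = "insert c0 (insert c1 K)"
    have "conn E (insert c1 K)" using c1 K conn_insert[of E K _ c1] unfolding linked_def by blast
    then have W: "conn E ?W" using c01 conn_insert[of E "insert c1 K" c1 c0] by blast
    have fW: "finite ?W" using finK by simp
    have "set ds \<noteq> {}" using ds by (cases ds) auto
    moreover have "?W \<inter> set ds = set ds" using dsK' by blast
    ultimately have ne: "?W \<inter> set ds \<noteq> {}" by simp
    have "c0 \<in> ?W - set ds" using 3 by blast
    obtain Z d where Z: "c0 \<in> Z" "Z \<subseteq> ?W - set ds" "conn E Z" "\<forall>a\<in>Z. \<forall>b\<in>?W - set ds. {a, b} \<in> E \<longrightarrow> b \<in> Z"
      "d \<in> ?W \<inter> set ds" "linked E {d} Z"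
      by (rule component_linked[OF fW W \<open>c0 \<in> ?W - set ds\<close> ne])
    have "c1 \<in> Z" using Z(1,4) c01 3 by blast
    have "finite Z" using Z(2) fW finite_subset by blast
    obtain X Y where XY: "Z = X \<union> Y" "X \<inter> Y = {}" "conn E X" "conn E Y" "c0 \<in> X" "c1 \<in> Y"
      by (rule conn_split[OF \<open>finite Z\<close> Z(3,1) \<open>c1 \<in> Z\<close> c01(1)])
    have sub: "X \<union> Y \<subseteq> ?W - set ds" "conn E (X \<union> Y)" using Z(2,3) XY(1) by auto
    have sub': "Y \<union> X \<subseteq> insert c1 (insert c0 K) - set ds" "Y \<inter> X = {}" using sub XY(2) by auto
    show ?thesis
    proof (cases "\<exists>d0\<in>set ds. \<exists>d1\<in>set ds. d0 \<noteq> d1 \<and> linked E {d0} X \<and> linked E {d1} Y")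
      case True
      then show ?thesis using hole_joined_twice[OF c0 c1 c01 att dsK XY(3,4,2,5,6) sub] dsK' by blast
    next
      case False
      have dds: "d \<in> set ds" using Z(5) by blast
      have "linked E {d} X \<or> linked E {d} Y" using Z(6) XY(1) by simp
      then show ?thesis
      proof
        assume lk: "linked E {d} X"
        \<comment> \<open>A contact \<open>e\<close> of \<open>Y\<close> other than \<open>d\<close>
          would form with \<open>d\<close> the pair excluded by the case distinction.\<close>
        have un: "\<forall>e\<in>set ds. linked E {e} Y \<longrightarrow> e = d" using False lk dds by metis
        show ?thesis
          using hole_joined_once[OF c0 c1 c01 att dsK XY(3,4,2,5,6) sub(1) dds lk un dsK'] by blast
      next
        assume lk: "linked E {d} Y"
        have un: "\<forall>e\<in>set ds. linked E {e} X \<longrightarrow> e = d" using False lk dds by metis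
        show ?thesis
          using hole_joined_once[OF c1 c0 c10 att' dsK'' XY(4,3) sub'(2) XY(6,5) sub'(1) dds lk un dsK'] by blast
      qed
    qed
  qed
qed

end

section \<open>Constructing a graph from its holes\<close>

lemma all_less_Suc_pairs:
  "(\<forall>j<Suc n. \<forall>i<j. P i j) \<longleftrightarrow> (\<forall>j<n. P 0 (Suc j)) \<and> (\<forall>j<n. \<forall>i<j. P (Suc i) (Suc j))"
proof (intro iffI conjI allI impI)
  fix j i assume "(\<forall>j<n. P 0 (Suc j)) \<and> (\<forall>j<n. \<forall>i<j. P (Suc i) (Suc j))" "j < Suc n" "i < j"
  then show "P i j" by (cases j; cases i) auto
qed auto

lemma ipath_iff_nth:
  "ipath E xs \<longleftrightarrow> distinct xs \<and> (\<forall>j<length xs. \<forall>i<j. {xs ! i, xs ! j} \<in> E \<longleftrightarrow> j = Suc i)"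
proof (induction xs)
  case (Cons x xs)
  have "(\<forall>y\<in>set xs. {x, y} \<in> E \<longleftrightarrow> y = hd xs) \<longleftrightarrow> (\<forall>j<length xs. {x, xs ! j} \<in> E \<longleftrightarrow> j = 0)" if "distinct xs"
  proof -
    have "xs ! j = hd xs \<longleftrightarrow> j = 0" if "j < length xs" for j
      using that \<open>distinct xs\<close> nth_eq_iff_index_eq[of xs j 0] by (cases xs) (auto simp: hd_conv_nth)
    then show ?thesis by (auto simp: all_set_conv_all_nth)
  qed
  then show ?case using Cons.IH by (auto simp: all_less_Suc_pairs)
qed simp

text \<open>This form can be compared with \<open>is_cycle\<close>. With \<open>i < j\<close>, the
  closing edge between index 0 and the last index is the only exceptional pair.\<close>

lemma hole_iff_nth:
  "hole E cs \<longleftrightarrow> 4 \<le> length cs \<and> distinct cs \<and>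
     (\<forall>j<length cs. \<forall>i<j. {cs ! i, cs ! j} \<in> E \<longleftrightarrow> j = Suc i \<or> i = 0 \<and> Suc j = length cs)"
proof (cases cs)
  case (Cons r zs)
  have "(\<forall>z\<in>set zs. {r, z} \<in> E \<longleftrightarrow> z = hd zs \<or> z = last zs) \<longleftrightarrow>
    (\<forall>j<length zs. {r, zs ! j} \<in> E \<longleftrightarrow> j = 0 \<or> Suc j = length zs)" if "distinct zs" "zs \<noteq> []"
  proof -
    have "zs ! j = hd zs \<longleftrightarrow> j = 0" if "j < length zs" for j
      using that \<open>distinct zs\<close> \<open>zs \<noteq> []\<close> nth_eq_iff_index_eq[of zs j 0] by (simp add: hd_conv_nth)
    moreover have "zs ! j = last zs \<longleftrightarrow> Suc j = length zs" if "j < length zs" for j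
    proof -
      have "length zs - 1 < length zs" "j = length zs - 1 \<longleftrightarrow> Suc j = length zs" using that by linarith+
      then show ?thesis
        using that \<open>distinct zs\<close> \<open>zs \<noteq> []\<close> nth_eq_iff_index_eq[of zs j "length zs - 1"] by (simp add: last_conv_nth)
    qed
    ultimately show ?thesis by (auto simp: all_set_conv_all_nth)
  qed
  then show ?thesis unfolding Cons hole.simps ipath_iff_nth
    by (cases "zs = []") (auto simp: all_less_Suc_pairs)
qed simp

lemma cycle_edges_iff:
  assumes "2 \<le> length vs"
  shows "e \<in> {{vs ! i, vs ! ((i + 1) mod length vs)} | i. i < length vs} \<longleftrightarrow>
    (\<exists>i. Suc i < length vs \<and> e = {vs ! i, vs ! Suc i}) \<or> e = {vs ! 0, vs ! (length vs - 1)}"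
    (is "?L \<longleftrightarrow> ?R")
proof
  assume ?L
  then obtain i where i: "i < length vs" "e = {vs ! i, vs ! ((i + 1) mod length vs)}" by blast
  show ?R
  proof (cases "Suc i < length vs")
    case False
    then have "Suc i = length vs" using i by simp
    then have "i = length vs - 1" "(i + 1) mod length vs = 0" by simp_all
    then show ?thesis using i by (simp add: insert_commute)
  qed (use i in auto)
next
  assume ?R
  then show ?L
  proof
    assume "\<exists>i. Suc i < length vs \<and> e = {vs ! i, vs ! Suc i}"
    then obtain i where "Suc i < length vs" "e = {vs ! i, vs ! Suc i}" by blast
    then show ?L by (intro CollectI exI[of _ i]) auto
  next
    assume e: "e = {vs ! 0, vs ! (length vs - 1)}"
    have "length vs - 1 + 1 = length vs" using assms by simp
    then have "length vs - 1 < length vs" "(length vs - 1 + 1) mod length vs = 0" by simp_all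
    then have "e = {vs ! (length vs - 1), vs ! ((length vs - 1 + 1) mod length vs)}"
      using e by (metis insert_commute)
    then show ?L using \<open>length vs - 1 < length vs\<close> by blast
  qed
qed

text \<open>No vertex set is mentioned, because in the induction \<open>E\<close> stays fixed while
  the vertex set shrinks.\<close>

definition wf_edges :: "'a set set \<Rightarrow> bool" where
  "wf_edges E \<longleftrightarrow> (\<forall>e\<in>E. \<exists>u v. u \<noteq> v \<and> e = {u, v})"

lemma wf_edgesD: "wf_edges E \<Longrightarrow> e \<in> E \<Longrightarrow> \<exists>u v. u \<noteq> v \<and> e = {u, v}"
  unfolding wf_edges_def by blast

lemma hole_is_cycle:
  assumes "wf_edges E" "hole E cs"
  shows "is_cycle (set cs, {e \<in> E. e \<subseteq> set cs})"
proof -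
  have h: "4 \<le> length cs" "distinct cs"
    and adj: "\<And>i j. i < j \<Longrightarrow> j < length cs \<Longrightarrow> {cs ! i, cs ! j} \<in> E \<longleftrightarrow> j = Suc i \<or> i = 0 \<and> Suc j = length cs"
    using assms(2) unfolding hole_iff_nth by auto
  have iff: "e \<in> E \<and> e \<subseteq> set cs \<longleftrightarrow>
      (\<exists>i. Suc i < length cs \<and> e = {cs ! i, cs ! Suc i}) \<or> e = {cs ! 0, cs ! (length cs - 1)}" for e
  proof
    assume e: "e \<in> E \<and> e \<subseteq> set cs"
    then obtain u v where uv: "u \<noteq> v" "e = {u, v}" using wf_edgesD[OF assms(1), of e] by auto
    then obtain i j where ij: "i < length cs" "u = cs ! i" "j < length cs" "v = cs ! j"
      using e by (auto simp: in_set_conv_nth)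
    have "i \<noteq> j" using uv ij by auto
    define i' where "i' = min i j"
    define j' where "j' = max i j"
    have "e = {cs ! i', cs ! j'}" "i' < j'" "j' < length cs"
      using uv ij \<open>i \<noteq> j\<close> unfolding i'_def j'_def min_def max_def by (auto simp: insert_commute)
    then show "(\<exists>i. Suc i < length cs \<and> e = {cs ! i, cs ! Suc i}) \<or> e = {cs ! 0, cs ! (length cs - 1)}"
    proof -
      have "{cs ! i', cs ! j'} \<in> E" using e \<open>e = {cs ! i', cs ! j'}\<close> by simp
      then have "j' = Suc i' \<or> i' = 0 \<and> Suc j' = length cs" using adj \<open>i' < j'\<close> \<open>j' < length cs\<close> by blast
      moreover have "Suc j' = length cs \<Longrightarrow> j' = length cs - 1" by simp
      ultimately show ?thesis using \<open>e = {cs ! i', cs ! j'}\<close> \<open>j' < length cs\<close> by auto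
    qed
  next
    assume "(\<exists>i. Suc i < length cs \<and> e = {cs ! i, cs ! Suc i}) \<or> e = {cs ! 0, cs ! (length cs - 1)}"
    then show "e \<in> E \<and> e \<subseteq> set cs"
    proof
      assume "\<exists>i. Suc i < length cs \<and> e = {cs ! i, cs ! Suc i}"
      then show ?thesis using adj by auto
    next
      assume "e = {cs ! 0, cs ! (length cs - 1)}"
      moreover have "{cs ! 0, cs ! (length cs - 1)} \<in> E" using adj[of 0 "length cs - 1"] h by auto
      moreover have "cs ! 0 \<in> set cs" "cs ! (length cs - 1) \<in> set cs" using h by (auto intro!: nth_mem)
      ultimately show ?thesis by blast
    qed
  qed
  have "2 \<le> length cs" using h by simp
  have "{e \<in> E. e \<subseteq> set cs} = {{cs ! i, cs ! ((i + 1) mod length cs)} | i. i < length cs}"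
  proof (rule set_eqI)
    fix e
    show "e \<in> {e \<in> E. e \<subseteq> set cs} \<longleftrightarrow> e \<in> {{cs ! i, cs ! ((i + 1) mod length cs)} | i. i < length cs}"
      unfolding cycle_edges_iff[OF \<open>2 \<le> length cs\<close>] using iff[of e] by simp
  qed
  then show ?thesis using h unfolding is_cycle_def by (intro exI[of _ cs]) auto
qed

lemma cycle_is_hole:
  assumes "is_cycle G" "4 \<le> card (verts G)"
  obtains cs where "hole (edges G) cs" "set cs = verts G"
proof -
  obtain vs where vs: "distinct vs" "3 \<le> length vs" "verts G = set vs"
     "edges G = {{vs ! i, vs ! ((i + 1) mod length vs)} | i. i < length vs}"
    using assms(1) unfolding is_cycle_def by blast
  have len: "4 \<le> length vs" using assms(2) vs distinct_card[of vs] by simp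
  then have "2 \<le> length vs" by simp
  have ed: "e \<in> edges G \<longleftrightarrow> (\<exists>i. Suc i < length vs \<and> e = {vs ! i, vs ! Suc i}) \<or> e = {vs ! 0, vs ! (length vs - 1)}" for e
    unfolding vs(4) using cycle_edges_iff[OF \<open>2 \<le> length vs\<close>] .
  have "{vs ! i, vs ! j} \<in> edges G \<longleftrightarrow> j = Suc i \<or> i = 0 \<and> Suc j = length vs" if "i < j" "j < length vs" for i j
  proof -
    have inj: "{vs ! i, vs ! j} = {vs ! k, vs ! l} \<longleftrightarrow> i = k \<and> j = l" if "k < l" "l < length vs" for k l
      using that \<open>i < j\<close> \<open>j < length vs\<close> vs(1) by (auto simp: doubleton_eq_iff nth_eq_iff_index_eq)
    then have "{vs ! i, vs ! j} = {vs ! k, vs ! Suc k} \<longleftrightarrow> i = k \<and> j = Suc k" if "Suc k < length vs" for k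
      using that by simp
    moreover have "{vs ! i, vs ! j} = {vs ! 0, vs ! (length vs - 1)} \<longleftrightarrow> i = 0 \<and> Suc j = length vs"
      using inj[of 0 "length vs - 1"] len by auto
    ultimately show ?thesis unfolding ed using that by auto
  qed
  then have "hole (edges G) vs" unfolding hole_iff_nth using vs(1) len by blast
  then show ?thesis using that vs(3) by blast
qed

section \<open>Peeling off simplicial vertices\<close>

lemma im_model_mono: "im_model E S H \<phi> \<Longrightarrow> S \<subseteq> T \<Longrightarrow> im_model E T H \<phi>"
  unfolding im_model_def by blast

text \<open>Three neighbours and \<open>r\<close> would form a clique on four vertices. The
  remaining degrees one and two are what \<open>c_A1\<close> and \<open>c_A2\<close> can
  add.\<close>

lemma simplicial_few_nbrs:
  assumes "finite N" "N \<subseteq> S" "r \<in> S" "r \<notin> N" "\<forall>x\<in>N. {r, x} \<in> E" "\<forall>x\<in>N. \<forall>y\<in>N. x \<noteq> y \<longrightarrow> {x, y} \<in> E"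
    and K4: "\<not> (\<exists>\<phi>. im_model E S K4 \<phi>)"
  shows "N = {} \<or> (\<exists>x. N = {x}) \<or> (\<exists>x y. N = {x, y} \<and> x \<noteq> y)"
proof (rule ccontr)
  assume no: "\<not> ?thesis"
  then obtain x where x: "x \<in> N" by blast
  with no obtain y where y: "y \<in> N" "y \<noteq> x" by blast
  with no x obtain z where z: "z \<in> N" "z \<noteq> x" "z \<noteq> y" by blast
  have "\<exists>\<phi>. im_model E S K4 \<phi>"
    by (rule K4_model[of "{r}" _ _ "{x}" "{y}" "{z}"]) (use x y z assms in \<open>auto simp: linked_def\<close>)
  then show False using K4 by blast
qed

text \<open>The induction common to both routes into (4). \<open>AC\<close> and \<open>NH\<close>
  abstract what each route knows about holes; they range over all subsets of \<open>S\<close>, so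
  they are inherited when a vertex is removed.\<close>

theorem constructible_from_holes:
  assumes "finite S" "S \<noteq> {}" "conn E S" and wf: "wf_edges E"
    and K4: "\<not> (\<exists>\<phi>. im_model E S K4 \<phi>)"
    and AC: "\<And>cs K p q. hole E cs \<Longrightarrow> set cs \<subseteq> S \<Longrightarrow> K \<subseteq> S \<Longrightarrow> conn E K \<Longrightarrow> K \<inter> set cs = {} \<Longrightarrow>
      p \<in> set cs \<Longrightarrow> q \<in> set cs \<Longrightarrow> p \<noteq> q \<Longrightarrow> linked E {p} K \<Longrightarrow> linked E {q} K \<Longrightarrow> {p, q} \<in> E"
    and NH: "\<And>cs K ds. hole E cs \<Longrightarrow> set cs \<subseteq> S \<Longrightarrow> K \<subseteq> S \<Longrightarrow> conn E K \<Longrightarrow> K \<noteq> {} \<Longrightarrow> K \<inter> set cs = {} \<Longrightarrow>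
      \<exists>c\<in>set cs. linked E {c} K \<Longrightarrow> hole E ds \<Longrightarrow> \<not> set ds \<subseteq> K \<union> {c \<in> set cs. linked E {c} K}"
  shows "A12_constructible (S, {e \<in> E. e \<subseteq> S})"
  using assms
proof (induction S rule: finite_psubset_induct)
  case (psubset S)
  note AC = psubset.prems(5) and NH = psubset.prems(6)
  have noloop: "{x} \<notin> E" for x using wf unfolding wf_edges_def by (metis doubleton_eq_iff insert_absorb2)
  show ?case
  proof (cases "\<exists>cs. hole E cs \<and> set cs = S")
    case True
    then show ?thesis using hole_is_cycle[OF wf] c_cycle by blast
  next
    case nocyc: False
    have "\<exists>r\<in>S. \<forall>x\<in>S - {r}. \<forall>y\<in>S - {r}. x \<noteq> y \<longrightarrow> {r, x} \<in> E \<longrightarrow> {r, y} \<in> E \<longrightarrow> {x, y} \<in> E"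
    proof (cases "\<exists>cs. hole E cs \<and> set cs \<subseteq> S")
      case False
      then show ?thesis using simplicial_vertex_exists[OF psubset.hyps False, of "{}"] psubset.prems(1) by auto
    next
      case True
      then obtain cs where cs: "hole E cs" "set cs \<subseteq> S" by blast
      then obtain k where k: "k \<in> S - set cs" using nocyc by blast
      have "finite (S - set cs)" using psubset.hyps by blast
      then obtain K where K: "k \<in> K" "K \<subseteq> S - set cs" "conn E K" "\<forall>a\<in>K. \<forall>b\<in>S - set cs. {a, b} \<in> E \<longrightarrow> b \<in> K"
        using k by (rule component_exists)
      have Ks: "K \<subseteq> S" "K \<inter> set cs = {}" "K \<noteq> {}" using K by auto
      have "K \<noteq> S" using cs Ks by (cases cs) auto
      then obtain a b where ab: "a \<in> K" "b \<in> S" "b \<notin> K" "{a, b} \<in> E"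
        using connD[OF psubset.prems(2) Ks(1,3)] by blast
      then have "b \<in> set cs" using K(4) by blast
      moreover have "linked E {b} K" using ab unfolding linked_def by (auto simp: insert_commute)
      ultimately have ex: "\<exists>c\<in>set cs. linked E {c} K" by blast
      let ?A = "{c \<in> set cs. linked E {c} K}"
      have "\<not> (\<exists>ds. hole E ds \<and> set ds \<subseteq> K \<union> ?A)"
        using NH[OF cs Ks(1) K(3) Ks(3,2) ex] by blast
      moreover have "finite (K \<union> ?A)" using Ks(1) psubset.hyps finite_subset by auto
      moreover have "?A \<subset> K \<union> ?A" using Ks by blast
      moreover have "\<forall>x\<in>?A. \<forall>y\<in>?A. x \<noteq> y \<longrightarrow> {x, y} \<in> E"
        using AC[OF cs Ks(1) K(3) Ks(2)] by blast
      \<comment> \<open>The clique to be avoided is the set of attachments. A vertex of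
        \<open>K\<close> has all its neighbours in \<open>K \<union> ?A\<close>, so being simplicial
        there means being simplicial in \<open>S\<close>, which could fail for a vertex of the
        hole.\<close>
      ultimately have "\<exists>r\<in>K \<union> ?A - ?A. \<forall>x\<in>K \<union> ?A - {r}. \<forall>y\<in>K \<union> ?A - {r}.
          x \<noteq> y \<longrightarrow> {r, x} \<in> E \<longrightarrow> {r, y} \<in> E \<longrightarrow> {x, y} \<in> E"
        by (intro simplicial_vertex_exists)
      then obtain r where r: "r \<in> K" and
         rs: "\<forall>x\<in>K \<union> ?A - {r}. \<forall>y\<in>K \<union> ?A - {r}. x \<noteq> y \<longrightarrow> {r, x} \<in> E \<longrightarrow> {r, y} \<in> E \<longrightarrow> {x, y} \<in> E" by blast
      have nb: "x \<in> K \<union> ?A" if "x \<in> S" "{r, x} \<in> E" for x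
      proof (cases "x \<in> set cs")
        case True
        then have "linked E {x} K" using that r unfolding linked_def by (auto simp: insert_commute)
        then show ?thesis using True by blast
      next
        case False
        then show ?thesis using that r K(4) by blast
      qed
      have "\<forall>x\<in>S - {r}. \<forall>y\<in>S - {r}. x \<noteq> y \<longrightarrow> {r, x} \<in> E \<longrightarrow> {r, y} \<in> E \<longrightarrow> {x, y} \<in> E"
        using rs nb by blast
      then show ?thesis using r Ks(1) by blast
    qed
    then obtain r where r: "r \<in> S"
      and rs: "\<forall>x\<in>S - {r}. \<forall>y\<in>S - {r}. x \<noteq> y \<longrightarrow> {r, x} \<in> E \<longrightarrow> {r, y} \<in> E \<longrightarrow> {x, y} \<in> E" by blast
    show ?thesis
    proof (cases "S = {r}")
      case True
      have "{e \<in> E. e \<subseteq> {r}} = {}" using wf unfolding wf_edges_def by fastforce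
      then show ?thesis using c_K1[of r] unfolding True by metis
    next
      case False
      let ?S = "S - {r}"
      define N where "N = {x \<in> ?S. {r, x} \<in> E}"
      have sub: "?S \<subset> S" "?S \<noteq> {}" using r False by auto
      have cS: "conn E ?S"
        by (rule conn_remove_simplicial[OF psubset.prems(2)]) (use rs in blast)
      have K4': "\<not> (\<exists>\<phi>. im_model E ?S K4 \<phi>)" using psubset.prems(4) im_model_mono[of E ?S] by blast
      have A: "A12_constructible (?S, {e \<in> E. e \<subseteq> ?S})"
      proof (rule psubset.IH[OF sub cS wf K4'])
        show "{p, q} \<in> E" if "hole E cs" "set cs \<subseteq> ?S" "K \<subseteq> ?S" "conn E K" "K \<inter> set cs = {}" "p \<in> set cs"
          "q \<in> set cs" "p \<noteq> q" "linked E {p} K" "linked E {q} K" for cs K p q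
          using AC[of cs K p q] that by blast
        show "\<not> set ds \<subseteq> K \<union> {c \<in> set cs. linked E {c} K}" if "hole E cs" "set cs \<subseteq> ?S" "K \<subseteq> ?S" "conn E K"
          "K \<noteq> {}" "K \<inter> set cs = {}" "\<exists>c\<in>set cs. linked E {c} K" "hole E ds" for cs K ds
          using NH[of cs K ds] that by blast
      qed
      have "finite N" using psubset.hyps unfolding N_def by simp
      then have "N = {} \<or> (\<exists>x. N = {x}) \<or> (\<exists>x y. N = {x, y} \<and> x \<noteq> y)"
        by (rule simplicial_few_nbrs[of _ S r E]) (use r rs psubset.prems(4) in \<open>auto simp: N_def\<close>)
      moreover have "N \<noteq> {}"
      proof -
        obtain a b where "a \<in> {r}" "b \<in> S" "b \<notin> {r}" "{a, b} \<in> E"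
          using connD[OF psubset.prems(2), of "{r}"] r False by blast
        then show ?thesis unfolding N_def by blast
      qed
      moreover have Seq: "S = insert r ?S" "r \<notin> ?S" using r by auto
      moreover have Eeq: "{e \<in> E. e \<subseteq> S} = {e \<in> E. e \<subseteq> ?S} \<union> {{r, x} | x. x \<in> N}"
      proof (intro set_eqI iffI)
        fix e assume e: "e \<in> {e \<in> E. e \<subseteq> S}"
        show "e \<in> {e \<in> E. e \<subseteq> ?S} \<union> {{r, x} | x. x \<in> N}"
        proof (cases "r \<in> e")
          case True
          obtain u v where "u \<noteq> v" "e = {u, v}" using e wf_edgesD[OF wf, of e] by auto
          then obtain x where "e = {r, x}" "x \<noteq> r" using True by auto
          then show ?thesis using e unfolding N_def by blast
        qed (use e in blast)
      next
        fix e assume "e \<in> {e \<in> E. e \<subseteq> ?S} \<union> {{r, x} | x. x \<in> N}"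
        then show "e \<in> {e \<in> E. e \<subseteq> S}" using r unfolding N_def by auto
      qed
      moreover have "A12_constructible (insert r ?S, {e \<in> E. e \<subseteq> ?S} \<union> {{r, x} | x. x \<in> N})" if "N = {x}" for x
      proof -
        have "x \<in> ?S" using that unfolding N_def by blast
        moreover have "{e \<in> E. e \<subseteq> ?S} \<union> {{r, x} | x. x \<in> N} = insert {r, x} {e \<in> E. e \<subseteq> ?S}" using that by auto
        ultimately show ?thesis using c_A1[OF A, of x r] by simp
      qed
      moreover have "A12_constructible (insert r ?S, {e \<in> E. e \<subseteq> ?S} \<union> {{r, x} | x. x \<in> N})"
        if "N = {x, y}" "x \<noteq> y" for x y
      proof -
        have "x \<in> ?S" "y \<in> ?S" "{x, y} \<in> E" using that rs unfolding N_def by blast+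
        then have "{x, y} \<in> {e \<in> E. e \<subseteq> ?S}" by blast
        moreover have "{{r, x} | x. x \<in> N} = {{r, x}, {r, y}}" using that by auto
        ultimately show ?thesis using c_A2[OF A, of x y r] by simp
      qed
      ultimately show ?thesis by metis
    qed
  qed
qed

section \<open>From forbidden induced minors, or from a unique hole, to constructibility\<close>

lemma reach_refl: "x \<in> verts G \<Longrightarrow> reach G x x"
  unfolding reach_def by blast

lemma conn_iff_reach:
  assumes "graph G"
  shows "conn (edges G) (verts G) \<longleftrightarrow> (\<forall>x\<in>verts G. \<forall>y\<in>verts G. reach G x y)"
proof
  assume c: "conn (edges G) (verts G)"
  show "\<forall>x\<in>verts G. \<forall>y\<in>verts G. reach G x y"
  proof (intro ballI, rule ccontr)
    fix x y assume xy: "x \<in> verts G" "y \<in> verts G" "\<not> reach G x y"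
    let ?P = "{z \<in> verts G. reach G x z}"
    have "x \<in> ?P" "y \<notin> ?P" using xy reach_refl[OF xy(1)] by simp_all
    then have "?P \<subseteq> verts G" "?P \<noteq> {}" "?P \<noteq> verts G" using xy(2) by blast+
    then obtain a b where ab: "a \<in> ?P" "b \<in> verts G" "b \<notin> ?P" "{a, b} \<in> edges G"
      by (rule connD[OF c])
    then have "reach G x b" unfolding reach_def adj_def by (auto intro: rtrancl_into_rtrancl)
    then show False using ab by blast
  qed
next
  assume r: "\<forall>x\<in>verts G. \<forall>y\<in>verts G. reach G x y"
  show "conn (edges G) (verts G)"
  proof (rule connI, rule ccontr)
    fix P assume P: "P \<subseteq> verts G" "P \<noteq> {}" "P \<noteq> verts G" and no: "\<not> (\<exists>a\<in>P. \<exists>b\<in>verts G - P. {a, b} \<in> edges G)"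
    then obtain x y where xy: "x \<in> P" "y \<in> verts G" "y \<notin> P" by blast
    then have "(x, y) \<in> {(x, y). adj G x y}\<^sup>*" using r P unfolding reach_def by blast
    then have "y \<in> P"
    proof (induction rule: rtrancl_induct)
      case base then show ?case using xy by blast
    next
      case (step y z)
      then have "{y, z} \<in> edges G" unfolding adj_def by blast
      then have "z \<in> verts G" using graph_adj_verts[OF assms] by blast
      then show ?case using no step \<open>{y, z} \<in> edges G\<close> by blast
    qed
    then show False using xy by blast
  qed
qed

lemma connected_iff_conn:
  "graph G \<Longrightarrow> connected G \<longleftrightarrow> verts G \<noteq> {} \<and> conn (edges G) (verts G)"
  unfolding connected_def using conn_iff_reach by blast

lemma graph_wf_edges: "graph G \<Longrightarrow> wf_edges (edges G)"
  unfolding graph_def wf_edges_def by blast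

lemma graph_edges_restrict: "graph G \<Longrightarrow> (verts G, {e \<in> edges G. e \<subseteq> verts G}) = G"
proof -
  assume "graph G"
  then have "{e \<in> edges G. e \<subseteq> verts G} = edges G" using graph_edge_sub[of G] by blast
  then show ?thesis by (simp add: verts_def edges_def)
qed

lemma no_loops_forbidden:
  "\<forall>i. {i} \<notin> edges K4" "\<forall>i. {i} \<notin> edges K23" "\<forall>i. {i} \<notin> edges F1" "\<forall>i. {i} \<notin> edges F2"
  by (auto simp: edges_K4 edges_K23 edges_F1 edges_F2)

lemma no_model:
  assumes "graph G" "\<not> has_induced_minor G H" "\<forall>i. {i} \<notin> edges H"
  shows "\<not> (\<exists>\<phi>. im_model (edges G) (verts G) H \<phi>)"
  using im_model_imp_induced_minor[OF assms(1) _ assms(3)] assms(2) by blast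

lemma no_K4_model:
  assumes "graph G" "\<not> has_minor G K4"
  shows "\<not> (\<exists>\<phi>. im_model (edges G) (verts G) K4 \<phi>)"
proof (rule no_model[OF assms(1) _ no_loops_forbidden(1)])
  show "\<not> has_induced_minor G K4"
    using assms(2) induced_minor_imp_minor unfolding has_induced_minor_def has_minor_def by blast
qed

text \<open>\<open>AC\<close> holds because nonadjacent attachments produce a \<open>K23\<close>. A
  hole violating \<open>NH\<close> is the second hole of \<open>two_holes\<close>, which produces
  \<open>F1\<close> or \<open>F2\<close>.\<close>

lemma induced_minor_free_constructible:
  assumes G: "graph G" "connected G" "\<not> has_minor G K4"
    and K23: "\<not> has_induced_minor G K23" and F1: "\<not> has_induced_minor G F1" and F2: "\<not> has_induced_minor G F2"
  shows "A12_constructible G"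
proof -
  let ?E = "edges G" and ?V = "verts G"
  note K4 = no_K4_model[OF G(1,3)]
  have K23: "\<not> (\<exists>\<phi>. im_model ?E ?V K23 \<phi>)"
    by (rule no_model[OF G(1) K23 no_loops_forbidden(2)])
  have F1: "\<not> (\<exists>\<phi>. im_model ?E ?V F1 \<phi>)"
    by (rule no_model[OF G(1) F1 no_loops_forbidden(3)])
  have F2: "\<not> (\<exists>\<phi>. im_model ?E ?V F2 \<phi>)"
    by (rule no_model[OF G(1) F2 no_loops_forbidden(4)])
  have fin: "finite ?V" using G(1) unfolding graph_def by blast
  have AC: "{p, q} \<in> ?E" if h: "hole ?E cs" "set cs \<subseteq> ?V" "K \<subseteq> ?V" "conn ?E K" "K \<inter> set cs = {}" "p \<in> set cs"
      "q \<in> set cs" "p \<noteq> q" "linked ?E {p} K" "linked ?E {q} K" for cs K p q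
  proof (rule ccontr)
    assume n: "{p, q} \<notin> ?E"
    have sub: "K \<union> set cs \<subseteq> ?V" using h by blast
    have "K \<noteq> {}" using h unfolding linked_def by blast
    moreover have "\<not> (\<exists>\<phi>. im_model ?E (K \<union> set cs) K4 \<phi>)" using K4 im_model_mono[OF _ sub] by blast
    ultimately have "\<exists>\<phi>. im_model ?E (K \<union> set cs) K23 \<phi>"
      using attachments_nonadjacent(1)[OF h(1,4) _ h(5) _ h(6-10) n] by blast
    then show False using K23 im_model_mono[OF _ sub] by blast
  qed
  have NH: "\<not> set ds \<subseteq> K \<union> {c \<in> set cs. linked ?E {c} K}"
    if h: "hole ?E cs" "set cs \<subseteq> ?V" "K \<subseteq> ?V" "conn ?E K" "K \<noteq> {}" "K \<inter> set cs = {}"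
      "\<exists>c\<in>set cs. linked ?E {c} K" "hole ?E ds" for cs K ds
  proof
    assume dsK: "set ds \<subseteq> K \<union> {c \<in> set cs. linked ?E {c} K}"
    have sub: "K \<union> set cs \<subseteq> ?V" using h by blast
    have dsV: "set ds \<subseteq> ?V" using dsK h by blast
    \<comment> \<open>Here \<open>attach\<close> is \<open>AC\<close> for the hole \<open>ds\<close>
      in place of \<open>cs\<close>.\<close>
    interpret two_holes ?E cs ds K
    proof
      show "finite K" using fin h(3) finite_subset by blast
      show "{p, q} \<in> ?E" if "conn ?E Z" "Z \<subseteq> K \<union> set cs" "Z \<inter> set ds = {}" "p \<in> set ds" "q \<in> set ds"
        "p \<noteq> q" "linked ?E {p} Z" "linked ?E {q} Z" for Z p q
      proof -
        have "Z \<subseteq> ?V" using that(2) sub by blast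
        show ?thesis by (rule AC[OF h(8) dsV \<open>Z \<subseteq> ?V\<close> that(1,3-8)])
      qed
    qed (use h in auto)
    obtain c where c: "c \<in> set cs" "linked ?E {c} K" using h(7) by blast
    have "(\<exists>\<phi>. im_model ?E (K \<union> set cs) F1 \<phi>) \<or> (\<exists>\<phi>. im_model ?E (K \<union> set cs) F2 \<phi>)"
    proof (cases "\<forall>x\<in>set cs. linked ?E {x} K \<longrightarrow> x = c")
      case True
      then have "set ds \<subseteq> insert c K" using dsK by blast
      then show ?thesis using one_attachment[OF c True] by blast
    next
      case False
      then obtain d where d: "d \<in> set cs" "linked ?E {d} K" "c \<noteq> d" by blast
      let ?A = "{c \<in> set cs. linked ?E {c} K}"
      have cd: "{c, d} \<in> ?E" using AC[OF h(1-4,6) c(1) d(1) d(3) c(2) d(2)] .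
      have "?A = {c, d}"
      proof (rule hole_clique[OF h(1)])
        show "{x, y} \<in> ?E" if "x \<in> ?A" "y \<in> ?A" "x \<noteq> y" for x y
          using AC[OF h(1-4,6), of x y] that by blast
      qed (use c d in auto)
      then have "\<forall>x\<in>set cs. linked ?E {x} K \<longrightarrow> x = c \<or> x = d" "set ds \<subseteq> insert c (insert d K)"
        using dsK by blast+
      then show ?thesis by (rule edge_attachment[OF c d(1,2,3) cd])
    qed
    then show False using F1 F2 im_model_mono[OF _ sub] by blast
  qed
  have "?V \<noteq> {}" "conn ?E ?V" using G(2) connected_iff_conn[OF G(1)] by simp_all
  then have "A12_constructible (?V, {e \<in> ?E. e \<subseteq> ?V})"
    by (rule constructible_from_holes[OF fin _ _ graph_wf_edges[OF G(1)] K4 AC NH])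
  then show ?thesis using graph_edges_restrict[OF G(1)] by simp
qed

text \<open>Nonadjacent attachments would create a second hole, whence \<open>AC\<close>. A hole
  violating \<open>NH\<close> has the same vertices as \<open>cs\<close> and so misses
  \<open>K\<close>; then every vertex of \<open>cs\<close> is attached, and \<open>AC\<close> would
  make the hole a clique.\<close>

lemma unique_hole_constructible:
  assumes G: "graph G" "connected G" "\<not> has_minor G K4"
    and uniq: "\<And>cs ds. hole (edges G) cs \<Longrightarrow> set cs \<subseteq> verts G \<Longrightarrow> hole (edges G) ds \<Longrightarrow> set ds \<subseteq> verts G \<Longrightarrow>
       set cs = set ds"
  shows "A12_constructible G"
proof -
  let ?E = "edges G" and ?V = "verts G"
  note K4 = no_K4_model[OF G(1,3)]
  have fin: "finite ?V" using G(1) unfolding graph_def by blast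
  have AC: "{p, q} \<in> ?E" if h: "hole ?E cs" "set cs \<subseteq> ?V" "K \<subseteq> ?V" "conn ?E K" "K \<inter> set cs = {}" "p \<in> set cs"
      "q \<in> set cs" "p \<noteq> q" "linked ?E {p} K" "linked ?E {q} K" for cs K p q
  proof (rule ccontr)
    assume n: "{p, q} \<notin> ?E"
    have sub: "K \<union> set cs \<subseteq> ?V" using h by blast
    have "K \<noteq> {}" using h unfolding linked_def by blast
    moreover have "\<not> (\<exists>\<phi>. im_model ?E (K \<union> set cs) K4 \<phi>)" using K4 im_model_mono[OF _ sub] by blast
    ultimately obtain ds where ds: "hole ?E ds" "set ds \<subseteq> K \<union> set cs" "set ds \<noteq> set cs"
      using attachments_nonadjacent(2)[OF h(1,4) _ h(5) _ h(6-10) n] by blast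
    then show False using uniq[OF h(1,2) ds(1)] sub by blast
  qed
  have NH: "\<not> set ds \<subseteq> K \<union> {c \<in> set cs. linked ?E {c} K}"
    if h: "hole ?E cs" "set cs \<subseteq> ?V" "K \<subseteq> ?V" "conn ?E K" "K \<noteq> {}" "K \<inter> set cs = {}"
      "\<exists>c\<in>set cs. linked ?E {c} K" "hole ?E ds" for cs K ds
  proof
    assume dsK: "set ds \<subseteq> K \<union> {c \<in> set cs. linked ?E {c} K}"
    then have dsV: "set ds \<subseteq> ?V" using h by blast
    have eq: "set cs = set ds" using uniq[OF h(1,2,8) dsV] .
    then have att: "linked ?E {x} K" if "x \<in> set cs" for x using that dsK h(6) by blast
    obtain x where x: "x \<in> set cs" using h(7) by blast
    obtain a b where ab: "a \<in> set cs" "b \<in> set cs" "a \<noteq> b" "{a, b} \<notin> ?E" using hole_nbrs[OF h(1) x] by metis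
    then show False using AC[OF h(1-4,6) ab(1,2,3) att att] by blast
  qed
  have "?V \<noteq> {}" "conn ?E ?V" using G(2) connected_iff_conn[OF G(1)] by simp_all
  then have "A12_constructible (?V, {e \<in> ?E. e \<subseteq> ?V})"
    by (rule constructible_from_holes[OF fin _ _ graph_wf_edges[OF G(1)] K4 AC NH])
  then show ?thesis using graph_edges_restrict[OF G(1)] by simp
qed

section \<open>1-perfect orientations\<close>

lemma orientation_iff:
  "orientation G D \<longleftrightarrow> (\<forall>u v. (u, v) \<in> D \<longrightarrow> {u, v} \<in> edges G) \<and>
     (\<forall>u v. {u, v} \<in> edges G \<longrightarrow> ((u, v) \<in> D \<longleftrightarrow> (v, u) \<notin> D))"
  unfolding orientation_def by auto

text \<open>Orienting all new edges away from \<open>w\<close> gives \<open>w\<close> the clique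
  \<open>N\<close> as out-neighbourhood and leaves all others unchanged.\<close>

lemma one_perfect_add_simplicial:
  assumes G: "graph (V, E)" and D: "one_perfect_orientation (V, E) D" and w: "w \<notin> V"
    and N: "clique (V, E) N"
  shows "graph (insert w V, E \<union> {{w, x} | x. x \<in> N})"
    and "one_perfect_orientation (insert w V, E \<union> {{w, x} | x. x \<in> N}) (D \<union> {(w, x) | x. x \<in> N})"
proof -
  have NV: "N \<subseteq> V" using N unfolding clique_def by auto
  have EV: "u \<in> V \<and> v \<in> V" if "{u, v} \<in> E" for u v using graph_adj_verts[OF G, of u v] that by simp
  show "graph (insert w V, E \<union> {{w, x} | x. x \<in> N})"
    unfolding graph_def
  proof (intro conjI ballI)
    show "finite (verts (insert w V, E \<union> {{w, x} | x. x \<in> N}))" using G unfolding graph_def by simp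
    fix e assume "e \<in> edges (insert w V, E \<union> {{w, x} | x. x \<in> N})"
    then consider "e \<in> E" | x where "x \<in> N" "e = {w, x}" by auto
    then show "\<exists>u v. u \<noteq> v \<and> u \<in> verts (insert w V, E \<union> {{w, x} | x. x \<in> N}) \<and>
        v \<in> verts (insert w V, E \<union> {{w, x} | x. x \<in> N}) \<and> e = {u, v}"
    proof cases
      case 1
      then obtain u v where "u \<noteq> v" "u \<in> V" "v \<in> V" "e = {u, v}" using G unfolding graph_def by auto
      then show ?thesis by auto
    next
      case 2
      then show ?thesis using NV w by (intro exI[of _ w] exI[of _ x]) auto
    qed
  qed
  have o1: "{u, v} \<in> E" if "(u, v) \<in> D" for u v
    using D that unfolding one_perfect_orientation_def orientation_iff by simp
  have o2: "(u, v) \<in> D \<longleftrightarrow> (v, u) \<notin> D" if "{u, v} \<in> E" for u v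
    using D that unfolding one_perfect_orientation_def orientation_iff by simp
  have Dw: "(u, v) \<in> D \<Longrightarrow> u \<noteq> w \<and> v \<noteq> w" for u v using o1 EV w by blast
  let ?G = "(insert w V, E \<union> {{w, x} | x. x \<in> N})" and ?D = "D \<union> {(w, x) | x. x \<in> N}"
  have "(u, v) \<in> ?D \<longleftrightarrow> (v, u) \<notin> ?D" if "{u, v} \<in> edges ?G" for u v
  proof (cases "{u, v} \<in> E")
    case True
    then have "u \<noteq> w" "v \<noteq> w" using EV w by blast+
    then show ?thesis using o2[OF True] by blast
  next
    case False
    moreover have "{u, v} \<in> E \<union> {{w, x} | x. x \<in> N}" using that by simp
    ultimately obtain x where x: "x \<in> N" "{u, v} = {w, x}" by blast
    then have "x \<noteq> w" using NV w by blast
    have "(u = w \<and> v = x) \<or> (u = x \<and> v = w)" using x(2) by (simp add: doubleton_eq_iff)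
    then show ?thesis using Dw x(1) \<open>x \<noteq> w\<close> by auto
  qed
  moreover have "{u, v} \<in> edges ?G" if "(u, v) \<in> ?D" for u v using that o1 by auto
  moreover have "clique ?G {z. (v, z) \<in> ?D}" if "v \<in> verts ?G" for v
  proof (cases "v = w")
    case True
    then have "{z. (v, z) \<in> ?D} = N" using Dw by auto
    then show ?thesis using N unfolding clique_def by auto
  next
    case False
    then have "v \<in> V" "{z. (v, z) \<in> ?D} = {z. (v, z) \<in> D}" using that by auto
    then show ?thesis using D unfolding one_perfect_orientation_def clique_def by auto
  qed
  ultimately show "one_perfect_orientation ?G ?D"
    unfolding one_perfect_orientation_def orientation_iff by blast
qed

lemma graph_cycle:
  assumes "is_cycle G"
  shows "graph G"
proof -
  obtain vs where vs: "distinct vs" "3 \<le> length vs" "verts G = set vs"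
     "edges G = {{vs ! i, vs ! ((i + 1) mod length vs)} | i. i < length vs}"
    using assms unfolding is_cycle_def by blast
  show ?thesis unfolding graph_def
  proof (intro conjI ballI)
    show "finite (verts G)" using vs by simp
    fix e assume "e \<in> edges G"
    then obtain i where i: "i < length vs" "e = {vs ! i, vs ! ((i + 1) mod length vs)}" using vs(4) by blast
    have "(i + 1) mod length vs < length vs" "(i + 1) mod length vs \<noteq> i"
      using i(1) vs(2) by (auto simp: mod_Suc)
    then show "\<exists>u v. u \<noteq> v \<and> u \<in> verts G \<and> v \<in> verts G \<and> e = {u, v}"
      using i vs(1,3) nth_eq_iff_index_eq[OF vs(1)] nth_mem by metis
  qed
qed

text \<open>Oriented all the way round, the cycle gives every vertex a single out-neighbour.\<close>

lemma cycle_one_perfectly_orientable: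
  assumes "is_cycle G"
  shows "one_perfectly_orientable G"
proof -
  obtain vs where vs: "distinct vs" "3 \<le> length vs" "verts G = set vs"
     "edges G = {{vs ! i, vs ! ((i + 1) mod length vs)} | i. i < length vs}"
    using assms unfolding is_cycle_def by blast
  define s where "s i = (i + 1) mod length vs" for i
  \<comment> \<open>Length at least 3 gives \<open>s (s i) \<noteq> i\<close>, so no arc of
    \<open>D\<close> occurs together with its reverse.\<close>
  have s: "s i < length vs" "s (s i) \<noteq> i" if "i < length vs" for i
    using that vs(2) unfolding s_def by (auto simp: mod_Suc)
  define D where "D = {(vs ! i, vs ! s i) | i. i < length vs}"
  have eq: "vs ! i = vs ! j \<longleftrightarrow> i = j" if "i < length vs" "j < length vs" for i j
    using that vs(1) nth_eq_iff_index_eq by blast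
  have ed: "{u, v} \<in> edges G \<longleftrightarrow> (u, v) \<in> D \<or> (v, u) \<in> D" for u v
    unfolding vs(4) D_def s_def by (auto simp: doubleton_eq_iff)
  have "(v, u) \<notin> D" if "(u, v) \<in> D" for u v
  proof
    assume "(v, u) \<in> D"
    with that obtain i j where ij: "i < length vs" "u = vs ! i" "v = vs ! s i"
      "j < length vs" "v = vs ! j" "u = vs ! s j" unfolding D_def by blast
    then have "j = s i" "i = s j" using eq s(1) by simp_all
    then show False using s(2)[OF ij(1)] by metis
  qed
  then have "orientation G D" unfolding orientation_iff using ed by blast
  moreover have "clique G {w. (v, w) \<in> D}" for v
  proof -
    have "w = w'" if "(v, w) \<in> D" "(v, w') \<in> D" for w w' using that eq unfolding D_def by auto
    moreover have "w \<in> verts G" if "(v, w) \<in> D" for w using that s(1) vs(3) unfolding D_def by auto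
    ultimately show ?thesis unfolding clique_def by auto
  qed
  ultimately show ?thesis unfolding one_perfectly_orientable_def one_perfect_orientation_def by blast
qed

lemma constructible_graph_orientable:
  "A12_constructible G \<Longrightarrow> graph G \<and> one_perfectly_orientable G"
proof (induction rule: A12_constructible.induct)
  case (c_K1 x)
  have "one_perfect_orientation ({x}, {}) {}"
    unfolding one_perfect_orientation_def orientation_def clique_def by simp
  then show ?case unfolding one_perfectly_orientable_def graph_def by auto
next
  case (c_cycle G)
  then show ?case using graph_cycle cycle_one_perfectly_orientable by blast
next
  case (c_A1 V E x w)
  then obtain D where D: "one_perfect_orientation (V, E) D" unfolding one_perfectly_orientable_def by blast
  have cl: "clique (V, E) {x}" using c_A1 unfolding clique_def by simp
  have eq: "insert {w, x} E = E \<union> {{w, z} | z. z \<in> {x}}" by auto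
  show ?case unfolding eq one_perfectly_orientable_def
    using one_perfect_add_simplicial[OF _ D c_A1.hyps(3) cl] c_A1.IH by blast
next
  case (c_A2 V E x y w)
  then obtain D where D: "one_perfect_orientation (V, E) D" unfolding one_perfectly_orientable_def by blast
  have "x \<in> V \<and> y \<in> V" using c_A2 graph_adj_verts[of "(V, E)" x y] by simp
  then have cl: "clique (V, E) {x, y}" using c_A2 unfolding clique_def by (auto simp: insert_commute)
  have eq: "E \<union> {{w, x}, {w, y}} = E \<union> {{w, z} | z. z \<in> {x, y}}" by auto
  show ?case unfolding eq one_perfectly_orientable_def
    using one_perfect_add_simplicial[OF _ D c_A2.hyps(3) cl] c_A2.IH by blast
qed

section \<open>Orientations and induced minors\<close>

lemma one_perfect_delete_vertex:
  assumes "graph G" "one_perfect_orientation G D"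
  shows "one_perfect_orientation (delete_vertex G v) {(a, b) \<in> D. a \<noteq> v \<and> b \<noteq> v}"
proof -
  let ?D = "{(a, b) \<in> D. a \<noteq> v \<and> b \<noteq> v}"
  have o1: "(a, b) \<in> D \<Longrightarrow> {a, b} \<in> edges G" for a b
    using assms(2) unfolding one_perfect_orientation_def orientation_iff by blast
  have o2: "{a, b} \<in> edges G \<Longrightarrow> (a, b) \<in> D \<longleftrightarrow> (b, a) \<notin> D" for a b
    using assms(2) unfolding one_perfect_orientation_def orientation_iff by blast
  have ed: "{a, b} \<in> edges (delete_vertex G v) \<longleftrightarrow> {a, b} \<in> edges G \<and> a \<noteq> v \<and> b \<noteq> v" for a b
    unfolding delete_vertex_def by auto
  have "orientation (delete_vertex G v) ?D"
    unfolding orientation_iff ed using o1 o2 by auto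
  moreover have "clique (delete_vertex G v) {w. (a, w) \<in> ?D}" if "a \<in> verts (delete_vertex G v)" for a
  proof -
    have "clique G {w. (a, w) \<in> D}"
      using assms(2) that unfolding one_perfect_orientation_def delete_vertex_def by auto
    then show ?thesis unfolding clique_def ed by (auto simp: delete_vertex_def)
  qed
  ultimately show ?thesis unfolding one_perfect_orientation_def by blast
qed

text \<open>If \<open>x \<rightarrow> y\<close> is contracted then every out-neighbour of \<open>x\<close> is adjacent to \<open>y\<close>, so the merged
  vertex can take over exactly the out-neighbours of \<open>y\<close>. Both orientations of the contracted edge
  have to be treated because the merged vertex keeps the name of its first end.\<close>

lemma one_perfect_contract:
  assumes G: "graph G" and D: "one_perfect_orientation G D" and uv: "{u, v} \<in> edges G" "u \<noteq> v"
  shows "one_perfectly_orientable (contract G u v)"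
proof -
  let ?C = "contract G u v"
  have o1: "(a, b) \<in> D \<Longrightarrow> {a, b} \<in> edges G" for a b
    using D unfolding one_perfect_orientation_def orientation_iff by blast
  have o2: "{a, b} \<in> edges G \<Longrightarrow> (a, b) \<in> D \<longleftrightarrow> (b, a) \<notin> D" for a b
    using D unfolding one_perfect_orientation_def orientation_iff by blast
  have V: "{a, b} \<in> edges G \<Longrightarrow> a \<in> verts G \<and> b \<in> verts G \<and> a \<noteq> b" for a b using graph_adj_verts[OF G] .
  have cl: "{b, c} \<in> edges G" if "(a, b) \<in> D" "(a, c) \<in> D" "b \<noteq> c" for a b c
    using D that o1 V unfolding one_perfect_orientation_def clique_def by blast
  \<comment> \<open>\<open>x\<close> is the tail and \<open>y\<close> the head of the contracted
    edge, whichever of them is \<open>u\<close>.\<close>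
  obtain x y where xy: "{x, y} = {u, v}" "(x, y) \<in> D"
    using o2[OF uv(1)] by (metis insert_commute)
  then have xy': "(x = u \<and> y = v) \<or> (x = v \<and> y = u)" by (simp add: doubleton_eq_iff)
  have ec: "{a, b} \<in> edges ?C \<longleftrightarrow> {a, b} \<in> edges G \<or> (a = u \<and> b \<noteq> u \<and> {v, b} \<in> edges G) \<or>
      (b = u \<and> a \<noteq> u \<and> {v, a} \<in> edges G)" if "a \<noteq> v" "b \<noteq> v" for a b
    using edges_contract[OF G uv(1) that] .
  have nv: "v \<notin> e" if "e \<in> edges ?C" for e using edges_contract_no_v[OF G uv(1) that] .
  have vC: "verts ?C = verts G - {v}" unfolding contract_def by simp
  \<comment> \<open>The arcs leaving \<open>u\<close> are those leaving \<open>y\<close>; all other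
    edges at \<open>u\<close> point to \<open>u\<close>, and the rest is inherited from
    \<open>D\<close>.\<close>
  define D' where "D' = {(a, b). a \<noteq> v \<and> b \<noteq> v \<and>
     (if a = u then b \<noteq> u \<and> (y, b) \<in> D
      else if b = u then {a, u} \<in> edges ?C \<and> (y, a) \<notin> D
      else (a, b) \<in> D)}"
  have yx: "(y, x) \<notin> D" using o2[of x y] o1[OF xy(2)] xy(2) by blast
  have y_edge: "{u, b} \<in> edges ?C" if "(y, b) \<in> D" "b \<noteq> u" "b \<noteq> v" for b
    using o1[OF that(1)] that ec[of u b] uv xy' by auto
  \<comment> \<open>If \<open>x\<close> points to \<open>a\<close>, then \<open>a\<close> and
    \<open>y\<close> are adjacent as out-neighbours of \<open>x\<close>, and since \<open>y\<close>
    does not point to \<open>a\<close>, the arc goes from \<open>a\<close> to \<open>y\<close>. So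
    each in-neighbour of the merged vertex already pointed to one of its two ends.\<close>
  have into: "(a, u) \<in> D \<or> (a, v) \<in> D" if "{a, u} \<in> edges ?C" "(y, a) \<notin> D" "a \<noteq> u" "a \<noteq> v" for a
  proof -
    have "{a, x} \<in> edges G \<or> {a, y} \<in> edges G"
      using ec[of a u] that uv xy' by (auto simp: insert_commute)
    moreover have "(a, y) \<in> D" if "{a, y} \<in> edges G" using o2[OF that] \<open>(y, a) \<notin> D\<close> by blast
    moreover have "{a, y} \<in> edges G" if "(x, a) \<in> D"
      using cl[OF that xy(2)] \<open>a \<noteq> u\<close> \<open>a \<noteq> v\<close> xy' by auto
    ultimately have "(a, x) \<in> D \<or> (a, y) \<in> D" using o2[of a x] by blast
    then show ?thesis using xy' by blast
  qed
  have or1: "{a, b} \<in> edges ?C" if "(a, b) \<in> D'" for a b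
    using that y_edge[of b] o1[of a b] ec[of a b] unfolding D'_def by (auto split: if_splits)
  have or2: "(a, b) \<in> D' \<longleftrightarrow> (b, a) \<notin> D'" if e: "{a, b} \<in> edges ?C" for a b
  proof -
    have ne: "a \<noteq> v" "b \<noteq> v" "a \<noteq> b" using nv[OF e] graph_adj_verts[OF graph_contract[OF G uv(1)] e] by auto
    consider "a = u" "b \<noteq> u" | "b = u" "a \<noteq> u" | "a \<noteq> u" "b \<noteq> u" using ne by blast
    then show ?thesis
    proof cases
      case 1
      then show ?thesis using e ne unfolding D'_def by (simp add: insert_commute)
    next
      case 2
      then show ?thesis using e ne unfolding D'_def by simp
    next
      case 3
      then have "{a, b} \<in> edges G" using ec[of a b] ne e by blast
      then show ?thesis using 3 ne o2 unfolding D'_def by simp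
    qed
  qed
  have cliq: "{b, c} \<in> edges ?C" if bc: "(a, b) \<in> D'" "(a, c) \<in> D'" "b \<noteq> c" for a b c
  proof (cases "a = u")
    case True
    then have "(y, b) \<in> D" "(y, c) \<in> D" "b \<noteq> v" "c \<noteq> v" using bc unfolding D'_def by auto
    then show ?thesis using cl[of y b c] bc ec[of b c] by blast
  next
    case False
    have ne: "a \<noteq> v" "b \<noteq> v" "c \<noteq> v" using bc unfolding D'_def by auto
    \<comment> \<open>Before the contraction \<open>a\<close> pointed to \<open>z\<close> and to one
      of \<open>u\<close> and \<open>v\<close>, so \<open>z\<close> is adjacent to that end and
      hence to the merged vertex.\<close>
    have main: "{z, u} \<in> edges ?C" if "(a, z) \<in> D'" "(a, u) \<in> D'" "z \<noteq> u" for z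
    proof -
      have "(a, z) \<in> D" "{a, u} \<in> edges ?C" "(y, a) \<notin> D" "z \<noteq> v"
        using that False unfolding D'_def by auto
      then have "{z, u} \<in> edges G \<or> {z, v} \<in> edges G"
        using into[of a] cl[of a z u] cl[of a z v] False ne that by blast
      then show ?thesis using ec[of z u] \<open>z \<noteq> v\<close> uv \<open>z \<noteq> u\<close> by (auto simp: insert_commute)
    qed
    consider "b = u" | "c = u" | "b \<noteq> u" "c \<noteq> u" by blast
    then show ?thesis
    proof cases
      case 1
      then show ?thesis using main[of c] bc by (simp add: insert_commute)
    next
      case 2
      then show ?thesis using main[of b] bc by simp
    next
      case 3
      then have "(a, b) \<in> D" "(a, c) \<in> D" using bc False unfolding D'_def by auto
      then show ?thesis using cl[of a b c] bc ec[OF ne(2,3)] by blast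
    qed
  qed
  have "clique ?C {w. (a, w) \<in> D'}" for a
    unfolding clique_def using cliq or1 graph_adj_verts[OF graph_contract[OF G uv(1)]] by blast
  then show ?thesis using or1 or2
    unfolding one_perfectly_orientable_def one_perfect_orientation_def orientation_iff by blast
qed

lemma induced_minor_orientable:
  "induced_minor_of H G \<Longrightarrow> graph G \<Longrightarrow> one_perfectly_orientable G \<Longrightarrow> graph H \<and> one_perfectly_orientable H"
proof (induction rule: induced_minor_of.induct)
  case (im_refl G)
  then show ?case by blast
next
  case (im_del H G v)
  then show ?case using graph_delete_vertex[of H v] one_perfect_delete_vertex[of H]
    unfolding one_perfectly_orientable_def by blast
next
  case (im_contr H G u v)
  then show ?case using graph_contract[of H u v] one_perfect_contract[of H]
    unfolding one_perfectly_orientable_def by blast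
qed

text \<open>Without triangles every out-neighbourhood has at most one element, so mapping each edge to its
  tail is injective.\<close>

lemma card_edges_le_verts:
  assumes "graph G" "one_perfectly_orientable G"
    and tf: "\<And>a b c. {a, b} \<in> edges G \<Longrightarrow> {a, c} \<in> edges G \<Longrightarrow> {b, c} \<in> edges G \<Longrightarrow> False"
  shows "card (edges G) \<le> card (verts G)"
proof -
  obtain D where D: "one_perfect_orientation G D" using assms(2) unfolding one_perfectly_orientable_def by blast
  have o1: "(a, b) \<in> D \<Longrightarrow> {a, b} \<in> edges G" for a b
    using D unfolding one_perfect_orientation_def orientation_iff by blast
  have o2: "{a, b} \<in> edges G \<Longrightarrow> (a, b) \<in> D \<longleftrightarrow> (b, a) \<notin> D" for a b
    using D unfolding one_perfect_orientation_def orientation_iff by blast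
  have fin: "finite (verts G)" using assms(1) unfolding graph_def by blast
  have V: "{a, b} \<in> edges G \<Longrightarrow> a \<in> verts G \<and> b \<in> verts G" for a b using graph_adj_verts[OF assms(1)] by blast
  have "b = c" if "(a, b) \<in> D" "(a, c) \<in> D" for a b c
  proof (rule ccontr)
    assume "b \<noteq> c"
    then have "{b, c} \<in> edges G"
      using D that o1 V unfolding one_perfect_orientation_def clique_def by blast
    then show False using tf o1 that by blast
  qed
  then have "inj_on fst D" unfolding inj_on_def by auto
  moreover have "fst p \<in> verts G" if "p \<in> D" for p using V[OF o1] that by (metis prod.collapse)
  then have "fst ` D \<subseteq> verts G" by blast
  ultimately have cD: "card D \<le> card (verts G)" and fD: "finite D"
    using card_inj_on_le[OF _ _ fin] inj_on_finite[OF _ _ fin] by blast+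
  have "edges G \<subseteq> (\<lambda>(a, b). {a, b}) ` D"
  proof
    fix e assume e: "e \<in> edges G"
    then obtain a b where ab: "e = {a, b}" using assms(1) unfolding graph_def by blast
    have "(a, b) \<in> D \<or> (b, a) \<in> D" using o2 e unfolding ab by blast
    then show "e \<in> (\<lambda>(a, b). {a, b}) ` D" unfolding ab by (force simp: insert_commute)
  qed
  then have "card (edges G) \<le> card D" using fD surj_card_le by blast
  then show ?thesis using cD by simp
qed

lemma isomorphic_orientable:
  fixes H :: "'b graph" and G :: "'a graph"
  assumes "isomorphic H G" "graph H" "one_perfectly_orientable G"
  shows "one_perfectly_orientable H"
proof -
  obtain f where f: "bij_betw f (verts H) (verts G)"
    "\<forall>u\<in>verts H. \<forall>v\<in>verts H. {u, v} \<in> edges H \<longleftrightarrow> {f u, f v} \<in> edges G"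
    using assms(1) unfolding isomorphic_def by blast
  obtain D where D: "one_perfect_orientation G D" using assms(3) unfolding one_perfectly_orientable_def by blast
  define D' where "D' = {(a, b). a \<in> verts H \<and> b \<in> verts H \<and> (f a, f b) \<in> D}"
  have fV: "f a \<in> verts G" if "a \<in> verts H" for a using f(1) that unfolding bij_betw_def by blast
  have fi: "f a \<noteq> f b" if "a \<in> verts H" "b \<in> verts H" "a \<noteq> b" for a b
    using f(1) that unfolding bij_betw_def inj_on_def by blast
  have o1: "(a, b) \<in> D \<Longrightarrow> {a, b} \<in> edges G" for a b
    using D unfolding one_perfect_orientation_def orientation_iff by blast
  have o2: "{a, b} \<in> edges G \<Longrightarrow> (a, b) \<in> D \<longleftrightarrow> (b, a) \<notin> D" for a b
    using D unfolding one_perfect_orientation_def orientation_iff by blast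
  have cl: "{b, c} \<in> edges G" if "a \<in> verts G" "(a, b) \<in> D" "(a, c) \<in> D" "b \<noteq> c" for a b c
    using D that unfolding one_perfect_orientation_def clique_def by blast
  have "orientation H D'"
    unfolding orientation_iff
  proof (intro conjI allI impI)
    show "{a, b} \<in> edges H" if "(a, b) \<in> D'" for a b using that o1 f(2) unfolding D'_def by auto
    show "(a, b) \<in> D' \<longleftrightarrow> (b, a) \<notin> D'" if "{a, b} \<in> edges H" for a b
    proof -
      have "a \<in> verts H" "b \<in> verts H" using graph_adj_verts[OF assms(2) that] by auto
      then show ?thesis using that f(2) o2 unfolding D'_def by auto
    qed
  qed
  moreover have "clique H {w. (v, w) \<in> D'}" if "v \<in> verts H" for v
    unfolding clique_def
  proof (intro conjI ballI impI)
    show "{w. (v, w) \<in> D'} \<subseteq> verts H" unfolding D'_def by blast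
    fix b c assume "b \<in> {w. (v, w) \<in> D'}" "c \<in> {w. (v, w) \<in> D'}" "b \<noteq> c"
    then have "b \<in> verts H" "c \<in> verts H" "(f v, f b) \<in> D" "(f v, f c) \<in> D" "b \<noteq> c" unfolding D'_def by auto
    then show "{b, c} \<in> edges H" using cl[OF fV[OF that]] fi f(2) by blast
  qed
  ultimately show ?thesis unfolding one_perfectly_orientable_def one_perfect_orientation_def by blast
qed

lemma not_induced_minor:
  fixes H :: "'b graph"
  assumes "graph G" "one_perfectly_orientable G" "graph H" "card (verts H) < card (edges H)"
    and "\<And>a b c. {a, b} \<in> edges H \<Longrightarrow> {a, c} \<in> edges H \<Longrightarrow> {b, c} \<in> edges H \<Longrightarrow> False"
  shows "\<not> has_induced_minor G H"
proof
  assume "has_induced_minor G H"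
  then obtain H' where "induced_minor_of H' G" "isomorphic H H'" unfolding has_induced_minor_def by blast
  then have "one_perfectly_orientable H"
    using induced_minor_orientable assms(1-3) isomorphic_orientable by blast
  then show False using card_edges_le_verts[OF assms(3) _ assms(5)] assms(4) by simp
qed

lemma graph_iff_card: "graph G \<longleftrightarrow> finite (verts G) \<and> (\<forall>e\<in>edges G. card e = 2 \<and> e \<subseteq> verts G)"
  unfolding graph_def card_2_iff by fastforce

text \<open>\<open>K23\<close>, \<open>F1\<close> and \<open>F2\<close> have 5, 6 and 7 vertices but
  6, 7 and 8 edges, and none has a triangle.\<close>

lemma orientable_induced_minor_free:
  assumes "graph G" "one_perfectly_orientable G"
  shows "\<not> has_induced_minor G K23" "\<not> has_induced_minor G F1" "\<not> has_induced_minor G F2"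
proof -
  show "\<not> has_induced_minor G K23"
  proof (rule not_induced_minor[OF assms])
    show "graph K23" unfolding graph_iff_card edges_K23 by simp
    show "card (verts K23) < card (edges K23)" by (simp add: edges_K23 doubleton_eq_iff)
  qed (simp add: edges_K23 doubleton_eq_iff; presburger)
  show "\<not> has_induced_minor G F1"
  proof (rule not_induced_minor[OF assms])
    show "graph F1" unfolding graph_iff_card edges_F1 by simp
    show "card (verts F1) < card (edges F1)" by (simp add: edges_F1 doubleton_eq_iff)
  qed (simp add: edges_F1 doubleton_eq_iff; presburger)
  show "\<not> has_induced_minor G F2"
  proof (rule not_induced_minor[OF assms])
    show "graph F2" unfolding graph_iff_card edges_F2 by simp
    show "card (verts F2) < card (edges F2)" by (simp add: edges_F2 doubleton_eq_iff)
  qed (simp add: edges_F2 doubleton_eq_iff; presburger)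
qed

section \<open>Blocks\<close>

lemma conn_edges_cong:
  assumes "\<And>a b. a \<in> X \<Longrightarrow> b \<in> X \<Longrightarrow> {a, b} \<in> E \<longleftrightarrow> {a, b} \<in> F"
  shows "conn E X \<longleftrightarrow> conn F X"
proof -
  have "linked E P (X - P) \<longleftrightarrow> linked F P (X - P)" if "P \<subseteq> X" for P
    using assms that unfolding linked_def by blast
  then show ?thesis unfolding conn_iff_linked by simp
qed

lemma subgraph_graph: "graph G \<Longrightarrow> subgraph B G \<Longrightarrow> graph B"
proof -
  assume G: "graph G" and B: "subgraph B G"
  have "finite (verts B)" using G B finite_subset unfolding graph_def subgraph_def by blast
  moreover have "card e = 2 \<and> e \<subseteq> verts B" if "e \<in> edges B" for e
    using G B that unfolding graph_iff_card subgraph_def by blast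
  ultimately show "graph B" unfolding graph_iff_card by blast
qed

lemma subgraph_trans: "subgraph A B \<Longrightarrow> subgraph B C \<Longrightarrow> subgraph A C"
  unfolding subgraph_def by blast

text \<open>For \<open>v\<close> outside \<open>H\<close> the last condition is connectedness again,
  so \<open>v\<close> may range freely.\<close>

lemma biconnected_iff:
  assumes "graph H"
  shows "biconnected H \<longleftrightarrow> verts H \<noteq> {} \<and> conn (edges H) (verts H) \<and> (\<forall>v. conn (edges H) (verts H - {v}))"
proof (cases "connected H")
  case False
  then show ?thesis using connected_iff_conn[OF assms] unfolding biconnected_def by blast
next
  case True
  have "\<not> cut_vertex H v \<longleftrightarrow> conn (edges H) (verts H - {v})" for v
  proof (cases "v \<in> verts H")
    case v: True
    let ?D = "delete_vertex H v"
    have vD: "verts ?D = verts H - {v}" unfolding delete_vertex_def by simp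
    have "reach H x y" if "x \<in> verts H" "y \<in> verts H" for x y using True that unfolding connected_def by blast
    then have "\<not> cut_vertex H v \<longleftrightarrow> (\<forall>x\<in>verts ?D. \<forall>y\<in>verts ?D. reach ?D x y)"
      using v unfolding cut_vertex_def vD by blast
    also have "\<dots> \<longleftrightarrow> conn (edges ?D) (verts ?D)" using conn_iff_reach[OF graph_delete_vertex[OF assms]] by blast
    also have "\<dots> \<longleftrightarrow> conn (edges H) (verts H - {v})"
      unfolding vD by (rule conn_edges_cong) (auto simp: delete_vertex_def)
    finally show ?thesis .
  next
    case False
    then show ?thesis using True connected_iff_conn[OF assms] unfolding cut_vertex_def by simp
  qed
  then show ?thesis using True connected_iff_conn[OF assms] unfolding biconnected_def by blast
qed

lemma biconnected_more_edges:
  assumes "graph (V, F)" "biconnected (V, E)" "graph (V, E)" "E \<subseteq> F"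
  shows "biconnected (V, F)"
  using assms(2) conn_mono[OF _ assms(4)] unfolding biconnected_iff[OF assms(1)] biconnected_iff[OF assms(3)]
  by simp

text \<open>Maximality under \<open>subgraph\<close> concerns edges as well as vertices, hence the
  sum of both cardinalities is maximized.\<close>

lemma biconnected_in_block:
  assumes G: "graph G" and H: "subgraph H G" "biconnected H"
  obtains B where "block G B" "subgraph H B"
proof -
  let ?P = "\<lambda>B. subgraph B G \<and> biconnected B \<and> subgraph H B"
  let ?f = "\<lambda>B. card (verts B) + card (edges B)"
  have fin: "finite (verts G)" "finite (edges G)"
  proof -
    show f: "finite (verts G)" using G unfolding graph_def by blast
    have "edges G \<subseteq> Pow (verts G)" using graph_edge_sub[OF G] by blast
    then show "finite (edges G)" using f finite_subset by blast
  qed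
  have finB: "finite (verts B)" "finite (edges B)" if "subgraph B G" for B
    using that fin finite_subset unfolding subgraph_def by blast+
  have "?f B < Suc (?f G)" if "?P B" for B
    using that fin unfolding subgraph_def by (simp add: add_mono card_mono less_Suc_eq_le)
  moreover have "?P H" using H unfolding subgraph_def by blast
  ultimately have "\<exists>B. ?P B \<and> (\<forall>B'. ?P B' \<longrightarrow> ?f B' \<le> ?f B)"
    by (intro ex_has_greatest_nat[of ?P H ?f "Suc (?f G)"]) blast+
  then obtain B where B: "?P B" "\<forall>B'. ?P B' \<longrightarrow> ?f B' \<le> ?f B" by blast
  have "B' = B" if "subgraph B' G" "biconnected B'" "subgraph B B'" for B'
  proof -
    have "?P B'" using that B(1) subgraph_trans by blast
    then have le: "?f B' \<le> ?f B" using B(2) by blast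
    have sub: "verts B \<subseteq> verts B'" "edges B \<subseteq> edges B'" using that(3) unfolding subgraph_def by auto
    note f' = finB[OF that(1)]
    have "card (verts B) \<le> card (verts B')" "card (edges B) \<le> card (edges B')"
      using sub f' card_mono by blast+
    then have "card (verts B) = card (verts B')" "card (edges B) = card (edges B')" using le by linarith+
    then have "verts B = verts B'" "edges B = edges B'" using sub f' card_subset_eq by blast+
    then show ?thesis unfolding verts_def edges_def by (simp add: prod_eq_iff)
  qed
  then have "block G B" using B(1) unfolding block_def by blast
  then show ?thesis using that B(1) by blast
qed

section \<open>Holes in 2-trees and in blocks\<close>

lemma hole_cong:
  assumes "\<And>a b. a \<in> set cs \<Longrightarrow> b \<in> set cs \<Longrightarrow> {a, b} \<in> E \<longleftrightarrow> {a, b} \<in> F"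
  shows "hole E cs \<longleftrightarrow> hole F cs"
proof -
  have "{cs ! i, cs ! j} \<in> E \<longleftrightarrow> {cs ! i, cs ! j} \<in> F" if "i < j" "j < length cs" for i j
    using assms that by simp
  then show ?thesis unfolding hole_iff_nth by simp
qed

lemma hole_nbrs_ex:
  assumes "hole E cs" "v \<in> set cs"
  shows "\<exists>a\<in>set cs. \<exists>b\<in>set cs. a \<noteq> b \<and> {v, a} \<in> E \<and> {v, b} \<in> E \<and> {a, b} \<notin> E"
proof -
  obtain a b where "a \<in> set cs" "b \<in> set cs" "a \<noteq> b" "{v, a} \<in> E" "{v, b} \<in> E" "{a, b} \<notin> E"
    "\<forall>z\<in>set cs. z \<noteq> v \<longrightarrow> {v, z} \<in> E \<longrightarrow> z = a \<or> z = b" by (rule hole_nbrs[OF assms])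
  then show ?thesis by blast
qed

lemma card_2_sub_pair: "card e = 2 \<Longrightarrow> e \<subseteq> {a, b} \<Longrightarrow> e = {a, b}"
  by (rule card_seteq) (simp_all add: card_insert_if)

lemma hole_verts:
  assumes "graph G" "hole (edges G) cs"
  shows "set cs \<subseteq> verts G"
proof
  fix v assume "v \<in> set cs"
  then obtain a where "{v, a} \<in> edges G" using hole_nbrs_ex[OF assms(2) \<open>v \<in> set cs\<close>] by blast
  then show "v \<in> verts G" using graph_adj_verts[OF assms(1)] by blast
qed

lemma hole_subgraph_biconnected:
  assumes "graph G" "hole (edges G) cs"
  shows "biconnected (set cs, {e \<in> edges G. e \<subseteq> set cs})" "subgraph (set cs, {e \<in> edges G. e \<subseteq> set cs}) G"
proof -
  let ?H = "(set cs, {e \<in> edges G. e \<subseteq> set cs})"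
  show sub: "subgraph ?H G" using hole_verts[OF assms] unfolding subgraph_def by auto
  have "conn {e \<in> edges G. e \<subseteq> set cs} X" if "conn (edges G) X" "X \<subseteq> set cs" for X
    using conn_edges_cong[of X "edges G" "{e \<in> edges G. e \<subseteq> set cs}"] that by blast
  moreover have "cs \<noteq> []" using assms(2) by auto
  ultimately show "biconnected ?H"
    using biconnected_iff[OF subgraph_graph[OF assms(1) sub]] conn_hole[OF assms(2)] conn_hole_remove[OF assms(2)]
    by simp
qed

text \<open>A vertex of a hole has two nonadjacent neighbours on it, whereas the only neighbours of
  \<open>w\<close> are the adjacent \<open>x\<close> and \<open>y\<close>. So extending a 2-tree or
  a hollowed 2-tree creates no hole.\<close>

lemma hole_add_simplicial:
  assumes G: "graph (V, E)" and xy: "{x, y} \<in> E" and w: "w \<notin> V"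
    and h: "hole (E \<union> {{w, x}, {w, y}}) cs"
  shows "hole E cs"
proof -
  have wE: "{w, a} \<notin> E" for a using graph_adj_verts[OF G, of w a] w by auto
  have wx: "w \<noteq> x" "w \<noteq> y" using wE[of y] wE[of x] xy by (auto simp: insert_commute)
  have "w \<notin> set cs"
  proof
    assume "w \<in> set cs"
    then obtain a b where ab: "a \<noteq> b" "{w, a} \<in> E \<union> {{w, x}, {w, y}}" "{w, b} \<in> E \<union> {{w, x}, {w, y}}"
        "{a, b} \<notin> E \<union> {{w, x}, {w, y}}" using hole_nbrs_ex[OF h \<open>w \<in> set cs\<close>] by meson
    then have "a = x \<or> a = y" "b = x \<or> b = y" using wE wx by (auto simp: doubleton_eq_iff)
    then show False using ab(1,4) xy by (auto simp: insert_commute)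
  qed
  then have "{a, b} \<in> E \<union> {{w, x}, {w, y}} \<longleftrightarrow> {a, b} \<in> E" if "a \<in> set cs" "b \<in> set cs" for a b
    using that by (auto simp: doubleton_eq_iff)
  then show ?thesis using h hole_cong[of cs "E \<union> {{w, x}, {w, y}}" E] by blast
qed

lemma graph_add_simplicial:
  assumes "graph (V, E)" "{x, y} \<in> E" "w \<notin> V"
  shows "graph (insert w V, E \<union> {{w, x}, {w, y}})"
proof -
  have V: "x \<in> V" "y \<in> V" using graph_adj_verts[OF assms(1), of x y] assms(2) by auto
  then have "w \<noteq> x" "w \<noteq> y" using assms(3) by auto
  then show ?thesis using V assms unfolding graph_iff_card by auto
qed

lemma two_tree_no_hole: "two_tree G \<Longrightarrow> graph G \<and> \<not> (\<exists>cs. hole (edges G) cs)"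
proof (induction rule: two_tree.induct)
  case (tt_base u v)
  have False if h: "hole {{u, v}} cs" for cs
  proof -
    have "cs \<noteq> []" using h by auto
    then have "hd cs \<in> set cs" by simp
    then obtain a b where "a \<noteq> b" "{hd cs, a} \<in> {{u, v}}" "{hd cs, b} \<in> {{u, v}}"
      using hole_nbrs_ex[OF h \<open>hd cs \<in> set cs\<close>] by blast
    then show False by (auto simp: doubleton_eq_iff)
  qed
  then show ?case using tt_base unfolding graph_iff_card by auto
next
  case (tt_step V E x y w)
  then have G: "graph (V, E)" by blast
  show ?case using graph_add_simplicial[OF G tt_step.hyps(2,3)]
      hole_add_simplicial[OF G tt_step.hyps(2,3)] tt_step.IH by auto
qed

text \<open>A hole missing a vertex of the cycle has an edge leaving it at some \<open>p\<close>,
  which then has three neighbours on the cycle: two on the hole and \<open>q\<close>.\<close>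

lemma hole_in_cycle:
  assumes "is_cycle G" "4 \<le> card (verts G)" "hole (edges G) ds"
  shows "set ds = verts G"
proof (rule ccontr)
  assume ne: "set ds \<noteq> verts G"
  obtain cs where cs: "hole (edges G) cs" "set cs = verts G" by (rule cycle_is_hole[OF assms(1,2)])
  have sub: "set ds \<subseteq> verts G" using hole_verts[OF graph_cycle[OF assms(1)] assms(3)] .
  have "set ds \<noteq> {}" using assms(3) by auto
  have "conn (edges G) (verts G)" using conn_hole[OF cs(1)] cs(2) by simp
  from this sub \<open>set ds \<noteq> {}\<close> ne obtain p q where pq: "p \<in> set ds" "q \<in> verts G" "q \<notin> set ds" "{p, q} \<in> edges G"
    by (rule connD)
  have "p \<in> set cs" using pq sub cs by blast
  then obtain a b where ab: "\<forall>z\<in>set cs. z \<noteq> p \<longrightarrow> {p, z} \<in> edges G \<longrightarrow> z = a \<or> z = b" using hole_nbrs[OF cs(1)] by metis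
  obtain c d where cd: "c \<in> set ds" "d \<in> set ds" "c \<noteq> d" "{p, c} \<in> edges G" "{p, d} \<in> edges G"
    using hole_nbrs_ex[OF assms(3) pq(1)] by blast
  have "c \<noteq> p" "d \<noteq> p" "q \<noteq> p" using graph_adj_verts[OF graph_cycle[OF assms(1)]] cd pq by blast+
  moreover have "c \<in> set cs" "d \<in> set cs" "q \<in> set cs" using cd pq sub cs(2) by auto
  ultimately have "c = a \<or> c = b" "d = a \<or> d = b" "q = a \<or> q = b" using ab cd(4,5) pq(4) by blast+
  then have "q = c \<or> q = d" using cd(3) by blast
  then show False using cd pq by blast
qed

lemma hollowed_two_tree_unique_hole:
  "hollowed_two_tree G \<Longrightarrow> graph G \<and>
     (\<forall>cs ds. hole (edges G) cs \<longrightarrow> hole (edges G) ds \<longrightarrow> set cs = set ds)"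
proof (induction rule: hollowed_two_tree.induct)
  case (htt_base G)
  then show ?case using hole_in_cycle graph_cycle by metis
next
  case (htt_step V E x y w)
  then have G: "graph (V, E)" by blast
  show ?case using graph_add_simplicial[OF G htt_step.hyps(2,3)]
      hole_add_simplicial[OF G htt_step.hyps(2,3)] htt_step.IH by auto
qed

text \<open>A hole with its edges is biconnected, so some block contains it, with all edges among
  its vertices. A block with a hole is neither a 2-tree nor \<open>K1\<close>, which leaves only a
  hollowed \<open>B0\<close>.\<close>

lemma blocks_unique_hole:
  assumes G: "graph G"
    and bl: "\<forall>B. block G B \<longrightarrow> two_tree B \<or> (B = B0 \<and> (is_K1 B \<or> hollowed_two_tree B))"
    and cs: "hole (edges G) cs" and ds: "hole (edges G) ds"
  shows "set cs = set ds"
proof -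
  have key: "hollowed_two_tree B0 \<and> hole (edges B0) zs" if h: "hole (edges G) zs" for zs
  proof -
    let ?H = "(set zs, {e \<in> edges G. e \<subseteq> set zs})"
    obtain B where B: "block G B" "subgraph ?H B"
      by (rule biconnected_in_block[OF G hole_subgraph_biconnected(2,1)[OF G h]])
    then have "{a, b} \<in> edges G \<longleftrightarrow> {a, b} \<in> edges B" if "a \<in> set zs" "b \<in> set zs" for a b
      using that unfolding block_def subgraph_def by auto
    then have hB: "hole (edges B) zs" using hole_cong[of zs "edges G" "edges B"] h by blast
    then have "\<not> two_tree B" using two_tree_no_hole by blast
    moreover have "\<not> is_K1 B"
    proof
      assume "is_K1 B"
      then have "edges B = {}" unfolding is_K1_def by auto
      then have "hole {} zs" using hB by simp
      moreover have "hd zs \<in> set zs" using hB by (cases zs) auto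
      ultimately show False using hole_nbrs_ex[of "{}" zs "hd zs"] by blast
    qed
    ultimately show ?thesis using bl B(1) hB by blast
  qed
  show ?thesis using key[OF cs] key[OF ds] hollowed_two_tree_unique_hole[of B0] by blast
qed

section \<open>How blocks change when a vertex is added\<close>

lemma biconnected_add_vertex:
  assumes G: "graph (V, E)" "biconnected (V, E)" and xy: "{x, y} \<in> E" and w: "w \<notin> V"
  shows "biconnected (insert w V, E \<union> {{w, x}, {w, y}})"
proof -
  let ?F = "E \<union> {{w, x}, {w, y}}"
  have V: "x \<in> V" "y \<in> V" "x \<noteq> y" using graph_adj_verts[OF G(1), of x y] xy by auto
  have c: "conn ?F V" "conn ?F (V - {v})" for v
    using G(2) conn_mono[of E _ ?F] unfolding biconnected_iff[OF G(1)] by auto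
  have ins: "conn ?F (insert w X)" if "conn ?F X" "x \<in> X \<or> y \<in> X" for X
    using that conn_insert[of ?F X x w] conn_insert[of ?F X y w] by blast
  have "conn ?F (insert w V - {v})" for v
  proof (cases "v = w")
    case True
    then have "insert w V - {v} = V" using w by blast
    then show ?thesis using c by simp
  next
    case False
    then have "insert w V - {v} = insert w (V - {v})" by blast
    \<comment> \<open>Since \<open>x\<close> and \<open>y\<close> differ, deleting \<open>v\<close>
      leaves \<open>w\<close> at least one of its neighbours.\<close>
    moreover have "x \<in> V - {v} \<or> y \<in> V - {v}" using V by blast
    ultimately show ?thesis using ins c(2) by metis
  qed
  then show ?thesis
    using biconnected_iff[OF graph_add_simplicial[OF G(1) xy w]] ins[OF c(1)] V by simp
qed

lemma biconnected_remove_vertex: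
  assumes G: "graph (W, F)" "biconnected (W, F)" and w: "w \<in> W" and xy: "{x, y} \<in> F" "x \<noteq> w" "y \<noteq> w"
    and nb: "\<And>z. {w, z} \<in> F \<Longrightarrow> z = x \<or> z = y"
  shows "biconnected (W - {w}, {e \<in> F. w \<notin> e})"
proof -
  let ?H = "(W - {w}, {e \<in> F. w \<notin> e})"
  have gH: "graph ?H" using graph_delete_vertex[OF G(1), of w] unfolding delete_vertex_def by simp
  have c: "conn F W" "conn F (W - {v})" for v using G(2) unfolding biconnected_iff[OF G(1)] by auto
  have rem: "conn {e \<in> F. w \<notin> e} (X - {w})" if "conn F X" for X
  proof -
    have "conn F (X - {w})"
    proof (rule conn_remove_simplicial[OF that])
      fix p q assume "p \<noteq> q" "{w, p} \<in> F" "{w, q} \<in> F"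
      then have "(p = x \<and> q = y) \<or> (p = y \<and> q = x)" using nb by blast
      then show "{p, q} \<in> F" using xy(1) by (auto simp: insert_commute)
    qed
    then show ?thesis using conn_edges_cong[of "X - {w}" F "{e \<in> F. w \<notin> e}"] by blast
  qed
  have "x \<in> W - {w}" using graph_adj_verts[OF G(1), of x y] xy by auto
  moreover have "conn {e \<in> F. w \<notin> e} (W - {w} - {v})" for v
  proof -
    have "W - {w} - {v} = W - {v} - {w}" by blast
    then show ?thesis using rem[OF c(2)[of v]] by metis
  qed
  ultimately show ?thesis using biconnected_iff[OF gH] rem[OF c(1)] by auto
qed

text \<open>Every biconnected subgraph of the smaller graph is one of the larger graph too, so
  maximality is inherited downwards.\<close>

lemma block_avoiding:
  assumes "block (insert w V, E \<union> {{w, x} | x. x \<in> N}) B" "w \<notin> verts B"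
  shows "block (V, E) B"
proof -
  have sB: "subgraph B (insert w V, E \<union> {{w, x} | x. x \<in> N})" using assms unfolding block_def by blast
  have "e \<in> E" if "e \<in> edges B" for e
  proof -
    have "e \<in> E \<union> {{w, x} | x. x \<in> N}" "e \<subseteq> verts B" using that sB unfolding subgraph_def by auto
    then show ?thesis using assms(2) by blast
  qed
  then have "subgraph B (V, E)" using assms(2) sB unfolding subgraph_def by auto
  moreover have "subgraph B' (insert w V, E \<union> {{w, x} | x. x \<in> N})" if "subgraph B' (V, E)" for B'
    using that unfolding subgraph_def by auto
  ultimately show ?thesis using assms(1) unfolding block_def by blast
qed

lemma biconnected_edge: "u \<noteq> v \<Longrightarrow> graph ({u, v}, {{u, v}}) \<and> biconnected ({u, v}, {{u, v}})"
proof -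
  assume ne: "u \<noteq> v"
  let ?G = "({u, v}, {{u, v}})"
  have g: "graph ?G" using ne unfolding graph_iff_card by auto
  have c: "conn {{u, v}} {u, v}" using conn_insert[of "{{u, v}}" "{v}" v u] by simp
  have c': "conn {{u, v}} ({u, v} - {z})" for z
  proof -
    have "z = u \<or> z = v \<or> {u, v} - {z} = {u, v}" by blast
    moreover have "{u, v} - {u} = {v}" "{u, v} - {v} = {u}" using ne by auto
    ultimately show ?thesis using c conn_singleton by metis
  qed
  show "graph ?G \<and> biconnected ?G" using g biconnected_iff[OF g] c c' by simp
qed

text \<open>\<open>X\<close> is empty or a single vertex, which treats plain connectedness and the
  deletion of one vertex together.\<close>

lemma biconnected_nbr:
  assumes "graph B" "biconnected B" "w \<in> verts B" "verts B - X \<noteq> {w}" "w \<notin> X" "X \<subseteq> {v}"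
  obtains b where "b \<in> verts B - X" "{w, b} \<in> edges B"
proof -
  have "X = {} \<or> X = {v}" using assms(6) by blast
  then have "conn (edges B) (verts B - X)" using assms(2) unfolding biconnected_iff[OF assms(1)] by auto
  moreover have "{w} \<subseteq> verts B - X" "{w} \<noteq> {}" "{w} \<noteq> verts B - X" using assms by auto
  ultimately obtain a b where "a \<in> {w}" "b \<in> verts B - X" "b \<notin> {w}" "{a, b} \<in> edges B" by (rule connD)
  then show ?thesis using that by blast
qed

text \<open>If a block through \<open>w\<close> had a vertex besides \<open>w\<close> and
  \<open>x\<close>, deleting \<open>x\<close> would isolate \<open>w\<close>. So by maximality this
  block is the new edge, a 2-tree, and the same \<open>B0\<close> still works.\<close>

lemma blocks_add_pendant:
  assumes G: "graph (V, E)" and x: "x \<in> V" and w: "w \<notin> V"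
    and bl: "\<forall>B. block (V, E) B \<longrightarrow> two_tree B \<or> (B = B0 \<and> (is_K1 B \<or> hollowed_two_tree B))"
    and B: "block (insert w V, insert {w, x} E) B"
  shows "two_tree B \<or> (B = B0 \<and> (is_K1 B \<or> hollowed_two_tree B))"
proof (cases "w \<in> verts B")
  case False
  have "insert {w, x} E = E \<union> {{w, z} | z. z \<in> {x}}" by auto
  then have "block (V, E) B" using block_avoiding[of w V E "{x}" B] False B by simp
  then show ?thesis using bl by blast
next
  case True
  let ?G = "(insert w V, insert {w, x} E)" and ?T = "({w, x}, {{w, x}})"
  have "w \<noteq> x" using x w by blast
  have gG: "graph ?G" using G x w \<open>w \<noteq> x\<close> unfolding graph_iff_card by auto
  have sB: "subgraph B ?G" "biconnected B"
    and mx: "\<And>B'. subgraph B' ?G \<Longrightarrow> biconnected B' \<Longrightarrow> subgraph B B' \<Longrightarrow> B' = B"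
    using B unfolding block_def by auto
  note gB = subgraph_graph[OF gG sB(1)]
  have nb: "b = x" if "{w, b} \<in> edges B" for b
  proof -
    have "{w, b} \<notin> E" using graph_adj_verts[OF G, of w b] w by auto
    then have "{w, b} = {w, x}" using that sB(1) unfolding subgraph_def by auto
    then show ?thesis using \<open>w \<noteq> x\<close> by (auto simp: doubleton_eq_iff)
  qed
  have "verts B \<subseteq> {w, x}"
  proof (rule ccontr)
    assume "\<not> ?thesis"
    then have "verts B - {x} \<noteq> {w}" by auto
    then obtain b where "b \<in> verts B - {x}" "{w, b} \<in> edges B"
      using biconnected_nbr[OF gB sB(2) True, of "{x}" x] \<open>w \<noteq> x\<close> by blast
    then show False using nb by blast
  qed
  moreover from this have "e = {w, x}" if "e \<in> edges B" for e
    using gB that unfolding graph_iff_card by (meson card_2_sub_pair subset_trans)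
  ultimately have "subgraph B ?T" using graph_edge_sub[OF gB] unfolding subgraph_def by auto
  moreover have "subgraph ?T ?G" using x unfolding subgraph_def by auto
  ultimately have "B = ?T" using mx biconnected_edge[OF \<open>w \<noteq> x\<close>] by blast
  then show ?thesis using tt_base[OF \<open>w \<noteq> x\<close>] by simp
qed

text \<open>A block through \<open>w\<close> is an old block containing the edge
  \<open>{x, y}\<close>, with \<open>w\<close> added, so its type carries over. The exceptional
  block is enlarged if it contains that edge, which is why the conclusion quantifies
  \<open>B0\<close> anew.\<close>

lemma blocks_add_simplicial:
  assumes G: "graph (V, E)" and xy: "{x, y} \<in> E" and w: "w \<notin> V"
    and bl: "\<forall>B. block (V, E) B \<longrightarrow> two_tree B \<or> (B = B0 \<and> (is_K1 B \<or> hollowed_two_tree B))"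
  shows "\<exists>B0. \<forall>B. block (insert w V, E \<union> {{w, x}, {w, y}}) B \<longrightarrow>
     two_tree B \<or> (B = B0 \<and> (is_K1 B \<or> hollowed_two_tree B))"
proof -
  let ?G = "(insert w V, E \<union> {{w, x}, {w, y}})"
  let ?add = "\<lambda>B. (insert w (verts B), edges B \<union> {{w, x}, {w, y}})"
  have V: "x \<in> V" "y \<in> V" "x \<noteq> y" using graph_adj_verts[OF G, of x y] xy by auto
  then have wxy: "w \<noteq> x" "w \<noteq> y" using w by auto
  note gG = graph_add_simplicial[OF G xy w]
  have wE: "{w, a} \<notin> E" for a using graph_adj_verts[OF G, of w a] w by auto
  have eqE: "E \<union> {{w, x}, {w, y}} = E \<union> {{w, z} | z. z \<in> {x, y}}" by auto
  have avoid: "block (V, E) B" if "block ?G B" "w \<notin> verts B" for B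
    using block_avoiding[of w V E "{x, y}" B] that unfolding eqE by blast
  have addsub: "subgraph (?add B) ?G \<and> biconnected (?add B) \<and> subgraph B (?add B)"
    if "subgraph B (V, E)" "biconnected B" "{x, y} \<in> edges B" for B
  proof -
    have gB: "graph (verts B, edges B)"
      using subgraph_graph[OF G that(1)] unfolding verts_def edges_def by simp
    have "w \<notin> verts B" using that(1) w unfolding subgraph_def by auto
    then have "biconnected (?add B)"
      using biconnected_add_vertex[OF gB _ that(3)] that(2) unfolding verts_def edges_def by simp
    moreover have "x \<in> verts B" "y \<in> verts B" using that(1,3) unfolding subgraph_def by auto
    ultimately show ?thesis using that(1) unfolding subgraph_def by auto
  qed
  have main: "\<exists>B1. B = ?add B1 \<and> block (V, E) B1 \<and> {x, y} \<in> edges B1 \<and> w \<notin> verts B1"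
    if B: "block ?G B" "w \<in> verts B" for B
  proof -
    obtain W F where WF: "B = (W, F)" by (cases B)
    have sB: "subgraph B ?G" "biconnected B"
      and mx: "\<And>B'. subgraph B' ?G \<Longrightarrow> biconnected B' \<Longrightarrow> subgraph B B' \<Longrightarrow> B' = B"
      using B unfolding block_def by auto
    note gB = subgraph_graph[OF gG sB(1)]
    have nb: "b = x \<or> b = y" if "{w, b} \<in> edges B" for b
    proof -
      have "{w, b} = {w, x} \<or> {w, b} = {w, y}" using that sB(1) wE unfolding subgraph_def by auto
      then show ?thesis by (auto simp: doubleton_eq_iff)
    qed
    let ?T = "(insert w {x, y}, {{x, y}} \<union> {{w, x}, {w, y}})"
    have eT: "graph ({x, y}, {{x, y}})" "biconnected ({x, y}, {{x, y}})" using biconnected_edge[OF V(3)] by blast+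
    have bT: "biconnected ?T" using biconnected_add_vertex[OF eT, of x y w] wxy by simp
    have sT: "subgraph ?T ?G" using V xy unfolding subgraph_def by auto
    \<comment> \<open>A block through \<open>w\<close> with only one of \<open>x\<close> and
      \<open>y\<close> would be confined to \<open>w\<close> and that vertex, hence lie properly
      inside the triangle \<open>?T\<close>.\<close>
    have both: "p \<in> W \<Longrightarrow> q \<in> W" if pq: "{p, q} = {x, y}" for p q
    proof (rule ccontr)
      assume p: "p \<in> W" and q: "q \<notin> W"
      have "p = x \<or> p = y" using pq by (auto simp: doubleton_eq_iff)
      then have "w \<noteq> p" using wxy by blast
      have Wp: "W \<subseteq> {w, p}"
      proof (rule ccontr)
        assume "\<not> ?thesis"
        then have "verts B - {p} \<noteq> {w}" unfolding WF by auto
        then obtain b where b: "b \<in> verts B - {p}" "{w, b} \<in> edges B"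
          using biconnected_nbr[OF gB sB(2) B(2), of "{p}" p] \<open>w \<noteq> p\<close> by blast
        then have "b = q" using nb[OF b(2)] pq by (auto simp: doubleton_eq_iff)
        then show False using b q WF by simp
      qed
      moreover have "e = {w, p}" if "e \<in> F" for e
      proof -
        have "card e = 2" "e \<subseteq> W" using gB that unfolding graph_iff_card WF by auto
        then show ?thesis using card_2_sub_pair Wp by (meson subset_trans)
      qed
      moreover have "{w, p} = {w, x} \<or> {w, p} = {w, y}" "p = x \<or> p = y" using pq by (auto simp: doubleton_eq_iff)
      ultimately have "subgraph B ?T" using graph_edge_sub[OF gB] unfolding subgraph_def WF by auto
      then have "B = ?T" using mx sT bT by blast
      then show False using q pq WF by (auto simp: doubleton_eq_iff)
    qed
    have "x \<in> W \<or> y \<in> W"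
    proof (cases "W = {w}")
      case True
      have "F = {}"
      proof (rule ccontr)
        assume "F \<noteq> {}"
        then obtain e where "e \<in> F" by blast
        then have "card e = 2" "e \<subseteq> {w}" using gB True unfolding graph_iff_card WF by auto
        then show False by (auto simp: card_2_iff)
      qed
      then have "subgraph B ?T" unfolding subgraph_def WF True by auto
      then have "B = ?T" using mx sT bT by blast
      then show ?thesis unfolding WF by auto
    next
      case False
      then obtain b where "b \<in> verts B - {}" "{w, b} \<in> edges B"
        using biconnected_nbr[OF gB sB(2) B(2), of "{}"] WF by auto
      then show ?thesis using nb[of b] WF by auto
    qed
    then have xW: "x \<in> W" "y \<in> W" using both[of x y] both[of y x] by (auto simp: insert_commute)
    \<comment> \<open>Adding edges between vertices already present keeps a graph biconnected, so
      maximality shows that \<open>B\<close> contains all three edges of the triangle.\<close>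
    let ?B2 = "(W, F \<union> {{x, y}, {w, x}, {w, y}})"
    have s2: "subgraph ?B2 ?G" using sB(1) xW B(2) xy unfolding subgraph_def WF by auto
    have "biconnected ?B2"
      using biconnected_more_edges[OF subgraph_graph[OF gG s2]] sB(2) gB unfolding WF by blast
    moreover have "subgraph B ?B2" using sB(1) unfolding subgraph_def WF by auto
    ultimately have "?B2 = B" using mx s2 by blast
    then have Fe: "{x, y} \<in> F" "{w, x} \<in> F" "{w, y} \<in> F" unfolding WF by auto
    let ?B1 = "(W - {w}, {e \<in> F. w \<notin> e})"
    have bi1: "biconnected ?B1"
      using biconnected_remove_vertex[of W F w x y] gB sB(2) B(2) Fe(1) wxy nb unfolding WF by auto
    have s1: "subgraph ?B1 (V, E)" using sB(1) unfolding subgraph_def WF by auto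
    have e1: "{x, y} \<in> edges ?B1" using Fe wxy by auto
    have "F = {e \<in> F. w \<notin> e} \<union> {{w, x}, {w, y}}"
    proof -
      have "e = {w, x} \<or> e = {w, y}" if "e \<in> F" "w \<in> e" for e
      proof -
        have "e \<in> E \<union> {{w, x}, {w, y}}" using that(1) sB(1) unfolding subgraph_def WF by auto
        moreover have "e \<notin> E" using that(2) graph_edge_sub[OF G] w by auto
        ultimately show ?thesis by blast
      qed
      then show ?thesis using Fe by blast
    qed
    moreover have "W = insert w (W - {w})" using B(2) WF by auto
    ultimately have Badd: "B = ?add ?B1" unfolding WF by simp
    \<comment> \<open>A biconnected \<open>B''\<close> above \<open>?B1\<close> contains
      \<open>{x, y}\<close>, so adding \<open>w\<close> to it gives a biconnected graph above
      \<open>B\<close>. By maximality that graph is \<open>B\<close>, and removing \<open>w\<close>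
      again yields \<open>?B1\<close>.\<close>
    have "B'' = ?B1" if B'': "subgraph B'' (V, E)" "biconnected B''" "subgraph ?B1 B''" for B''
    proof -
      have "{x, y} \<in> edges B''" using B''(3) e1 unfolding subgraph_def by blast
      then have a: "subgraph (?add B'') ?G" "biconnected (?add B'')" using addsub[OF B''(1,2)] by auto
      have "subgraph B (?add B'')"
        unfolding Badd using B''(1,3) Fe xW wxy unfolding subgraph_def by auto
      then have eq: "?add B'' = B" using mx a by blast
      have wB: "w \<notin> verts B''" "\<And>e. e \<in> edges B'' \<Longrightarrow> w \<notin> e" using B''(1) w unfolding subgraph_def by auto
      have "verts B'' = W - {w}" using eq wB(1) unfolding WF by auto
      moreover have "edges B'' = {e \<in> F. w \<notin> e}" using eq wB(2) unfolding WF by auto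
      ultimately show ?thesis unfolding verts_def edges_def by (simp add: prod_eq_iff)
    qed
    then have "block (V, E) ?B1" unfolding block_def using s1 bi1 by blast
    then show ?thesis using Badd e1 by (intro exI[of _ ?B1]) auto
  qed
  define B0' where "B0' = (if {x, y} \<in> edges B0 then ?add B0 else B0)"
  have "two_tree B \<or> (B = B0' \<and> (is_K1 B \<or> hollowed_two_tree B))" if B: "block ?G B" for B
  proof (cases "w \<in> verts B")
    case True
    then obtain B1 where B1: "B = ?add B1" "block (V, E) B1" "{x, y} \<in> edges B1" "w \<notin> verts B1"
      using main[OF B] by blast
    have B1eq: "B1 = (verts B1, edges B1)" unfolding verts_def edges_def by simp
    consider "two_tree B1" | "B1 = B0" "is_K1 B1" | "B1 = B0" "hollowed_two_tree B1" using bl B1(2) by blast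
    then show ?thesis
    proof cases
      case 1
      then have "two_tree (verts B1, edges B1)" using B1eq by simp
      then show ?thesis using tt_step[OF _ B1(3,4)] B1(1) by simp
    next
      case 2
      then show ?thesis using B1(3) unfolding is_K1_def by auto
    next
      case 3
      then have "hollowed_two_tree (verts B1, edges B1)" using B1eq by simp
      then have "hollowed_two_tree B" using htt_step[OF _ B1(3,4)] B1(1) by simp
      moreover have "B = B0'" using 3(1) B1(1,3) unfolding B0'_def by simp
      ultimately show ?thesis by blast
    qed
  next
    case False
    have bB: "block (V, E) B" by (rule avoid[OF B False])
    \<comment> \<open>Adding \<open>w\<close> to a block with the edge \<open>{x, y}\<close> would
      enlarge it, so a block that survives unchanged lacks this edge; if it is \<open>B0\<close>, it
      is also \<open>B0'\<close>.\<close>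
    moreover have "{x, y} \<notin> edges B"
    proof
      assume "{x, y} \<in> edges B"
      then have "subgraph (?add B) ?G \<and> biconnected (?add B) \<and> subgraph B (?add B)"
        using addsub[of B] bB unfolding block_def by blast
      then have "?add B = B" using B unfolding block_def by blast
      then have "insert w (verts B) = verts B" unfolding verts_def by (metis fst_conv)
      then show False using False by blast
    qed
    ultimately have "B0 = B \<longrightarrow> B0' = B" unfolding B0'_def by auto
    then show ?thesis using bl bB by blast
  qed
  then show ?thesis by blast
qed

lemma cycle_biconnected:
  assumes "is_cycle G" "4 \<le> card (verts G)"
  shows "biconnected G"
proof -
  obtain cs where cs: "hole (edges G) cs" "set cs = verts G" by (rule cycle_is_hole[OF assms])
  then show ?thesis
    using biconnected_iff[OF graph_cycle[OF assms(1)]] conn_hole[OF cs(1)] conn_hole_remove[OF cs(1)] by auto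
qed

text \<open>\<open>is_cycle\<close> admits triangles, which are 2-trees, whereas
  \<open>htt_base\<close> starts at length 4.\<close>

lemma triangle_two_tree:
  assumes "is_cycle G" "card (verts G) < 4"
  shows "two_tree G"
proof -
  obtain vs where vs: "distinct vs" "3 \<le> length vs" "verts G = set vs"
     "edges G = {{vs ! i, vs ! ((i + 1) mod length vs)} | i. i < length vs}"
    using assms(1) unfolding is_cycle_def by blast
  then have l: "length vs = 3" using assms(2) distinct_card[of vs] by simp
  then obtain a b c where abc: "vs = [a, b, c]"
    by (metis (no_types, opaque_lifting) length_0_conv length_Suc_conv numeral_3_eq_3)
  have "e \<in> edges G \<longleftrightarrow> e = {a, b} \<or> e = {b, c} \<or> e = {a, c}" for e
  proof -
    have "e \<in> edges G \<longleftrightarrow> (\<exists>i. Suc i < length vs \<and> e = {vs ! i, vs ! Suc i}) \<or> e = {vs ! 0, vs ! (length vs - 1)}"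
      unfolding vs(4) using cycle_edges_iff[of vs e] l by simp
    moreover have "(\<exists>i. Suc i < 3 \<and> P i) \<longleftrightarrow> P 0 \<or> P 1" for P :: "nat \<Rightarrow> bool"
      by (auto simp: less_Suc_eq numeral_3_eq_3)
    ultimately show ?thesis unfolding l by (simp add: abc)
  qed
  then have "edges G = {{a, b}} \<union> {{c, a}, {c, b}}" by (auto simp: insert_commute)
  moreover have "verts G = insert c {a, b}" using vs(3) abc by auto
  ultimately have "G = (insert c {a, b}, {{a, b}} \<union> {{c, a}, {c, b}})"
    unfolding verts_def edges_def by (simp add: prod_eq_iff)
  moreover have "two_tree (insert c {a, b}, {{a, b}} \<union> {{c, a}, {c, b}})"
    using tt_step[OF tt_base[of a b], of a b c] vs(1) abc by auto
  ultimately show ?thesis by simp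
qed

lemma block_of_biconnected:
  assumes "graph G" "biconnected G" "block G B"
  shows "B = G"
proof -
  have "subgraph G G" using graph_edge_sub[OF assms(1)] unfolding subgraph_def by blast
  then show ?thesis using assms(2,3) unfolding block_def by blast
qed

lemma two_tree_biconnected:
  assumes "two_tree G"
  shows "biconnected G"
  using assms
proof (induction rule: two_tree.induct)
  case (tt_base u v)
  then show ?case using biconnected_edge[OF tt_base] by blast
next
  case (tt_step V E x y w)
  have "graph (V, E)" using two_tree_no_hole[OF tt_step.hyps(1)] by blast
  then show ?case by (rule biconnected_add_vertex[OF _ tt_step.IH tt_step.hyps(2,3)])
qed

text \<open>\<open>K1\<close> and cycles of length at least 4 are their own exceptional blocks, and
  the two operations preserve the block condition.\<close>

lemma constructible_blocks:
  "A12_constructible G \<Longrightarrow> \<exists>B0. \<forall>B. block G B \<longrightarrow> two_tree B \<or> (B = B0 \<and> (is_K1 B \<or> hollowed_two_tree B))"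
proof (induction rule: A12_constructible.induct)
  case (c_K1 x)
  have "B = ({x}, {})" if "block ({x}, {}) B" for B
  proof -
    have "subgraph B ({x}, {})" "verts B \<noteq> {}"
      using that unfolding block_def biconnected_def connected_def by auto
    then have "verts B = {x}" "edges B = {}" unfolding subgraph_def by auto
    then show ?thesis unfolding verts_def edges_def by (simp add: prod_eq_iff)
  qed
  then show ?case unfolding is_K1_def by blast
next
  case (c_cycle G)
  show ?case
  proof (cases "4 \<le> card (verts G)")
    case True
    then show ?thesis using htt_base[OF c_cycle True]
        block_of_biconnected[OF graph_cycle[OF c_cycle] cycle_biconnected[OF c_cycle True]] by blast
  next
    case False
    then have "two_tree G" using triangle_two_tree[OF c_cycle] by simp
    then show ?thesis using block_of_biconnected[OF graph_cycle[OF c_cycle] two_tree_biconnected] by blast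
  qed
next
  case (c_A1 V E x w)
  then show ?case using blocks_add_pendant constructible_graph_orientable[OF c_A1.hyps(1)] by metis
next
  case (c_A2 V E x y w)
  then show ?case using blocks_add_simplicial constructible_graph_orientable[OF c_A2.hyps(1)] by metis
qed

theorem theorem5p4:
  fixes G :: "'a graph"
  assumes "graph G" and "connected G" and "\<not> has_minor G K4"
  shows "(one_perfectly_orientable G \<longleftrightarrow>
            \<not> has_induced_minor G K23 \<and> \<not> has_induced_minor G F1 \<and> \<not> has_induced_minor G F2)
       \<and> ((\<not> has_induced_minor G K23 \<and> \<not> has_induced_minor G F1 \<and> \<not> has_induced_minor G F2) \<longleftrightarrow>
            (\<exists>B0. \<forall>B. block G B \<longrightarrow>
                 two_tree B \<or> (B = B0 \<and> (is_K1 B \<or> hollowed_two_tree B))))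
       \<and> ((\<exists>B0. \<forall>B. block G B \<longrightarrow>
                 two_tree B \<or> (B = B0 \<and> (is_K1 B \<or> hollowed_two_tree B))) \<longleftrightarrow>
            A12_constructible G)"
    (is "(?orientable \<longleftrightarrow> ?free) \<and> (?free \<longleftrightarrow> ?blocks) \<and> (?blocks \<longleftrightarrow> ?constructible)")
proof -
  have "?constructible \<Longrightarrow> ?orientable"
    using constructible_graph_orientable by blast
  moreover have "?orientable \<Longrightarrow> ?free"
    using orientable_induced_minor_free[OF assms(1)] by blast
  moreover have "?free \<Longrightarrow> ?constructible"
    using induced_minor_free_constructible[OF assms] by blast
  moreover have "?constructible \<Longrightarrow> ?blocks"
    by (rule constructible_blocks)
  moreover have "?blocks \<Longrightarrow> ?constructible"
  proof -
    assume ?blocks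
    then obtain B0 where
      "\<forall>B. block G B \<longrightarrow> two_tree B \<or> (B = B0 \<and> (is_K1 B \<or> hollowed_two_tree B))" ..
    then show ?constructible
      by (intro unique_hole_constructible[OF assms] blocks_unique_hole[OF assms(1)])
  qed
  ultimately show ?thesis by blast
qed

end
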